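(* Any irreducible Whittaker module of type $\eta$ (i.e. a $U$-module generated by a nonzero vector $w$ with $xw=\eta(x)w$ for all $x\in U^+$) is isomorphic to one of: (a) $V(\eta;\kappa,c)=M(\eta)/W(\eta;\kappa,c)$ with $(\kappa,c)$ non-critical; (b) $V(\eta;\kappa,c)/V(\eta;\kappa_-,c_-)\cong V(\eta;\kappa,c)/\widetilde W_-(\eta;\kappa,c)\cong M(\eta)/\widehat W_-(\eta;\kappa,c)$ with $(\kappa,c)$ critical.
   Context: Let $q\in\mathbb{C}$ be nonzero and not a root of unity, and $U=U_q(\mathfrak{sl}_3)$ the algebra generated by $E_1,E_2,F_1,F_2,K_1^{\pm1},K_2^{\pm1}$ with the Jimbo relations. Put $F_3=F_1F_2-qF_2F_1$, $K=K_1K_2^2$, $C_1=F_1E_1+\frac{qK_1+q^{-1}K_1^{-1}}{(q-q^{-1})^2}$. Let $U^+$ be the subalgebra generated by $E_1,E_2$, $\eta:U^+\to\mathbb{C}$ the algebra homomorphism with $\eta(E_1)=\alpha\neq0$, $\eta(E_2)=0$, and $M(\eta)=U\otimes_{U^+}\mathbb{C}v_\eta$ with $xv_\eta=\eta(x)v_\eta$. Write $[k]=\frac{q^k-q^{-k}}{q-q^{-1}}$, $[k]!=[k]\cdots[1]$, $[0]!=1$, $\genfrac{[}{]}{0pt}{}{n}{k}=\frac{[n]!}{[k]![n-k]!}$ for $0\le k\le n$ (0 otherwise). For $n\in\mathbb{Z}_+$, $l\in\mathbb{Z}$, $Q\in\mathbb{C}[K^{\pm1},C_1]$, $u(n,l,Q)=q^{2nl}K_2^l\sum_{k=0}^{n}\sum_{j=0}^{n-k}a_{kj}(n)F_2^{n-k}F_3^kK_2^{2j}K^{-2j-k}Qv_\eta$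 with $a_{kj}(n)=(-1)^j\alpha^k(q^2-1)^kq^{j(n-3)}q^{\frac{1}{2}k(2n+2j+k-7)}\genfrac{[}{]}{0pt}{}{n}{k}\genfrac{[}{]}{0pt}{}{n-k}{j}$. For $n\in\mathbb{N}$, $h_n(K,C_1)=q^{3-2n}K+q^{2n-3}K^{-1}-(q-q^{-1})^2C_1$; $(\kappa,c)\in\mathbb{C}^2$, $\kappa\ne0$, is critical if $h_n(\kappa,c)=0$ for some $n\in\mathbb{N}$ and non-critical otherwise; for critical $(\kappa,c)$, $n_-$ is the smallest such $n$ (at most two exist), $\kappa_-=q^{-3n_-}\kappa$, $c_-=\frac{q^{n_--3}\kappa^{-1}+q^{3-n_-}\kappa}{(q-q^{-1})^2}$. $J(\kappa,c)$ is the ideal generated by $K-\kappa$, $C_1-c$; $W(\eta;\kappa,c)=UJ(\kappa,c)v_\eta$, $V(\eta;\kappa,c)=M(\eta)/W(\eta;\kappa,c)$. $u_-=u(n_-,0,1)$, $\widehat W_-(\eta;\kappa,c)=Uu_-+W(\eta;\kappa,c)$, $\widetilde W_-(\eta;\kappa,c)=\widehat W_-(\eta;\kappa,c)/W(\eta;\kappa,c)\subseteq V(\eta;\kappa,c)$, which is isomorphic to $V(\eta;\kappa_-,c_-)$. *)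

theory Defs
  imports Complex_Main
begin

datatype gen = E1 | E2 | F1 | F2 | K1 | K2 | K1i | K2i
  (* K1i, K2i stand for the generators K_1^{-1}, K_2^{-1} *)

text \<open>Noncommutative polynomials: finitely supported functions on words.
  The word [g1,...,gm] stands for the product g1 * ... * gm.\<close>
type_synonym nc = "gen list \<Rightarrow> complex"

definition ncfin :: "nc \<Rightarrow> bool" where
  "ncfin f \<longleftrightarrow> finite {w. f w \<noteq> 0}"

definition ncc :: "complex \<Rightarrow> nc" where
  "ncc c = (\<lambda>w. if w = [] then c else 0)"

definition ncw :: "gen list \<Rightarrow> nc" where
  "ncw m = (\<lambda>w. if w = m then 1 else 0)"

definition ncg :: "gen \<Rightarrow> nc" where
  "ncg g = ncw [g]"

definition ncadd :: "nc \<Rightarrow> nc \<Rightarrow> nc" where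
  "ncadd f g = (\<lambda>w. f w + g w)"

definition ncsc :: "complex \<Rightarrow> nc \<Rightarrow> nc" where
  "ncsc c f = (\<lambda>w. c * f w)"

definition ncsub :: "nc \<Rightarrow> nc \<Rightarrow> nc" where
  "ncsub f g = ncadd f (ncsc (-1) g)"

definition ncmul :: "nc \<Rightarrow> nc \<Rightarrow> nc" where
  "ncmul f g = (\<lambda>w. \<Sum>i\<le>length w. f (take i w) * g (drop i w))"

definition ncpow :: "nc \<Rightarrow> nat \<Rightarrow> nc" where
  "ncpow f n = (ncmul f ^^ n) (ncc 1)"

definition ncsum :: "('i \<Rightarrow> nc) \<Rightarrow> 'i set \<Rightarrow> nc" where
  "ncsum F A = (\<lambda>w. \<Sum>x\<in>A. F x w)"

inductive_set ncspan :: "nc set \<Rightarrow> nc set" for X where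
  ncspan_zero: "ncc 0 \<in> ncspan X"
| ncspan_base: "x \<in> X \<Longrightarrow> x \<in> ncspan X"
| ncspan_add: "x \<in> ncspan X \<Longrightarrow> y \<in> ncspan X \<Longrightarrow> ncadd x y \<in> ncspan X"
| ncspan_scale: "x \<in> ncspan X \<Longrightarrow> ncsc c x \<in> ncspan X"

definition Eg :: "nat \<Rightarrow> gen" where "Eg i = (if i = 1 then E1 else E2)"
definition Fg :: "nat \<Rightarrow> gen" where "Fg i = (if i = 1 then F1 else F2)"
definition Kg :: "nat \<Rightarrow> gen" where "Kg i = (if i = 1 then K1 else K2)"
definition Kig :: "nat \<Rightarrow> gen" where "Kig i = (if i = 1 then K1i else K2i)"
definition cartan :: "nat \<Rightarrow> nat \<Rightarrow> int" where "cartan i j = (if i = j then 2 else -1)"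

definition Uq_rels :: "complex \<Rightarrow> nc set" where
  "Uq_rels q =
     {ncsub (ncmul (ncg (Kg i)) (ncg (Kig i))) (ncc 1) | i. i \<in> {1,2}}
   \<union> {ncsub (ncmul (ncg (Kig i)) (ncg (Kg i))) (ncc 1) | i. i \<in> {1,2}}
   \<union> {ncsub (ncmul (ncg K1) (ncg K2)) (ncmul (ncg K2) (ncg K1))}
   \<union> {ncsub (ncmul (ncmul (ncg (Kg i)) (ncg (Eg j))) (ncg (Kig i)))
            (ncsc (q powi cartan i j) (ncg (Eg j))) | i j. i \<in> {1,2} \<and> j \<in> {1,2}}
   \<union> {ncsub (ncmul (ncmul (ncg (Kg i)) (ncg (Fg j))) (ncg (Kig i)))
            (ncsc (q powi (- cartan i j)) (ncg (Fg j))) | i j. i \<in> {1,2} \<and> j \<in> {1,2}}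
   \<union> {ncsub (ncsub (ncmul (ncg (Eg i)) (ncg (Fg j))) (ncmul (ncg (Fg j)) (ncg (Eg i))))
            (if i = j then ncsc (1 / (q - inverse q)) (ncsub (ncg (Kg i)) (ncg (Kig i))) else ncc 0)
        | i j. i \<in> {1,2} \<and> j \<in> {1,2}}
   \<union> {ncadd (ncsub (ncw [Eg i, Eg i, Eg j]) (ncsc (q + inverse q) (ncw [Eg i, Eg j, Eg i])))
            (ncw [Eg j, Eg i, Eg i]) | i j. i \<in> {1,2} \<and> j \<in> {1,2} \<and> i \<noteq> j}
   \<union> {ncadd (ncsub (ncw [Fg i, Fg i, Fg j]) (ncsc (q + inverse q) (ncw [Fg i, Fg j, Fg i])))
            (ncw [Fg j, Fg i, Fg i]) | i j. i \<in> {1,2} \<and> j \<in> {1,2} \<and> i \<noteq> j}"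

primrec wact :: "(gen \<Rightarrow> 'v \<Rightarrow> 'v) \<Rightarrow> gen list \<Rightarrow> 'v \<Rightarrow> 'v" where
  "wact \<rho> [] v = v"
| "wact \<rho> (g # w) v = \<rho> g (wact \<rho> w v)"

definition act :: "(complex \<Rightarrow> 'v::ab_group_add \<Rightarrow> 'v) \<Rightarrow> (gen \<Rightarrow> 'v \<Rightarrow> 'v) \<Rightarrow> nc \<Rightarrow> 'v \<Rightarrow> 'v" where
  "act scale \<rho> f v = (\<Sum>w\<in>{w. f w \<noteq> 0}. scale (f w) (wact \<rho> w v))"

definition Uq_module :: "complex \<Rightarrow> (complex \<Rightarrow> 'v::ab_group_add \<Rightarrow> 'v) \<Rightarrow> (gen \<Rightarrow> 'v \<Rightarrow> 'v) \<Rightarrow> bool" where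
  "Uq_module q scale \<rho> \<longleftrightarrow> vector_space scale \<and>
     (\<forall>g. Vector_Spaces.linear scale scale (\<rho> g)) \<and>
     (\<forall>r\<in>Uq_rels q. \<forall>v. act scale \<rho> r v = 0)"

definition irreducible_Umod :: "(complex \<Rightarrow> 'v::ab_group_add \<Rightarrow> 'v) \<Rightarrow> (gen \<Rightarrow> 'v \<Rightarrow> 'v) \<Rightarrow> bool" where
  "irreducible_Umod scale \<rho> \<longleftrightarrow> (UNIV :: 'v set) \<noteq> {0} \<and>
     (\<forall>S. module.subspace scale S \<and> (\<forall>g. \<rho> g ` S \<subseteq> S) \<longrightarrow> S = {0} \<or> S = UNIV)"

text \<open>Whittaker module of type eta (eta(E1) = alpha, eta(E2) = 0):
  generated by a nonzero vector w with E1 w = alpha w, E2 w = 0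
  (equivalently x w = eta(x) w for all x in U^+).\<close>
definition whittaker_Umod :: "complex \<Rightarrow> (complex \<Rightarrow> 'v::ab_group_add \<Rightarrow> 'v) \<Rightarrow> (gen \<Rightarrow> 'v \<Rightarrow> 'v) \<Rightarrow> bool" where
  "whittaker_Umod \<alpha> scale \<rho> \<longleftrightarrow> (\<exists>w. w \<noteq> 0 \<and> \<rho> E1 w = scale \<alpha> w \<and> \<rho> E2 w = 0 \<and>
     {act scale \<rho> f w | f. ncfin f} = UNIV)"

text \<open>V is isomorphic to the cyclic quotient F/L of the free algebra by the left ideal L
  (L contains the two-sided ideal of relations, so F/L is a U-module):
  there is a vector w such that f \<mapsto> f w is onto V with kernel exactly L.\<close>
definition iso_to_quot :: "(complex \<Rightarrow> 'v::ab_group_add \<Rightarrow> 'v) \<Rightarrow> (gen \<Rightarrow> 'v \<Rightarrow> 'v) \<Rightarrow> nc set \<Rightarrow> bool" where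
  "iso_to_quot scale \<rho> L \<longleftrightarrow> (\<exists>w. {act scale \<rho> f w | f. ncfin f} = UNIV \<and>
     (\<forall>f. ncfin f \<longrightarrow> (act scale \<rho> f w = 0 \<longleftrightarrow> f \<in> L)))"

definition Kel :: nc where "Kel = ncw [K1, K2, K2]"
definition Kinvel :: nc where "Kinvel = ncw [K2i, K2i, K1i]"
definition Kpow :: "int \<Rightarrow> nc" where
  "Kpow m = (if m \<ge> 0 then ncpow Kel (nat m) else ncpow Kinvel (nat (- m)))"

definition C1el :: "complex \<Rightarrow> nc" where
  "C1el q = ncadd (ncw [F1, E1])
     (ncsc (1 / (q - inverse q)^2) (ncadd (ncsc q (ncg K1)) (ncsc (inverse q) (ncg K1i))))"

definition F3el :: "complex \<Rightarrow> nc" where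
  "F3el q = ncsub (ncw [F1, F2]) (ncsc q (ncw [F2, F1]))"

definition qint :: "complex \<Rightarrow> nat \<Rightarrow> complex" where
  "qint q k = (q ^ k - inverse q ^ k) / (q - inverse q)"
definition qfact :: "complex \<Rightarrow> nat \<Rightarrow> complex" where
  "qfact q n = (\<Prod>k\<in>{1..n}. qint q k)"
definition qbin :: "complex \<Rightarrow> nat \<Rightarrow> nat \<Rightarrow> complex" where
  "qbin q n k = (if k \<le> n then qfact q n / (qfact q k * qfact q (n - k)) else 0)"

text \<open>The exponent k(2n+2j+k-7)/2 is always an integer (k(k-7) is even).\<close>
definition acoef :: "complex \<Rightarrow> complex \<Rightarrow> nat \<Rightarrow> nat \<Rightarrow> nat \<Rightarrow> complex" where
  "acoef q \<alpha> n k j = (-1) ^ j * \<alpha> ^ k * (q^2 - 1) ^ k * q powi (int j * (int n - 3))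
     * q powi ((int k * (2 * int n + 2 * int j + int k - 7)) div 2)
     * qbin q n k * qbin q (n - k) j"

text \<open>The element of U whose image on v_eta is u(n,0,1).\<close>
definition uel :: "complex \<Rightarrow> complex \<Rightarrow> nat \<Rightarrow> nc" where
  "uel q \<alpha> n = ncsum (\<lambda>(k, j). ncsc (acoef q \<alpha> n k j)
       (ncmul (ncpow (ncg F2) (n - k)) (ncmul (ncpow (F3el q) k)
         (ncmul (ncpow (ncg K2) (2 * j)) (Kpow (- 2 * int j - int k))))))
     {(k, j). k \<le> n \<and> j \<le> n - k}"

definition hfun :: "complex \<Rightarrow> nat \<Rightarrow> complex \<Rightarrow> complex \<Rightarrow> complex" where
  "hfun q n \<kappa> c = q powi (3 - 2 * int n) * \<kappa> + q powi (2 * int n - 3) * inverse \<kappa>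
     - (q - inverse q)^2 * c"

definition critical :: "complex \<Rightarrow> complex \<Rightarrow> complex \<Rightarrow> bool" where
  "critical q \<kappa> c \<longleftrightarrow> (\<exists>n::nat. n \<ge> 1 \<and> hfun q n \<kappa> c = 0)"

definition nminus :: "complex \<Rightarrow> complex \<Rightarrow> complex \<Rightarrow> nat" where
  "nminus q \<kappa> c = (LEAST n::nat. n \<ge> 1 \<and> hfun q n \<kappa> c = 0)"

section \<open>Kernels of F \<rightarrow> V(eta;kappa,c) and F \<rightarrow> M(eta)/What_-(eta;kappa,c)\<close>

definition eta_word :: "complex \<Rightarrow> gen list \<Rightarrow> complex" where
  "eta_word \<alpha> m = (if set m \<subseteq> {E1} then \<alpha> ^ length m else 0)"

definition L_M :: "complex \<Rightarrow> complex \<Rightarrow> nc set" where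
  "L_M q \<alpha> =
     {ncmul (ncmul a r) b | a r b. ncfin a \<and> ncfin b \<and> r \<in> Uq_rels q}
   \<union> {ncmul a (ncsub (ncw m) (ncc (eta_word \<alpha> m))) | a m. ncfin a \<and> set m \<subseteq> {E1, E2}}"

text \<open>Generators of U J(kappa,c): J is the ideal of C[K^{\<plusminus>1},C_1] generated by K-kappa, C_1-c.\<close>
definition L_J :: "complex \<Rightarrow> complex \<Rightarrow> complex \<Rightarrow> nc set" where
  "L_J q \<kappa> c =
     {ncmul a (ncmul (ncsub Kel (ncc \<kappa>)) (ncmul (Kpow m) (ncpow (C1el q) n))) | a m n. ncfin a}
   \<union> {ncmul a (ncmul (ncsub (C1el q) (ncc c)) (ncmul (Kpow m) (ncpow (C1el q) n))) | a m n. ncfin a}"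

definition LV :: "complex \<Rightarrow> complex \<Rightarrow> complex \<Rightarrow> complex \<Rightarrow> nc set" where
  "LV q \<alpha> \<kappa> c = ncspan (L_M q \<alpha> \<union> L_J q \<kappa> c)"

definition LVminus :: "complex \<Rightarrow> complex \<Rightarrow> complex \<Rightarrow> complex \<Rightarrow> nc set" where
  "LVminus q \<alpha> \<kappa> c = ncspan (L_M q \<alpha> \<union> L_J q \<kappa> c
       \<union> {ncmul a (uel q \<alpha> (nminus q \<kappa> c)) | a. ncfin a})"

end

(* Let Y be a space of vectors y with E1 y = alpha y, E2 y = 0 that is stable under K, K^-1 and C1.
   The vectors F2^a F3^b K2^l y with y in Y span a submodule.  Assume that a nontrivial
   combination of such vectors vanishes.  Subtracting multiples with the help of E1 one may assume
   that the coefficient of the highest power F3^n is concentrated in a single power of K2, and then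
   E1 and E2 force h_n(K, C1) to kill this coefficient.  Hence there are no relations at all in the
   non-critical case, and none among the vectors with b < n_- in the critical case, where u_- removes
   the higher powers of F3; this determines the annihilator of a Whittaker vector that is an
   eigenvector of K and C1.  Such an eigenvector exists because a nonzero complex vector space of
   countable dimension admits no operator T for which all T - r are bijective. *)
theory Submission
  imports Defs "HOL-Library.Function_Algebras" "HOL-Library.Countable_Set"
    "HOL-Analysis.Continuum_Not_Denumerable" "HOL-Computational_Algebra.Fundamental_Theorem_Algebra"
begin

subsection \<open>Noncommutative polynomials\<close>

text \<open>Independence has to be extracted from the defining relations on the given module alone,
  with no basis of U at hand. It is stated over spaces Y because no eigenvector is known at that
  stage; in fact it produces the eigenvector. If T commutes with K and C1 and has no eigenvector in
  Y, then (T - r)Y is a nonzero space of the same kind, generates the module by irreducibility, and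
  by comparison of coefficients equals Y for every r. Independence may fail because some h_n(K, C1)
  has a kernel. The vectors u(n,0,1) over this kernel then either vanish, which leaves only the
  powers of F3 below n, or give Whittaker vectors killed by h_m at m = -n, and on these the h_m with
  m \<ge> 1 are injective as long as K has no eigenvector. For the annihilator, spanning is proved
  in the quotient of the free algebra by the ideal, independence in the given module. That u_- acts
  as zero in the critical case is a matter of eigenvalues of K: on the submodule generated by u_-
  they are q^(-3(n_- + d)) \<kappa> with d \<ge> 0, never \<kappa>.\<close>

lemma ncfin_ncc [simp]: "ncfin (ncc c)"
  unfolding ncfin_def ncc_def by (rule finite_subset[of _ "{[]}"]) auto

lemma ncfin_ncw [simp]: "ncfin (ncw m)"
  unfolding ncfin_def ncw_def by (rule finite_subset[of _ "{m}"]) auto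

lemma ncfin_ncg [simp]: "ncfin (ncg g)"
  by (simp add: ncg_def)

lemma ncfin_ncadd [simp]: "ncfin f \<Longrightarrow> ncfin g \<Longrightarrow> ncfin (ncadd f g)"
  unfolding ncfin_def ncadd_def
  by (rule finite_subset[of _ "{w. f w \<noteq> 0} \<union> {w. g w \<noteq> 0}"]) auto

lemma ncfin_ncsc [simp]: "ncfin f \<Longrightarrow> ncfin (ncsc c f)"
  unfolding ncfin_def ncsc_def by (rule finite_subset[of _ "{w. f w \<noteq> 0}"]) auto

lemma ncfin_ncsub [simp]: "ncfin f \<Longrightarrow> ncfin g \<Longrightarrow> ncfin (ncsub f g)"
  by (simp add: ncsub_def)

lemma ncfin_ncmul [simp]:
  assumes "ncfin f" "ncfin g" shows "ncfin (ncmul f g)"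
proof -
  have "{w. ncmul f g w \<noteq> 0} \<subseteq> (\<lambda>(u, v). u @ v) ` ({w. f w \<noteq> 0} \<times> {w. g w \<noteq> 0})"
  proof
    fix w assume "w \<in> {w. ncmul f g w \<noteq> 0}"
    then obtain i where "f (take i w) * g (drop i w) \<noteq> 0"
      unfolding ncmul_def by (auto elim: sum.not_neutral_contains_not_neutral)
    then have "(take i w, drop i w) \<in> {w. f w \<noteq> 0} \<times> {w. g w \<noteq> 0}" by simp
    then show "w \<in> (\<lambda>(u, v). u @ v) ` ({w. f w \<noteq> 0} \<times> {w. g w \<noteq> 0})"
      by (rule rev_image_eqI) simp
  qed
  then show ?thesis
    using assms unfolding ncfin_def by (meson finite_SigmaI finite_imageI finite_subset)
qed

lemma ncfin_ncpow [simp]: "ncfin f \<Longrightarrow> ncfin (ncpow f n)"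
  unfolding ncpow_def by (induction n) auto

lemma ncfin_ncsum [simp]:
  assumes "\<And>x. x \<in> A \<Longrightarrow> ncfin (F x)" shows "ncfin (ncsum F A)"
proof (cases "finite A")
  case True
  then have "finite (\<Union>x\<in>A. {w. F x w \<noteq> 0})" using assms by (auto simp: ncfin_def)
  then show ?thesis unfolding ncfin_def
    by (rule finite_subset[rotated])
      (auto simp: ncsum_def elim: sum.not_neutral_contains_not_neutral)
qed (simp add: ncfin_def ncsum_def)

lemma ncfin_induct [consumes 1, case_names zero add]:
  assumes "ncfin f"
    and "P (ncc 0)"
    and "\<And>c m f. ncfin f \<Longrightarrow> P f \<Longrightarrow> P (ncadd (ncsc c (ncw m)) f)"
  shows "P f"
proof -
  have "P f" if "finite S" "{w. f w \<noteq> 0} = S" for S f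
    using that
  proof (induction S arbitrary: f)
    case empty
    then have "f = ncc 0" by (auto simp: ncc_def fun_eq_iff)
    then show ?case using assms(2) by simp
  next
    case (insert m S)
    define g where "g = f(m := 0)"
    have S: "{w. g w \<noteq> 0} = S" using insert.hyps insert.prems by (auto simp: g_def)
    then have "P g" by (rule insert.IH)
    moreover have "f = ncadd (ncsc (f m) (ncw m)) g"
      by (auto simp: g_def ncadd_def ncsc_def ncw_def fun_eq_iff)
    moreover have "ncfin g" using insert.hyps S by (simp add: ncfin_def)
    ultimately show ?case using assms(3) by metis
  qed
  then show ?thesis using assms(1) by (auto simp: ncfin_def)
qed

lemma ncmul_ncg: "ncmul (ncg g) f = (\<lambda>w. case w of [] \<Rightarrow> 0 | h # t \<Rightarrow> if h = g then f t else 0)"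
proof
  fix w show "ncmul (ncg g) f w = (case w of [] \<Rightarrow> 0 | h # t \<Rightarrow> if h = g then f t else 0)"
  proof (cases w)
    case (Cons h t)
    have "ncmul (ncg g) f w = (\<Sum>i\<in>{..length w} - {1}. ncg g (take i w) * f (drop i w)) + ncg g (take 1 w) * f (drop 1 w)"
      unfolding ncmul_def by (subst sum.remove[of _ 1]) (auto simp: Cons)
    also have "(\<Sum>i\<in>{..length w} - {1}. ncg g (take i w) * f (drop i w)) = 0"
    proof (rule sum.neutral, rule ballI)
      fix i assume "i \<in> {..length w} - {1}"
      then have "length (take i w) \<noteq> length [g]" by auto
      then have "take i w \<noteq> [g]" by metis
      then show "ncg g (take i w) * f (drop i w) = 0" by (simp add: ncg_def ncw_def)
    qed
    finally show ?thesis by (simp add: Cons ncg_def ncw_def)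
  qed (simp add: ncmul_def ncg_def ncw_def)
qed

text \<open>Splitting off the first letter of the word proves associativity for a generator on the
  left; words and then finite combinations are reached from it by induction.\<close>

lemma ncmul_ncg_assoc: "ncmul (ncg g) (ncmul a b) = ncmul (ncmul (ncg g) a) b"
proof
  fix w show "ncmul (ncg g) (ncmul a b) w = ncmul (ncmul (ncg g) a) b w"
  proof (cases w)
    case Nil
    then show ?thesis by (simp add: ncmul_ncg ncmul_def[of _ b])
  next
    case (Cons h t)
    have "ncmul (ncmul (ncg g) a) b w = (\<Sum>i\<le>length t. ncmul (ncg g) a (h # take i t) * b (drop i t))"
      unfolding Cons ncmul_def[of _ b] list.size add_Suc_right add_0_right sum.atMost_Suc_shift
      by (simp add: ncmul_ncg)
    then show ?thesis by (simp add: ncmul_ncg Cons ncmul_def[of _ b])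
  qed
qed

lemma ncmul_ncc1 [simp]: "ncmul (ncc 1) f = f"
proof
  fix w
  have "ncmul (ncc 1) f w = (\<Sum>i\<in>{..length w}. if i = 0 then f w else 0)"
    unfolding ncmul_def ncc_def by (rule sum.cong) auto
  then show "ncmul (ncc 1) f w = f w" by simp
qed

lemma ncmul_ncadd_left: "ncmul (ncadd a b) f = ncadd (ncmul a f) (ncmul b f)"
  by (auto simp: ncmul_def ncadd_def fun_eq_iff sum.distrib algebra_simps)

lemma ncmul_ncadd_right: "ncmul f (ncadd a b) = ncadd (ncmul f a) (ncmul f b)"
  by (auto simp: ncmul_def ncadd_def fun_eq_iff sum.distrib algebra_simps)

lemma ncmul_ncsc_left: "ncmul (ncsc c a) f = ncsc c (ncmul a f)"
  by (auto simp: ncmul_def ncsc_def fun_eq_iff sum_distrib_left algebra_simps)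

lemma ncmul_ncsc_right: "ncmul f (ncsc c a) = ncsc c (ncmul f a)"
  by (auto simp: ncmul_def ncsc_def fun_eq_iff sum_distrib_left algebra_simps)

lemma ncmul_zero_left [simp]: "ncmul (ncc 0) f = ncc 0"
  by (auto simp: ncmul_def ncc_def fun_eq_iff)

lemma ncmul_zero_right [simp]: "ncmul f (ncc 0) = ncc 0"
  by (auto simp: ncmul_def ncc_def fun_eq_iff)

lemma ncw_Nil: "ncw [] = ncc 1"
  by (auto simp: ncw_def ncc_def)

lemma ncw_Cons: "ncw (g # m) = ncmul (ncg g) (ncw m)"
  by (auto simp: ncmul_ncg ncw_def fun_eq_iff split: list.split)

lemma ncmul_ncc1_right [simp]: "ncmul f (ncc 1) = f"
proof
  fix w
  have "ncmul f (ncc 1) w = (\<Sum>i\<in>{..length w}. if i = length w then f w else 0)"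
    unfolding ncmul_def ncc_def by (rule sum.cong) auto
  then show "ncmul f (ncc 1) w = f w" by simp
qed

lemma ncfin_Uq_rels: "r \<in> Uq_rels q \<Longrightarrow> ncfin r"
  unfolding Uq_rels_def by (auto split: if_splits)

lemma ncfin_Kpow [simp]: "ncfin (Kpow m)"
  by (simp add: Kpow_def Kel_def Kinvel_def)

lemma ncfin_C1el [simp]: "ncfin (C1el q)"
  by (simp add: C1el_def)

lemma ncfin_F3el [simp]: "ncfin (F3el q)"
  by (simp add: F3el_def)

lemma ncfin_uel [simp]: "ncfin (uel q \<alpha> n)"
  unfolding uel_def by (auto intro!: ncfin_ncsum)

subsection \<open>Modules over the free algebra\<close>

text \<open>Generators act by arbitrary linear maps. The relations enter only in
  \<open>uq_rep\<close>, so that the trivial action and the action on a quotient can be handled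
  before their relations are established.\<close>

locale lin_rep = vector_space scale
  for scale :: "complex \<Rightarrow> 'v::ab_group_add \<Rightarrow> 'v" (infixr "*s" 75) +
  fixes \<rho> :: "gen \<Rightarrow> 'v \<Rightarrow> 'v"
  assumes lin: "\<And>g. Vector_Spaces.linear scale scale (\<rho> g)"
begin

abbreviation A where "A \<equiv> act scale \<rho>"

lemma rho_add [simp]: "\<rho> g (x + y) = \<rho> g x + \<rho> g y"
  using lin[of g] by (simp add: Vector_Spaces.linear_def module_hom_iff)

lemma rho_scale [simp]: "\<rho> g (c *s x) = c *s \<rho> g x"
  using lin[of g] by (simp add: Vector_Spaces.linear_def module_hom_iff)

lemma rho_zero [simp]: "\<rho> g 0 = 0"
  using rho_scale[of g 0 0] by simp

lemma rho_minus [simp]: "\<rho> g (- x) = - \<rho> g x"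
  using rho_scale[of g "-1" x] by simp

lemma rho_diff [simp]: "\<rho> g (x - y) = \<rho> g x - \<rho> g y"
  using rho_add[of g x "- y"] by simp

lemma rho_sum: "\<rho> g (sum f S) = (\<Sum>x\<in>S. \<rho> g (f x))"
  by (induction S rule: infinite_finite_induct) auto

lemma act_superset: "finite S \<Longrightarrow> {w. f w \<noteq> 0} \<subseteq> S \<Longrightarrow> A f v = (\<Sum>w\<in>S. f w *s wact \<rho> w v)"
  unfolding act_def by (rule sum.mono_neutral_left) auto

lemma act_ncadd [simp]:
  assumes "ncfin f" "ncfin g" shows "A (ncadd f g) v = A f v + A g v"
proof -
  let ?S = "{w. f w \<noteq> 0} \<union> {w. g w \<noteq> 0}"
  have fin: "finite ?S" using assms by (simp add: ncfin_def)
  have "A (ncadd f g) v = (\<Sum>w\<in>?S. ncadd f g w *s wact \<rho> w v)"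
    by (rule act_superset[OF fin]) (auto simp: ncadd_def)
  also have "\<dots> = (\<Sum>w\<in>?S. f w *s wact \<rho> w v) + (\<Sum>w\<in>?S. g w *s wact \<rho> w v)"
    by (simp add: ncadd_def scale_left_distrib sum.distrib)
  also have "\<dots> = A f v + A g v"
    using act_superset[OF fin, of f v] act_superset[OF fin, of g v] by simp
  finally show ?thesis .
qed

lemma act_ncsc [simp]: assumes "ncfin f" shows "A (ncsc c f) v = c *s A f v"
proof -
  have "A (ncsc c f) v = (\<Sum>w\<in>{w. f w \<noteq> 0}. ncsc c f w *s wact \<rho> w v)"
    by (rule act_superset) (use assms in \<open>auto simp: ncsc_def ncfin_def\<close>)
  then show ?thesis by (simp add: act_def ncsc_def scale_sum_right)
qed

lemma act_ncsub [simp]: "ncfin f \<Longrightarrow> ncfin g \<Longrightarrow> A (ncsub f g) v = A f v - A g v"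
  by (simp add: ncsub_def)

lemma act_ncc [simp]: "A (ncc c) v = c *s v"
  by (subst act_superset[of "{[]}"]) (auto simp: ncc_def)

lemma act_ncw [simp]: "A (ncw m) v = wact \<rho> m v"
  by (subst act_superset[of "{m}"]) (auto simp: ncw_def)

lemma act_ncg [simp]: "A (ncg g) v = \<rho> g v"
  by (simp add: ncg_def)

lemma act_ncmul_ncg:
  assumes "ncfin f" shows "A (ncmul (ncg g) f) v = \<rho> g (A f v)"
proof -
  have "A (ncmul (ncg g) f) v = (\<Sum>w\<in>(#) g ` {w. f w \<noteq> 0}. ncmul (ncg g) f w *s wact \<rho> w v)"
    by (rule act_superset) (use assms in \<open>auto simp: ncmul_ncg ncfin_def split: list.split_asm if_split_asm\<close>)
  also have "\<dots> = (\<Sum>w\<in>{w. f w \<noteq> 0}. f w *s \<rho> g (wact \<rho> w v))"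
    by (subst sum.reindex) (auto simp: ncmul_ncg)
  finally show ?thesis by (simp add: act_def rho_sum)
qed

lemma act_ncmul_ncw: "ncfin f \<Longrightarrow> A (ncmul (ncw m) f) v = wact \<rho> m (A f v)"
proof (induction m)
  case (Cons g m)
  then show ?case
    by (simp add: ncw_Cons ncmul_ncg_assoc[symmetric] act_ncmul_ncg)
qed (simp add: ncw_Nil)

lemma act_ncmul [simp]:
  assumes "ncfin f" "ncfin h" shows "A (ncmul f h) v = A f (A h v)"
  using assms(1)
proof (induction rule: ncfin_induct)
  case zero then show ?case by simp
next
  case (add c m f)
  then show ?case
    using assms(2) by (simp add: ncmul_ncadd_left ncmul_ncsc_left act_ncmul_ncw)
qed

lemma act_ncpow [simp]: "ncfin f \<Longrightarrow> A (ncpow f n) v = (A f ^^ n) v"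
  by (induction n) (simp_all add: ncpow_def ncfin_ncpow[unfolded ncpow_def])

lemma act_ncsum:
  assumes "finite I" "\<And>x. x \<in> I \<Longrightarrow> ncfin (F x)"
  shows "A (ncsum F I) v = (\<Sum>x\<in>I. A (F x) v)"
  using assms
proof (induction I rule: finite_induct)
  case empty
  have "ncsum F {} = ncc 0" by (auto simp: ncsum_def ncc_def)
  then show ?case by simp
next
  case (insert x I)
  have "ncsum F (insert x I) = ncadd (F x) (ncsum F I)"
    using insert.hyps by (auto simp: ncsum_def ncadd_def)
  then show ?case using insert by simp
qed

lemma wact_scale [simp]: "wact \<rho> m (c *s x) = c *s wact \<rho> m x"
  by (induction m) auto

lemma act_vscale: "A f (c *s x) = c *s A f x"
  by (simp add: act_def scale_sum_right mult.commute)

lemma act_vzero [simp]: "A f 0 = 0"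
  using act_vscale[of f 0 0] by simp

lemma act_induct:
  assumes "ncfin f" "subspace S" "\<And>g x. x \<in> S \<Longrightarrow> \<rho> g x \<in> S" "v \<in> S"
  shows "A f v \<in> S"
proof -
  have "wact \<rho> m v \<in> S" for m using assms by (induction m) auto
  then show ?thesis unfolding act_def by (intro subspace_sum subspace_scale assms)
qed

definition cyc :: "'v \<Rightarrow> 'v set" where "cyc v = {A f v |f. ncfin f}"

lemma cycI: "ncfin f \<Longrightarrow> A f v \<in> cyc v" by (auto simp: cyc_def)

lemma cyc_self: "v \<in> cyc v" using cycI[of "ncc 1" v] by simp

lemma subspace_cyc: "subspace (cyc v)"
proof (rule subspaceI)
  show "0 \<in> cyc v" using cycI[of "ncc 0" v] by simp
  show "x + y \<in> cyc v" if xy: "x \<in> cyc v" "y \<in> cyc v" for x y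
  proof -
    obtain f g where "ncfin f" "ncfin g" "x = A f v" "y = A g v" using xy unfolding cyc_def by blast
    then show ?thesis using cycI[of "ncadd f g" v] by simp
  qed
  show "c *s x \<in> cyc v" if x: "x \<in> cyc v" for c x
  proof -
    obtain f where "ncfin f" "x = A f v" using x unfolding cyc_def by blast
    then show ?thesis using cycI[of "ncsc c f" v] by simp
  qed
qed

lemma rho_cyc:
  assumes "x \<in> cyc v" shows "\<rho> g x \<in> cyc v"
proof -
  obtain f where "ncfin f" "x = A f v" using assms unfolding cyc_def by blast
  then show ?thesis using cycI[of "ncmul (ncg g) f" v] by simp
qed

text \<open>Linear functionals separate points, since a nonzero vector extends to a basis. Testing
  an identity on a generic functional turns it into one between complex numbers, where the
  simplification rules for fields apply.\<close>

lemma vec_eqI: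
  assumes "\<And>\<phi>. (\<And>x y. \<phi> (x + y) = \<phi> x + \<phi> y) \<Longrightarrow> (\<And>x y. \<phi> (x - y) = \<phi> x - \<phi> y) \<Longrightarrow>
     (\<And>x. \<phi> (- x) = - \<phi> x) \<Longrightarrow> \<phi> 0 = 0 \<Longrightarrow> (\<And>c x. \<phi> (c *s x) = c * \<phi> x) \<Longrightarrow> \<phi> x = (\<phi> y :: complex)"
  shows "x = y"
proof (rule ccontr)
  assume "x \<noteq> y"
  interpret C: vector_space "(*) :: complex \<Rightarrow> complex \<Rightarrow> complex"
    by standard (auto simp: algebra_simps)
  interpret P: vector_space_pair scale "(*) :: complex \<Rightarrow> complex \<Rightarrow> complex" ..
  have "independent {x - y}" using \<open>x \<noteq> y\<close> by simp
  then obtain \<phi> where \<phi>: "Vector_Spaces.linear scale (*) \<phi>" "\<phi> (x - y) = 1"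
    using P.linear_independent_extend[of "{x - y}" "\<lambda>_. 1"] by auto
  note lin = P.linear_add[OF \<phi>(1)] P.linear_diff[OF \<phi>(1)] P.linear_neg[OF \<phi>(1)]
    P.linear_0[OF \<phi>(1)] P.linear_scale[OF \<phi>(1)]
  have "\<phi> x = \<phi> y" by (rule assms) (auto simp: lin)
  then show False using \<phi>(2) by (simp add: lin)
qed

end

subsection \<open>Modules over the quantum group\<close>

locale uq_rep = lin_rep scale \<rho>
  for scale :: "complex \<Rightarrow> 'v::ab_group_add \<Rightarrow> 'v" (infixr "*s" 75)
    and \<rho> :: "gen \<Rightarrow> 'v \<Rightarrow> 'v" +
  fixes q \<alpha> :: complex
  assumes q0 [simp]: "q \<noteq> 0"
    and q_not_root: "\<And>n. n > 0 \<Longrightarrow> q ^ n \<noteq> 1"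
    and \<alpha>0 [simp]: "\<alpha> \<noteq> 0"
    and rels: "\<And>r v. r \<in> Uq_rels q \<Longrightarrow> act scale \<rho> r v = 0"
begin

lemma q_powi_eq_1_iff: "q powi m = 1 \<longleftrightarrow> m = 0"
proof
  assume *: "q powi m = 1"
  show "m = 0"
  proof (rule ccontr)
    assume "m \<noteq> 0"
    then have "q ^ nat \<bar>m\<bar> \<noteq> 1" by (intro q_not_root) auto
    moreover have "q ^ nat \<bar>m\<bar> = 1"
      using * by (cases "m \<ge> 0") (auto simp: power_int_def power_inverse)
    ultimately show False by simp
  qed
qed simp

lemma q_powi_inject [simp]: "q powi m = q powi l \<longleftrightarrow> m = l"
proof
  assume "q powi m = q powi l"
  then have "q powi (m - l) = 1" by (simp add: power_int_diff)
  then show "m = l" by (simp add: q_powi_eq_1_iff)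
qed simp

abbreviation (input) qd where "qd \<equiv> q - inverse q"

lemma q2_ne_1: "q\<^sup>2 \<noteq> 1" by (rule q_not_root) simp

lemma qd0 [simp]: "qd \<noteq> 0"
  using q2_ne_1 by (auto simp: field_simps power2_eq_square)

lemma qint_ne_0 [simp]: "n > 0 \<Longrightarrow> qint q n \<noteq> 0"
  using q_not_root[of "n + n"] qd0 unfolding qint_def power_add by (auto simp: power_inverse field_simps)

lemma qint_0 [simp]: "qint q 0 = 0" by (simp add: qint_def)

lemma qint_1 [simp]: "qint q (Suc 0) = 1" using qd0 by (simp add: qint_def)

lemma qint_Suc: "qint q (Suc n) = q ^ n + inverse q * qint q n"
  and qint_Suc': "qint q (Suc n) = q * qint q n + inverse q ^ n"
  using qd0 by (simp_all add: qint_def divide_simps) (simp_all add: algebra_simps)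

lemma qint_powi: "qint q n = (q powi int n - q powi (- int n)) / qd"
  by (simp add: qint_def power_int_minus power_inverse)

definition k2p :: "int \<Rightarrow> 'v \<Rightarrow> 'v" where
  "k2p l x = (if l \<ge> 0 then (\<rho> K2 ^^ nat l) x else (\<rho> K2i ^^ nat (- l)) x)"

definition kk where "kk x = \<rho> K1 (\<rho> K2 (\<rho> K2 x))"
definition kki where "kki x = \<rho> K2i (\<rho> K2i (\<rho> K1i x))"
text \<open>The Casimir element of the copy of U_q(sl2) generated by E1, F1 and K1; this is why it
  commutes with E1, and it has weight zero.\<close>

definition c1 where "c1 x = \<rho> F1 (\<rho> E1 x) + (1 / qd\<^sup>2) *s (q *s \<rho> K1 x + inverse q *s \<rho> K1i x)"
definition f3 where "f3 x = \<rho> F1 (\<rho> F2 x) - q *s \<rho> F2 (\<rho> F1 x)"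

lemma k1_k1i [simp]: "\<rho> K1 (\<rho> K1i x) = x" and k2_k2i [simp]: "\<rho> K2 (\<rho> K2i x) = x"
  and k1i_k1 [simp]: "\<rho> K1i (\<rho> K1 x) = x" and k2i_k2 [simp]: "\<rho> K2i (\<rho> K2 x) = x"
proof -
  have "ncsub (ncmul (ncg (Kg i)) (ncg (Kig i))) (ncc 1) \<in> Uq_rels q"
    "ncsub (ncmul (ncg (Kig i)) (ncg (Kg i))) (ncc 1) \<in> Uq_rels q" if "i \<in> {1,2}" for i
    using that unfolding Uq_rels_def by blast+
  note rels[OF this(1)[of 1], of x] rels[OF this(1)[of 2], of x] rels[OF this(2)[of 1], of x] rels[OF this(2)[of 2], of x]
  then show "\<rho> K1 (\<rho> K1i x) = x" "\<rho> K2 (\<rho> K2i x) = x" "\<rho> K1i (\<rho> K1 x) = x" "\<rho> K2i (\<rho> K2 x) = x"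
    by (simp_all add: Kg_def Kig_def)
qed

lemma k2_k1: "\<rho> K2 (\<rho> K1 x) = \<rho> K1 (\<rho> K2 x)"
proof -
  have "ncsub (ncmul (ncg K1) (ncg K2)) (ncmul (ncg K2) (ncg K1)) \<in> Uq_rels q"
    unfolding Uq_rels_def by blast
  from rels[OF this, of x] show ?thesis by simp
qed

lemma ke:
  assumes "i \<in> {1,2}" "j \<in> {1,2}"
  shows "\<rho> (Kg i) (\<rho> (Eg j) x) = (q powi cartan i j) *s \<rho> (Eg j) (\<rho> (Kg i) x)"
proof -
  have "ncsub (ncmul (ncmul (ncg (Kg i)) (ncg (Eg j))) (ncg (Kig i)))
            (ncsc (q powi cartan i j) (ncg (Eg j))) \<in> Uq_rels q"
    using assms unfolding Uq_rels_def by blast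
  from rels[OF this, of "\<rho> (Kg i) x"] show ?thesis
    using assms by (auto simp: Kg_def Kig_def)
qed

lemma kf:
  assumes "i \<in> {1,2}" "j \<in> {1,2}"
  shows "\<rho> (Kg i) (\<rho> (Fg j) x) = (q powi (- cartan i j)) *s \<rho> (Fg j) (\<rho> (Kg i) x)"
proof -
  have "ncsub (ncmul (ncmul (ncg (Kg i)) (ncg (Fg j))) (ncg (Kig i)))
            (ncsc (q powi (- cartan i j)) (ncg (Fg j))) \<in> Uq_rels q"
    using assms unfolding Uq_rels_def by blast
  from rels[OF this, of "\<rho> (Kg i) x"] show ?thesis
    using assms by (auto simp: Kg_def Kig_def)
qed

lemma k1_e1: "\<rho> K1 (\<rho> E1 x) = q\<^sup>2 *s \<rho> E1 (\<rho> K1 x)"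
  and k1_e2: "\<rho> K1 (\<rho> E2 x) = inverse q *s \<rho> E2 (\<rho> K1 x)"
  and k2_e1: "\<rho> K2 (\<rho> E1 x) = inverse q *s \<rho> E1 (\<rho> K2 x)"
  and k2_e2: "\<rho> K2 (\<rho> E2 x) = q\<^sup>2 *s \<rho> E2 (\<rho> K2 x)"
  using ke[of 1 1 x] ke[of 1 2 x] ke[of 2 1 x] ke[of 2 2 x]
  by (simp_all add: Kg_def Eg_def cartan_def power_int_minus)

lemma k1_f1: "\<rho> K1 (\<rho> F1 x) = inverse (q\<^sup>2) *s \<rho> F1 (\<rho> K1 x)"
  and k1_f2: "\<rho> K1 (\<rho> F2 x) = q *s \<rho> F2 (\<rho> K1 x)"
  and k2_f1: "\<rho> K2 (\<rho> F1 x) = q *s \<rho> F1 (\<rho> K2 x)"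
  and k2_f2: "\<rho> K2 (\<rho> F2 x) = inverse (q\<^sup>2) *s \<rho> F2 (\<rho> K2 x)"
  using kf[of 1 1 x] kf[of 1 2 x] kf[of 2 1 x] kf[of 2 2 x]
  by (simp_all add: Kg_def Fg_def cartan_def power_int_minus)

lemma k1i_flip: "\<rho> K1i x = y \<longleftrightarrow> x = \<rho> K1 y" and k2i_flip: "\<rho> K2i x = y \<longleftrightarrow> x = \<rho> K2 y"
  by auto

lemma k1i_e1: "\<rho> K1i (\<rho> E1 x) = inverse (q\<^sup>2) *s \<rho> E1 (\<rho> K1i x)"
  and k1i_e2: "\<rho> K1i (\<rho> E2 x) = q *s \<rho> E2 (\<rho> K1i x)"
  and k2i_e1: "\<rho> K2i (\<rho> E1 x) = q *s \<rho> E1 (\<rho> K2i x)"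
  and k1i_f1: "\<rho> K1i (\<rho> F1 x) = q\<^sup>2 *s \<rho> F1 (\<rho> K1i x)"
  and k1i_f2: "\<rho> K1i (\<rho> F2 x) = inverse q *s \<rho> F2 (\<rho> K1i x)"
  and k2i_f1: "\<rho> K2i (\<rho> F1 x) = inverse q *s \<rho> F1 (\<rho> K2i x)"
  and k2i_f2: "\<rho> K2i (\<rho> F2 x) = q\<^sup>2 *s \<rho> F2 (\<rho> K2i x)"
  by (simp_all add: k1i_flip k2i_flip k1_e1 k1_e2 k2_e1 k2_e2 k1_f1 k1_f2 k2_f1 k2_f2)

lemma k2i_k1: "\<rho> K2i (\<rho> K1 x) = \<rho> K1 (\<rho> K2i x)"
  by (simp add: k2i_flip k2_k1)

lemma k2_k1i: "\<rho> K2 (\<rho> K1i x) = \<rho> K1i (\<rho> K2 x)"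
  by (metis k1_k1i k1i_k1 k2_k1)

lemma e_f:
  assumes "i \<in> {1,2}" "j \<in> {1,2}"
  shows "\<rho> (Eg i) (\<rho> (Fg j) x) = \<rho> (Fg j) (\<rho> (Eg i) x) +
     (if i = j then (1 / qd) *s (\<rho> (Kg i) x - \<rho> (Kig i) x) else 0)"
proof -
  have "ncsub (ncsub (ncmul (ncg (Eg i)) (ncg (Fg j))) (ncmul (ncg (Fg j)) (ncg (Eg i))))
            (if i = j then ncsc (1 / (q - inverse q)) (ncsub (ncg (Kg i)) (ncg (Kig i))) else ncc 0) \<in> Uq_rels q"
    using assms unfolding Uq_rels_def by blast
  from rels[OF this, of x] show ?thesis
    by (auto split: if_splits simp: algebra_simps)
qed

lemma e1_f1: "\<rho> E1 (\<rho> F1 x) = \<rho> F1 (\<rho> E1 x) + (1 / qd) *s (\<rho> K1 x - \<rho> K1i x)"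
  and e1_f2: "\<rho> E1 (\<rho> F2 x) = \<rho> F2 (\<rho> E1 x)"
  and e2_f1: "\<rho> E2 (\<rho> F1 x) = \<rho> F1 (\<rho> E2 x)"
  and e2_f2: "\<rho> E2 (\<rho> F2 x) = \<rho> F2 (\<rho> E2 x) + (1 / qd) *s (\<rho> K2 x - \<rho> K2i x)"
  using e_f[of 1 1 x] e_f[of 1 2 x] e_f[of 2 1 x] e_f[of 2 2 x]
  by (simp_all add: Eg_def Fg_def Kg_def Kig_def)

lemma serre_f:
  assumes "i \<in> {1,2}" "j \<in> {1,2}" "i \<noteq> j"
  shows "\<rho> (Fg i) (\<rho> (Fg i) (\<rho> (Fg j) x)) =
    (q + inverse q) *s \<rho> (Fg i) (\<rho> (Fg j) (\<rho> (Fg i) x)) - \<rho> (Fg j) (\<rho> (Fg i) (\<rho> (Fg i) x))"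
proof -
  have "ncadd (ncsub (ncw [Fg i, Fg i, Fg j]) (ncsc (q + inverse q) (ncw [Fg i, Fg j, Fg i])))
            (ncw [Fg j, Fg i, Fg i]) \<in> Uq_rels q"
    using assms unfolding Uq_rels_def by blast
  from rels[OF this, of x] show ?thesis
    by (simp add: algebra_simps eq_neg_iff_add_eq_0)
qed

lemma serre_f1: "\<rho> F1 (\<rho> F1 (\<rho> F2 x)) = (q + inverse q) *s \<rho> F1 (\<rho> F2 (\<rho> F1 x)) - \<rho> F2 (\<rho> F1 (\<rho> F1 x))"
  and serre_f2: "\<rho> F2 (\<rho> F2 (\<rho> F1 x)) = (q + inverse q) *s \<rho> F2 (\<rho> F1 (\<rho> F2 x)) - \<rho> F1 (\<rho> F2 (\<rho> F2 x))"
  using serre_f[of 1 2 x] serre_f[of 2 1 x] by (simp_all add: Fg_def)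

section \<open>Commutation rules for F3, C1 and K\<close>

lemma f3_add [simp]: "f3 (x + y) = f3 x + f3 y" and f3_scale [simp]: "f3 (c *s x) = c *s f3 x"
  by (simp_all add: f3_def algebra_simps)

lemma kk_add [simp]: "kk (x + y) = kk x + kk y" and kk_scale [simp]: "kk (c *s x) = c *s kk x"
  by (simp_all add: kk_def algebra_simps)

lemma kki_add [simp]: "kki (x + y) = kki x + kki y" and kki_scale [simp]: "kki (c *s x) = c *s kki x"
  by (simp_all add: kki_def algebra_simps)

lemma c1_add [simp]: "c1 (x + y) = c1 x + c1 y" and c1_scale [simp]: "c1 (c *s x) = c *s c1 x"
  by (simp_all add: c1_def algebra_simps)

lemma kk_kki [simp]: "kk (kki x) = x" and kki_kk [simp]: "kki (kk x) = x"
  by (simp_all add: kk_def kki_def)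

text \<open>Expanded, this equation is the Serre relation with F1 doubled; \<open>f3_f2\<close> is
  in the same way the one with F2 doubled.\<close>

lemma f1_f3: "\<rho> F1 (f3 x) = inverse q *s f3 (\<rho> F1 x)"
  unfolding f3_def by (rule vec_eqI) (simp add: serre_f1, simp add: field_simps)

lemma f3_f2: "f3 (\<rho> F2 x) = inverse q *s \<rho> F2 (f3 x)"
  unfolding f3_def by (rule vec_eqI) (simp add: serre_f2, simp add: field_simps)

lemma e1_f3: "\<rho> E1 (f3 x) = f3 (\<rho> E1 x) + \<rho> F2 (\<rho> K1i x)"
  unfolding f3_def
  by (rule vec_eqI) (simp add: e1_f1 e1_f2 k1_f2 k1i_f2, use qd0 in \<open>simp add: divide_simps\<close>, simp add: algebra_simps)

lemma e2_f3: "\<rho> E2 (f3 x) = f3 (\<rho> E2 x) - q *s \<rho> F1 (\<rho> K2 x)"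
  unfolding f3_def
  by (rule vec_eqI) (simp add: e2_f1 e2_f2 k2_f1 k2i_f1, use qd0 in \<open>simp add: divide_simps\<close>, simp add: algebra_simps)

lemma k1_f3: "\<rho> K1 (f3 x) = inverse q *s f3 (\<rho> K1 x)"
  and k1i_f3: "\<rho> K1i (f3 x) = q *s f3 (\<rho> K1i x)"
  and k2_f3: "\<rho> K2 (f3 x) = inverse q *s f3 (\<rho> K2 x)"
  and k2i_f3: "\<rho> K2i (f3 x) = q *s f3 (\<rho> K2i x)"
  unfolding f3_def
  by (rule vec_eqI; simp add: k1_f1 k1_f2 k2_f1 k2_f2 k1i_f1 k1i_f2 k2i_f1 k2i_f2 field_simps power2_eq_square)+

lemma c1_e1: "c1 (\<rho> E1 x) = \<rho> E1 (c1 x)"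
  unfolding c1_def
  by (rule vec_eqI) (simp add: e1_f1 k1_e1 k1i_e1, use qd0 in \<open>simp add: divide_simps\<close>, simp add: algebra_simps power2_eq_square)

text \<open>On E1 the exponents contributed by K1 and K2^2 are 2 and -2 and cancel; on E2 they are
  -1 and 4. So K commutes with E1 and F1, while F2 and F3 have weight q^-3, the source of \<kappa>_-
  = q^(-3 n_-) \<kappa>.\<close>

lemma kk_e1: "kk (\<rho> E1 x) = \<rho> E1 (kk x)" and kk_e2: "kk (\<rho> E2 x) = q ^ 3 *s \<rho> E2 (kk x)"
  and kk_f1: "kk (\<rho> F1 x) = \<rho> F1 (kk x)" and kk_f2: "kk (\<rho> F2 x) = inverse q ^ 3 *s \<rho> F2 (kk x)"
  and kk_k1: "kk (\<rho> K1 x) = \<rho> K1 (kk x)" and kk_k2: "kk (\<rho> K2 x) = \<rho> K2 (kk x)"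
  and kk_k1i: "kk (\<rho> K1i x) = \<rho> K1i (kk x)"
  unfolding kk_def by (simp_all add: k1_e1 k1_e2 k2_e1 k2_e2 k1_f1 k1_f2 k2_f1 k2_f2 k2_k1 k2_k1i k2i_k1 field_simps power2_eq_square power3_eq_cube)

lemma kk_f3: "kk (f3 x) = inverse q ^ 3 *s f3 (kk x)"
  by (simp add: kk_def k1_f3 k2_f3 power3_eq_cube mult.assoc)

lemma kki_flip: "kki x = y \<longleftrightarrow> x = kk y" by auto

lemma kki_e1: "kki (\<rho> E1 x) = \<rho> E1 (kki x)" and kki_e2: "kki (\<rho> E2 x) = inverse q ^ 3 *s \<rho> E2 (kki x)"
  and kki_f1: "kki (\<rho> F1 x) = \<rho> F1 (kki x)"
  and kki_k1: "kki (\<rho> K1 x) = \<rho> K1 (kki x)" and kki_k2: "kki (\<rho> K2 x) = \<rho> K2 (kki x)"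
  and kki_k1i: "kki (\<rho> K1i x) = \<rho> K1i (kki x)"
  by (simp_all add: kki_flip kk_e1 kk_e2 kk_f1 kk_k1 kk_k2 kk_k1i power_inverse)

lemma c1_kk: "c1 (kk x) = kk (c1 x)" and c1_kki: "c1 (kki x) = kki (c1 x)"
  by (simp_all add: c1_def kk_e1 kk_f1 kk_k1 kk_k1i kki_e1 kki_f1 kki_k1 kki_k1i)

lemma c1_k2: "c1 (\<rho> K2 x) = \<rho> K2 (c1 x)"
  by (simp add: c1_def k2_f1 k2_e1 k2i_f1 k2i_e1 k2_k1 k2_k1i k2i_k1)

lemma k1_eq: "\<rho> K1 x = \<rho> K2i (\<rho> K2i (kk x))" and k1i_eq: "\<rho> K1i x = \<rho> K2 (\<rho> K2 (kki x))"
  by (simp_all add: kk_def kki_def k2i_k1)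

subsection \<open>Integer powers of the generator K2\<close>

lemma k2p_0 [simp]: "k2p 0 x = x" by (simp add: k2p_def)

lemma k2_k2p: "\<rho> K2 (k2p l x) = k2p (l + 1) x"
proof (cases "l \<ge> 0")
  case True then show ?thesis by (simp add: k2p_def nat_add_distrib)
next
  case False
  then obtain n where "l = - int (Suc n)" by (metis int_cases not_le of_nat_0_le_iff)
  then show ?thesis by (auto simp: k2p_def nat_add_distrib)
qed

lemma k2i_k2p: "\<rho> K2i (k2p l x) = k2p (l - 1) x"
  using k2_k2p[of "l - 1" x] by (simp add: k2i_flip)

lemma k2p_commute:
  assumes "\<And>x. T (\<rho> K2 x) = \<rho> K2 (T x)"
  shows "T (k2p l x) = k2p l (T x)"
proof (induction l rule: int_induct[where k = 0])
  case base then show ?case by simp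
next
  case (step1 i) then show ?case using assms[of "k2p i x"] by (simp add: k2_k2p)
next
  case (step2 i)
  have "\<rho> K2 (T (k2p (i - 1) x)) = T (\<rho> K2 (k2p (i - 1) x))" using assms by simp
  also have "\<dots> = \<rho> K2 (k2p (i - 1) (T x))" using step2 by (simp add: k2_k2p)
  finally show ?case by (metis k2i_k2)
qed

lemma k2p_scale [simp]: "k2p l (c *s x) = c *s k2p l x"
  using k2p_commute[of "\<lambda>x. c *s x" l x] by simp

lemma k2p_plus [simp]: "k2p l (x + y) = k2p l x + k2p l y"
proof (induction l rule: int_induct[where k = 0])
  case base then show ?case by simp
next
  case (step1 i) then show ?case using k2_k2p[of i] by (metis rho_add)
next
  case (step2 i) then show ?case using k2i_k2p[of i] by (metis rho_add)
qed

lemma k2p_k2p: "k2p l (k2p m x) = k2p (l + m) x"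
proof (induction l rule: int_induct[where k = 0])
  case base then show ?case by simp
next
  case (step1 i) then show ?case using k2_k2p[of i "k2p m x"] k2_k2p[of "i + m" x] by (simp add: algebra_simps)
next
  case (step2 i) then show ?case using k2i_k2p[of i "k2p m x"] k2i_k2p[of "i + m" x] by (simp add: algebra_simps)
qed

lemma c1_k2p: "c1 (k2p l x) = k2p l (c1 x)" by (rule k2p_commute) (rule c1_k2)
lemma kk_k2p: "kk (k2p l x) = k2p l (kk x)" by (rule k2p_commute) (rule kk_k2)
lemma kki_k2p: "kki (k2p l x) = k2p l (kki x)" by (rule k2p_commute) (rule kki_k2)

lemma k1_k2p: "\<rho> K1 (k2p l x) = k2p (l - 2) (kk x)"
  by (simp add: k1_eq kk_k2p k2i_k2p)

lemma k1i_k2p: "\<rho> K1i (k2p l x) = k2p (l + 2) (kki x)"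
  by (simp add: k1i_eq kki_k2p k2_k2p add.commute)

lemma k2p_qcommute:
  assumes T: "\<And>x. \<rho> K2 (T x) = (q powi e) *s T (\<rho> K2 x)"
    and lin: "\<And>c x. T (c *s x) = c *s T x"
  shows "k2p l (T x) = (q powi (e * l)) *s T (k2p l x)"
proof (induction l rule: int_induct[where k = 0])
  case base then show ?case by simp
next
  case (step1 i)
  have "k2p (i + 1) (T x) = \<rho> K2 (q powi (e * i) *s T (k2p i x))"
    using step1 by (simp flip: k2_k2p)
  also have "\<dots> = (q powi (e * (i + 1))) *s T (k2p (i + 1) x)"
    by (simp add: T k2_k2p power_int_add distrib_left mult.commute)
  finally show ?case .
next
  case (step2 i)
  have "\<rho> K2 (q powi (e * (i - 1)) *s T (k2p (i - 1) x)) = (q powi (e * i)) *s T (k2p i x)"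
    by (simp add: T k2_k2p power_int_diff right_diff_distrib)
  then have "q powi (e * (i - 1)) *s T (k2p (i - 1) x) = \<rho> K2i (k2p i (T x))"
    using step2 by (metis k2i_k2)
  then show ?case by (simp add: k2i_k2p)
qed

lemma e1_k2p: "\<rho> E1 (k2p l x) = (q powi l) *s k2p l (\<rho> E1 x)"
  using k2p_qcommute[of "\<rho> E1" "-1" l x] by (simp add: k2_e1 power_int_minus flip: power_int_add)

lemma e2_k2p: "\<rho> E2 (k2p l x) = (q powi (- 2 * l)) *s k2p l (\<rho> E2 x)"
  using k2p_qcommute[of "\<rho> E2" "2" l x] by (simp add: k2_e2 power_int_minus flip: power_int_add)

lemma k2p_zero [simp]: "k2p l 0 = 0"
  using k2p_scale[of l 0 0] by simp

section \<open>Powers of F2 and F3\<close>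

lemma e1_f2pow: "\<rho> E1 ((\<rho> F2 ^^ a) x) = (\<rho> F2 ^^ a) (\<rho> E1 x)"
  by (induction a) (simp_all add: e1_f2)

lemma f3pow_add [simp]: "(f3 ^^ a) (x + y) = (f3 ^^ a) x + (f3 ^^ a) y"
  and f3pow_scale [simp]: "(f3 ^^ a) (c *s x) = c *s (f3 ^^ a) x"
  and f2pow_add [simp]: "(\<rho> F2 ^^ a) (x + y) = (\<rho> F2 ^^ a) x + (\<rho> F2 ^^ a) y"
  and f2pow_scale [simp]: "(\<rho> F2 ^^ a) (c *s x) = c *s (\<rho> F2 ^^ a) x"
  by (induction a) simp_all

lemma f3_diff [simp]: "f3 (x - y) = f3 x - f3 y"
  using f3_add[of x "-1 *s y"] f3_scale[of "-1" y] by simp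

lemma f2pow_diff [simp]: "(\<rho> F2 ^^ a) (x - y) = (\<rho> F2 ^^ a) x - (\<rho> F2 ^^ a) y"
  using f2pow_add[of a x "-1 *s y"] f2pow_scale[of a "-1" y] by simp

lemma f3pow_diff [simp]: "(f3 ^^ a) (x - y) = (f3 ^^ a) x - (f3 ^^ a) y"
  using f3pow_add[of a x "-1 *s y"] f3pow_scale[of a "-1" y] by simp

lemma f3_f2pow: "f3 ((\<rho> F2 ^^ a) x) = inverse q ^ a *s (\<rho> F2 ^^ a) (f3 x)"
  by (induction a) (simp_all add: f3_f2 mult.commute)

lemma f3pow_f2pow: "(f3 ^^ b) ((\<rho> F2 ^^ a) x) = inverse q ^ (a * b) *s (\<rho> F2 ^^ a) ((f3 ^^ b) x)"
  by (induction b) (simp_all add: f3_f2pow power_add mult.commute)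

lemma k1i_f3pow: "\<rho> K1i ((f3 ^^ b) x) = q ^ b *s (f3 ^^ b) (\<rho> K1i x)"
  and k1_f3pow: "\<rho> K1 ((f3 ^^ b) x) = inverse q ^ b *s (f3 ^^ b) (\<rho> K1 x)"
  and k2_f3pow: "\<rho> K2 ((f3 ^^ b) x) = inverse q ^ b *s (f3 ^^ b) (\<rho> K2 x)"
  and k2i_f3pow: "\<rho> K2i ((f3 ^^ b) x) = q ^ b *s (f3 ^^ b) (\<rho> K2i x)"
  by (induction b) (simp_all add: k1i_f3 k1_f3 k2_f3 k2i_f3 mult.commute)

lemma k1i_f2pow: "\<rho> K1i ((\<rho> F2 ^^ b) x) = inverse q ^ b *s (\<rho> F2 ^^ b) (\<rho> K1i x)"
  and k1_f2pow: "\<rho> K1 ((\<rho> F2 ^^ b) x) = q ^ b *s (\<rho> F2 ^^ b) (\<rho> K1 x)"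
  and k2_f2pow: "\<rho> K2 ((\<rho> F2 ^^ b) x) = inverse q ^ (2 * b) *s (\<rho> F2 ^^ b) (\<rho> K2 x)"
  and k2i_f2pow: "\<rho> K2i ((\<rho> F2 ^^ b) x) = q ^ (2 * b) *s (\<rho> F2 ^^ b) (\<rho> K2i x)"
  by (induction b) (simp_all add: k1i_f2 k1_f2 k2_f2 k2i_f2 mult.commute power2_eq_square algebra_simps)

text \<open>By \<open>e1_f3\<close>, moving E1 past one F3 leaves F2 K1^-1. Carrying F2 to the left
  past one F3 costs q^-1 and carrying K1^-1 to the right past one F3 costs q, so the coefficients
  obey the recursion \<open>qint_Suc\<close>.\<close>

lemma e1_f3pow: "\<rho> E1 ((f3 ^^ Suc b) x) =
    (f3 ^^ Suc b) (\<rho> E1 x) + qint q (Suc b) *s \<rho> F2 ((f3 ^^ b) (\<rho> K1i x))"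
proof (induction b)
  case 0 then show ?case by (simp add: e1_f3)
next
  case (Suc b)
  have "\<rho> E1 ((f3 ^^ Suc (Suc b)) x) = f3 (\<rho> E1 ((f3 ^^ Suc b) x)) + \<rho> F2 (\<rho> K1i ((f3 ^^ Suc b) x))"
    by (simp add: e1_f3)
  also have "\<dots> = (f3 ^^ Suc (Suc b)) (\<rho> E1 x) +
      (inverse q * qint q (Suc b) + q ^ Suc b) *s \<rho> F2 ((f3 ^^ Suc b) (\<rho> K1i x))"
    unfolding Suc k1i_f3pow by (simp add: f3_f2 scale_left_distrib mult.commute)
  finally show ?case by (simp add: qint_Suc[of "Suc b"] add.commute)
qed

lemma e2_f3pow: "\<rho> E2 ((f3 ^^ Suc b) x) =
    (f3 ^^ Suc b) (\<rho> E2 x) - (q * inverse q ^ b * qint q (Suc b)) *s (f3 ^^ b) (\<rho> F1 (\<rho> K2 x))"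
proof (induction b)
  case 0 then show ?case by (simp add: e2_f3)
next
  case (Suc b)
  have f1: "\<rho> F1 ((f3 ^^ b) y) = inverse q ^ b *s (f3 ^^ b) (\<rho> F1 y)" for b y
    by (induction b) (simp_all add: f1_f3 mult.commute)
  have "\<rho> E2 ((f3 ^^ Suc (Suc b)) x) = f3 (\<rho> E2 ((f3 ^^ Suc b) x)) - q *s \<rho> F1 (\<rho> K2 ((f3 ^^ Suc b) x))"
    by (simp add: e2_f3)
  also have "\<dots> = (f3 ^^ Suc (Suc b)) (\<rho> E2 x) -
      (q * inverse q ^ b * qint q (Suc b) + q * inverse q ^ Suc b * inverse q ^ Suc b) *s (f3 ^^ Suc b) (\<rho> F1 (\<rho> K2 x))"
    unfolding Suc k2_f3pow rho_scale f1 by (simp add: scale_left_distrib mult_ac)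
  also have "q * inverse q ^ b * qint q (Suc b) + q * inverse q ^ Suc b * inverse q ^ Suc b =
      q * inverse q ^ Suc b * qint q (Suc (Suc b))"
    unfolding qint_Suc'[of "Suc b"] by (simp add: field_simps)
  finally show ?case .
qed

lemma e2_f2pow: "\<rho> E2 ((\<rho> F2 ^^ Suc a) x) = (\<rho> F2 ^^ Suc a) (\<rho> E2 x) +
    (qint q (Suc a) / qd) *s (\<rho> F2 ^^ a) (inverse q ^ a *s \<rho> K2 x - q ^ a *s \<rho> K2i x)"
proof (induction a)
  case 0 then show ?case by (simp add: e2_f2)
next
  case (Suc a)
  have *: "\<rho> E2 ((\<rho> F2 ^^ Suc (Suc a)) x) = \<rho> F2 (\<rho> E2 ((\<rho> F2 ^^ Suc a) x)) +
     (1 / qd) *s (\<rho> K2 ((\<rho> F2 ^^ Suc a) x) - \<rho> K2i ((\<rho> F2 ^^ Suc a) x))"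
    by (simp add: e2_f2)
  have i1: "qint q (Suc (Suc a)) * inverse q ^ Suc a = qint q (Suc a) * inverse q ^ a + inverse q ^ (2 * Suc a)"
    unfolding qint_Suc'[of "Suc a"] by (simp add: field_simps mult_2_right power_add)
  have i2: "qint q (Suc (Suc a)) * q ^ Suc a = qint q (Suc a) * q ^ a + q ^ (2 * Suc a)"
    unfolding qint_Suc[of "Suc a"] by (simp add: field_simps mult_2_right power_add)
  define D where "D = inverse qd"
  have *: "\<rho> E2 ((\<rho> F2 ^^ Suc (Suc a)) x) = (\<rho> F2 ^^ Suc (Suc a)) (\<rho> E2 x) +
     ((D * (qint q (Suc a) * inverse q ^ a + inverse q ^ (2 * Suc a))) *s (\<rho> F2 ^^ Suc a) (\<rho> K2 x) -
      (D * (qint q (Suc a) * q ^ a + q ^ (2 * Suc a))) *s (\<rho> F2 ^^ Suc a) (\<rho> K2i x))"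
    unfolding * Suc k2_f2pow k2i_f2pow divide_inverse mult_1_left D_def[symmetric]
    by (rule vec_eqI, simp, simp add: algebra_simps)
  show ?case
    unfolding * i1[symmetric] i2[symmetric] divide_inverse D_def[symmetric]
    by (simp add: scale_right_diff_distrib mult_ac)
qed

lemma f1_f3pow: "\<rho> F1 ((f3 ^^ b) y) = inverse q ^ b *s (f3 ^^ b) (\<rho> F1 y)"
  by (induction b) (simp_all add: f1_f3 mult.commute)

lemma f1_f2: "\<rho> F1 (\<rho> F2 x) = f3 x + q *s \<rho> F2 (\<rho> F1 x)"
  by (simp add: f3_def)

lemma f1_f2pow: "\<rho> F1 ((\<rho> F2 ^^ Suc a) x) = q ^ Suc a *s (\<rho> F2 ^^ Suc a) (\<rho> F1 x) +
    qint q (Suc a) *s (\<rho> F2 ^^ a) (f3 x)"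
proof (induction a)
  case 0 then show ?case by (simp add: f1_f2 add.commute)
next
  case (Suc a)
  have *: "\<rho> F1 ((\<rho> F2 ^^ Suc (Suc a)) x) = f3 ((\<rho> F2 ^^ Suc a) x) + q *s \<rho> F2 (\<rho> F1 ((\<rho> F2 ^^ Suc a) x))"
    by (simp add: f1_f2)
  show ?case
    unfolding * Suc f3_f2pow unfolding qint_Suc'[of "Suc a"]
    by (rule vec_eqI, simp, simp add: algebra_simps)
qed

subsection \<open>Whittaker vectors and the spanning vectors\<close>

definition Wh :: "'v set" where "Wh = {y. \<rho> E1 y = \<alpha> *s y \<and> \<rho> E2 y = 0}"

definition B :: "nat \<Rightarrow> nat \<Rightarrow> int \<Rightarrow> 'v \<Rightarrow> 'v" where
  "B a b l y = (\<rho> F2 ^^ a) ((f3 ^^ b) (k2p l y))"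

definition dq :: complex where "dq = 1 / qd\<^sup>2"

lemma B_add [simp]: "B a b l (x + y) = B a b l x + B a b l y"
  and B_scale [simp]: "B a b l (c *s x) = c *s B a b l x"
  by (simp_all add: B_def)

lemma B_zero [simp]: "B a b l 0 = 0"
  using B_scale[of a b l 0 0] by simp

lemma B_diff [simp]: "B a b l (x - y) = B a b l x - B a b l y"
  using B_add[of a b l x "-1 *s y"] B_scale[of a b l "-1" y] by simp

lemma B_000 [simp]: "B 0 0 0 y = y" by (simp add: B_def)

text \<open>E1 keeps the degree a + b, trading one factor F3 for F2, whereas E2 lowers the degree by
  one (\<open>e2_B\<close>). This grading carries the induction in
  \<open>free_bounded\<close>.\<close>

lemma e1_B:
  assumes "y \<in> Wh"
  shows "\<rho> E1 (B a b l y) = (\<alpha> * q powi l) *s B a b l y +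
    (case b of 0 \<Rightarrow> 0 | Suc b' \<Rightarrow> qint q b *s B (Suc a) b' (l + 2) (kki y))"
proof -
  have y: "\<rho> E1 (k2p l y) = (\<alpha> * q powi l) *s k2p l y"
    using assms by (simp add: e1_k2p Wh_def mult.commute)
  show ?thesis
  proof (cases b)
    case 0 then show ?thesis by (simp add: B_def e1_f2pow y)
  next
    case (Suc b')
    show ?thesis
      unfolding Suc B_def e1_f2pow e1_f3pow y k1i_k2p by (simp add: funpow_swap1)
  qed
qed

text \<open>E1 acts on \<open>k2p l y\<close> by the nonzero scalar \<alpha> q^l, so the definition
  of C1 can be solved for F1. This is what removes F1 from the spanning vectors and leaves F2, F3,
  K2 and operators on y.\<close>

lemma f1_k2p:
  assumes "y \<in> Wh"
  shows "\<rho> F1 (k2p l y) = (q powi (- l) / \<alpha>) *s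
    (k2p l (c1 y) - (dq * q) *s k2p (l - 2) (kk y) - (dq * inverse q) *s k2p (l + 2) (kki y))"
proof -
  have y: "\<rho> E1 (k2p l y) = (\<alpha> * q powi l) *s k2p l y"
    using assms by (simp add: e1_k2p Wh_def mult.commute)
  have *: "k2p l (c1 y) = (\<alpha> * q powi l) *s \<rho> F1 (k2p l y) +
     dq *s (q *s k2p (l - 2) (kk y) + inverse q *s k2p (l + 2) (kki y))"
    unfolding c1_k2p[symmetric] c1_def[of "k2p l y"] y k1_k2p k1i_k2p by (simp add: dq_def)
  show ?thesis unfolding * by (simp add: scale_right_distrib power_int_minus)
qed

lemma e2_B:
  assumes "y \<in> Wh"
  shows "\<rho> E2 (B a b l y) =
    (case a of 0 \<Rightarrow> 0 | Suc a' \<Rightarrow> (qint q a / qd) *s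
       ((q powi (- int a' - int b)) *s B a' b (l + 1) y - (q powi (int a' + int b)) *s B a' b (l - 1) y)) -
    (case b of 0 \<Rightarrow> 0 | Suc b' \<Rightarrow> (q powi (- int b' - l) * qint q b / \<alpha>) *s
       (B a b' (l + 1) (c1 y) - (dq * q) *s B a b' (l - 1) (kk y) - (dq * inverse q) *s B a b' (l + 3) (kki y)))"
proof -
  have y: "\<rho> E2 (k2p l y) = 0"
    using assms by (simp add: e2_k2p Wh_def)
  have k2: "\<rho> K2 ((f3 ^^ b) (k2p l y)) = (q powi (- int b)) *s (f3 ^^ b) (k2p (l + 1) y)"
    "\<rho> K2i ((f3 ^^ b) (k2p l y)) = (q powi (int b)) *s (f3 ^^ b) (k2p (l - 1) y)"
    unfolding k2_f3pow k2i_f3pow k2_k2p k2i_k2p by (simp_all add: power_int_minus power_inverse)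
  have 1: "(\<rho> F2 ^^ a) (\<rho> E2 ((f3 ^^ b) (k2p l y))) = - (case b of 0 \<Rightarrow> 0 | Suc b' \<Rightarrow> (q powi (- int b' - l) * qint q b / \<alpha>) *s
       (B a b' (l + 1) (c1 y) - (dq * q) *s B a b' (l - 1) (kk y) - (dq * inverse q) *s B a b' (l + 3) (kki y)))"
  proof (cases b)
    case 0 then show ?thesis by (simp add: y) (metis f2pow_scale scale_zero_left)
  next
    case (Suc b')
    have c: "q * inverse q ^ b' * qint q (Suc b') * (q powi (- (l + 1)) / \<alpha>) = q powi (- int b' - l) * qint q b / \<alpha>"
      by (simp add: Suc power_int_diff power_int_minus power_int_add power_inverse field_simps)
    have "(f3 ^^ Suc b') 0 = 0" by (metis f3pow_scale scale_zero_left)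
    then have "\<rho> E2 ((f3 ^^ b) (k2p l y)) = - ((q powi (- int b' - l) * qint q b / \<alpha>) *s (f3 ^^ b') 
        (k2p (l + 1) (c1 y) - (dq * q) *s k2p (l - 1) (kk y) - (dq * inverse q) *s k2p (l + 3) (kki y)))"
      unfolding Suc e2_f3pow k2_k2p f1_k2p[OF assms] y c[unfolded Suc, symmetric] by (simp add: algebra_simps)
    moreover have "(\<rho> F2 ^^ a) (- x) = - (\<rho> F2 ^^ a) x" for x
      using f2pow_scale[of a "-1" x] by simp
    ultimately show ?thesis by (simp add: Suc B_def)
  qed
  show ?thesis
  proof (cases a)
    case 0 then show ?thesis using 1 by (simp add: B_def)
  next
    case (Suc a')
    have c: "inverse q ^ a' *s x *s z = (q powi (- int a')) *s x *s z" for x z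
      by (simp add: power_int_minus power_inverse)
    have "\<rho> E2 (B a b l y) = (\<rho> F2 ^^ a) (\<rho> E2 ((f3 ^^ b) (k2p l y))) + (qint q a / qd) *s
       ((q powi (- int a' - int b)) *s B a' b (l + 1) y - (q powi (int a' + int b)) *s B a' b (l - 1) y)"
      unfolding B_def Suc e2_f2pow k2
      by (simp add: power_int_diff power_int_add power_int_minus power_inverse field_simps)
    then show ?thesis unfolding 1 by (simp add: Suc)
  qed
qed

lemma f1_B:
  assumes "y \<in> Wh"
  shows "\<rho> F1 (B a b l y) = (q powi (int a - int b - l) / \<alpha>) *s
      (B a b l (c1 y) - (dq * q) *s B a b (l - 2) (kk y) - (dq * inverse q) *s B a b (l + 2) (kki y)) +
     (case a of 0 \<Rightarrow> 0 | Suc a' \<Rightarrow> qint q a *s B a' (Suc b) l y)"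
proof -
  have *: "\<rho> F1 ((f3 ^^ b) (k2p l y)) = (q powi (- int b - l) / \<alpha>) *s
      (f3 ^^ b) (k2p l (c1 y) - (dq * q) *s k2p (l - 2) (kk y) - (dq * inverse q) *s k2p (l + 2) (kki y))"
    unfolding f1_f3pow f1_k2p[OF assms] by (simp add: power_int_diff power_int_minus power_inverse field_simps)
  show ?thesis
  proof (cases a)
    case 0 then show ?thesis using * by (simp add: B_def)
  next
    case (Suc a')
    have c: "q ^ Suc a' * (q powi (- int b - l) / \<alpha>) = q powi (int a - int b - l) / \<alpha>"
      by (simp add: Suc power_int_diff power_int_minus power_int_add field_simps)
    have "\<rho> F1 (B a b l y) = (q powi (int a - int b - l) / \<alpha>) *s (\<rho> F2 ^^ a) 
      ((f3 ^^ b) (k2p l (c1 y) - (dq * q) *s k2p (l - 2) (kk y) - (dq * inverse q) *s k2p (l + 2) (kki y))) +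
       qint q a *s B a' (Suc b) l y"
      unfolding c[symmetric] unfolding Suc B_def f1_f2pow * by simp
    then show ?thesis by (simp add: Suc B_def)
  qed
qed

lemma k1_B: "\<rho> K1 (B a b l y) = (q powi (int a - int b)) *s B a b (l - 2) (kk y)"
  and k1i_B: "\<rho> K1i (B a b l y) = (q powi (int b - int a)) *s B a b (l + 2) (kki y)"
  and k2_B: "\<rho> K2 (B a b l y) = (q powi (- 2 * int a - int b)) *s B a b (l + 1) y"
  and k2i_B: "\<rho> K2i (B a b l y) = (q powi (2 * int a + int b)) *s B a b (l - 1) y"
  and f2_B: "\<rho> F2 (B a b l y) = B (Suc a) b l y"
  unfolding B_def k1_f2pow k1_f3pow k1_k2p k1i_f2pow k1i_f3pow k1i_k2p k2_f2pow k2_f3pow k2_k2p k2i_f2pow k2i_f3pow k2i_k2p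
    power_inverse rho_scale f2pow_scale scale_scale
  by (simp_all add: power_int_diff power_int_minus power_int_add power_int_mult power_mult divide_inverse mult.commute power_inverse)

lemma kk_B: "kk (B a b l y) = (q powi (- 3 * (int a + int b))) *s B a b l (kk y)"
proof -
  have 1: "kk ((\<rho> F2 ^^ a) x) = (q powi (- 3 * int a)) *s (\<rho> F2 ^^ a) (kk x)" for a x
    by (induction a) (simp_all add: kk_f2 power_int_diff power_int_minus power_inverse algebra_simps divide_inverse)
  have 2: "kk ((f3 ^^ a) x) = (q powi (- 3 * int a)) *s (f3 ^^ a) (kk x)" for a x
    by (induction a) (simp_all add: kk_f3 power_int_diff power_int_minus power_inverse algebra_simps divide_inverse)
  show ?thesis
    by (simp add: B_def 1 2 kk_k2p algebra_simps flip: power_int_add)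
qed

lemma f3pow_B: "(\<rho> F2 ^^ a) ((f3 ^^ c) (B a' b l y)) = inverse q ^ (a' * c) *s B (a + a') (c + b) l y"
  by (simp add: B_def f3pow_f2pow funpow_add)

lemma k2p_B: "k2p m (B a b l y) = (q powi (- m * (2 * int a + int b))) *s B a b (l + m) y"
proof -
  have "\<rho> K2 ((\<rho> F2 ^^ a) x) = (q powi (- 2 * int a)) *s (\<rho> F2 ^^ a) (\<rho> K2 x)" for x
    unfolding k2_f2pow by (simp add: power_int_minus power_int_mult power_inverse power_mult)
  from k2p_qcommute[OF this f2pow_scale, of m]
  have 1: "k2p m ((\<rho> F2 ^^ a) x) = (q powi (- 2 * int a * m)) *s (\<rho> F2 ^^ a) (k2p m x)" for x .
  have "\<rho> K2 ((f3 ^^ b) x) = (q powi (- int b)) *s (f3 ^^ b) (\<rho> K2 x)" for x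
    unfolding k2_f3pow by (simp add: power_int_minus power_inverse)
  from k2p_qcommute[OF this f3pow_scale, of m]
  have 2: "k2p m ((f3 ^^ b) x) = (q powi (- int b * m)) *s (f3 ^^ b) (k2p m x)" for x .
  show ?thesis unfolding B_def 1 2
    by (simp add: k2p_k2p algebra_simps flip: power_int_add)
qed

subsection \<open>Finite families of Whittaker vectors\<close>

definition wsub :: "'v set \<Rightarrow> bool" where
  "wsub Y \<longleftrightarrow> subspace Y \<and> Y \<subseteq> Wh \<and> (\<forall>y\<in>Y. kk y \<in> Y \<and> kki y \<in> Y \<and> c1 y \<in> Y)"

definition supp :: "(nat \<Rightarrow> nat \<Rightarrow> int \<Rightarrow> 'v) \<Rightarrow> (nat \<times> nat \<times> int) set" where
  "supp P = {(a, b, l). P a b l \<noteq> 0}"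

text \<open>A formal combination of the vectors \<open>B a b l y\<close>. The coefficients are
  vectors of Y, on which K and C1 act, instead of scalars. A relation is a family with
  \<open>val P = 0\<close>, and it is trivial when \<open>P = 0\<close>.\<close>

definition fam :: "'v set \<Rightarrow> (nat \<Rightarrow> nat \<Rightarrow> int \<Rightarrow> 'v) \<Rightarrow> bool" where
  "fam Y P \<longleftrightarrow> finite (supp P) \<and> (\<forall>a b l. P a b l \<in> Y)"

definition val :: "(nat \<Rightarrow> nat \<Rightarrow> int \<Rightarrow> 'v) \<Rightarrow> 'v" where
  "val P = (\<Sum>(a, b, l)\<in>supp P. B a b l (P a b l))"

definition sing :: "nat \<Rightarrow> nat \<Rightarrow> int \<Rightarrow> 'v \<Rightarrow> nat \<Rightarrow> nat \<Rightarrow> int \<Rightarrow> 'v" where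
  "sing a b l y = (\<lambda>a' b' l'. if a' = a \<and> b' = b \<and> l' = l then y else 0)"

lemma val_superset: "finite S \<Longrightarrow> supp P \<subseteq> S \<Longrightarrow> val P = (\<Sum>(a, b, l)\<in>S. B a b l (P a b l))"
  unfolding val_def by (rule sum.mono_neutral_left) (auto simp: supp_def)

lemma val_sing [simp]: "val (sing a b l y) = B a b l y"
  by (subst val_superset[of "{(a, b, l)}"]) (auto simp: supp_def sing_def)

lemma val_zero [simp]: "val 0 = 0"
  by (simp add: val_def supp_def)

lemma fam_sing: "subspace Y \<Longrightarrow> y \<in> Y \<Longrightarrow> fam Y (sing a b l y)"
  unfolding fam_def supp_def sing_def
  by (auto intro!: finite_subset[of _ "{(a, b, l)}"] subspace_0 split: if_splits)

lemma fam_zero: "subspace Y \<Longrightarrow> fam Y 0"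
  by (simp add: fam_def supp_def subspace_0 split_def)

lemma supp_add: "supp (P + Q) \<subseteq> supp P \<union> supp Q"
  by (auto simp: supp_def)

lemma fam_add: "subspace Y \<Longrightarrow> fam Y P \<Longrightarrow> fam Y Q \<Longrightarrow> fam Y (P + Q)"
  unfolding fam_def using supp_add by (auto intro: subspace_add finite_subset)

lemma fam_finite: "fam Y P \<Longrightarrow> finite (supp P)" and fam_in: "fam Y P \<Longrightarrow> P a b l \<in> Y"
  by (auto simp: fam_def)

lemma val_add: assumes "fam Y P" "fam Y Q" shows "val (P + Q) = val P + val Q"
proof -
  let ?S = "supp P \<union> supp Q"
  have fin: "finite ?S" using assms by (auto simp: fam_def)
  have "val (P + Q) = (\<Sum>(a, b, l)\<in>?S. B a b l (P a b l) + B a b l (Q a b l))"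
    using val_superset[OF fin supp_add] by simp
  also have "\<dots> = (\<Sum>(a, b, l)\<in>?S. B a b l (P a b l)) + (\<Sum>(a, b, l)\<in>?S. B a b l (Q a b l))"
    by (simp add: sum.distrib split_def)
  also have "\<dots> = val P + val Q"
    using val_superset[OF fin, of P] val_superset[OF fin, of Q] by auto
  finally show ?thesis .
qed

lemma fam_induct [consumes 2, case_names zero add]:
  assumes "subspace Y" "fam Y P" "Q 0"
    and step: "\<And>P a b l y. fam Y P \<Longrightarrow> Q P \<Longrightarrow> y \<in> Y \<Longrightarrow> y \<noteq> 0 \<Longrightarrow> Q (sing a b l y + P)"
  shows "Q P"
proof -
  have "Q P" if "finite S" "fam Y P" "supp P = S" for S P
    using that
  proof (induction S arbitrary: P)
    case empty
    then have "P = 0" by (auto simp: supp_def fun_eq_iff)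
    show ?case unfolding \<open>P = 0\<close> by (rule assms(3))
  next
    case (insert x S)
    obtain a b l where x: "x = (a, b, l)" by (cases x)
    define P' where "P' = (\<lambda>a' b' l'. if (a', b', l') = x then 0 else P a' b' l')"
    have S: "supp P' = S" using insert.hyps insert.prems unfolding supp_def P'_def
      by (auto split: if_splits)
    moreover have "fam Y P'" using insert.prems insert.hyps S \<open>subspace Y\<close>
      by (auto simp: fam_def P'_def subspace_0)
    ultimately have "Q P'" using insert.IH by blast
    moreover have "P = sing a b l (P a b l) + P'"
      by (auto simp: fun_eq_iff sing_def P'_def x)
    moreover have "(a, b, l) \<in> supp P" using insert.prems(2) x by simp
    then have "P a b l \<noteq> 0" by (simp add: supp_def)
    ultimately show ?case using step[of P' "P a b l" a b l] \<open>fam Y P'\<close> insert.prems(1) by (metis fam_in)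
  qed
  then show ?thesis using assms(2) fam_finite by blast
qed

text \<open>Both sides are additive and every family is a sum of singletons, so a map of families
  describes an operator of the module as soon as this is checked on a single
  \<open>B a b l y\<close>.\<close>

lemma op_transfer:
  assumes Y: "subspace Y" and P: "fam Y P"
    and Tf: "\<And>P Q. Tf (P + Q) = Tf P + Tf Q" "Tf 0 = 0"
    and T: "\<And>x y. T (x + y) = T x + T y" "T 0 = 0"
    and s: "\<And>a b l y. y \<in> Y \<Longrightarrow> fam Y (Tf (sing a b l y)) \<and> val (Tf (sing a b l y)) = T (B a b l y)"
  shows "fam Y (Tf P) \<and> val (Tf P) = T (val P)"
  using Y P
proof (induction P rule: fam_induct)
  case zero show ?case unfolding Tf(2) T(2) val_zero using fam_zero[OF Y] by blast
next
  case (add P a b l y)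
  note s = s[OF \<open>y \<in> Y\<close>, of a b l]
  show ?case
    unfolding Tf(1) val_add[OF fam_sing[OF Y \<open>y \<in> Y\<close>] add.hyps(1)] val_add[OF conjunct1[OF s] conjunct1[OF add.IH]] T(1) val_sing
    using s add.IH by (intro conjI fam_add[OF Y]) auto
qed

lemma kk_zero [simp]: "kk 0 = 0" and kki_zero [simp]: "kki 0 = 0" and c1_zero [simp]: "c1 0 = 0"
  by (simp_all add: kk_def kki_def c1_def)

lemma kk_minus [simp]: "kk (- x) = - kk x" and kki_minus [simp]: "kki (- x) = - kki x"
  using kk_scale[of "-1" x] kki_scale[of "-1" x] by simp_all

lemma c1_minus [simp]: "c1 (- x) = - c1 x"
  using c1_scale[of "-1" x] by simp

lemma kk_diff [simp]: "kk (x - y) = kk x - kk y" and kki_diff [simp]: "kki (x - y) = kki x - kki y"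
  and c1_diff [simp]: "c1 (x - y) = c1 x - c1 y"
  using kk_add[of x "- y"] kki_add[of x "- y"] c1_add[of x "- y"] by simp_all

lemma B_minus [simp]: "B a b l (- x) = - B a b l x"
  using B_scale[of a b l "-1" x] by simp

text \<open>The three maps below describe the operators \<open>E1 - \<alpha> q^m\<close>, \<open>E2\<close> and, on Whittaker
  vectors, \<open>C1\<close> on the level of coefficient families.\<close>

definition D1f where
  "D1f m P a b l = (\<alpha> * (q powi l - q powi m)) *s P a b l +
     (case a of 0 \<Rightarrow> 0 | Suc a' \<Rightarrow> qint q (Suc b) *s kki (P a' (Suc b) (l - 2)))"

definition E2f where
  "E2f P a b l = (qint q (Suc a) / qd) *s
      ((q powi (- int a - int b)) *s P (Suc a) b (l - 1) - (q powi (int a + int b)) *s P (Suc a) b (l + 1)) -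
     (qint q (Suc b) / \<alpha>) *s
      ((q powi (1 - int b - l)) *s c1 (P a (Suc b) (l - 1))
        - (dq * q * q powi (- 1 - int b - l)) *s kk (P a (Suc b) (l + 1))
        - (dq * inverse q * q powi (3 - int b - l)) *s kki (P a (Suc b) (l - 3)))"

definition Cf where
  "Cf P a b l = (case b of 0 \<Rightarrow> 0 | Suc b' \<Rightarrow> (\<alpha> * qint q (Suc a)) *s P (Suc a) b' l) +
     (q powi (int a - int b - l)) *s c1 (P a b l) +
     (dq * q * (q powi (int a - int b) - q powi (int a - int b - l - 2))) *s kk (P a b (l + 2)) +
     (dq * inverse q * (q powi (int b - int a) - q powi (int a - int b - l + 2))) *s kki (P a b (l - 2))"

lemma fam_D1f:
  assumes Y: "wsub Y" and P: "fam Y P"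
  shows "fam Y (D1f m P) \<and> val (D1f m P) = \<rho> E1 (val P) - (\<alpha> * q powi m) *s val P"
proof (rule op_transfer[OF _ P])
  show sY: "subspace Y" using Y by (simp add: wsub_def)
  fix a b l y assume y: "y \<in> Y"
  then have W: "y \<in> Wh" and ks: "kki y \<in> Y" using Y by (auto simp: wsub_def)
  have 1: "D1f m (sing a b l y) = sing a b l ((\<alpha> * (q powi l - q powi m)) *s y) +
     (case b of 0 \<Rightarrow> 0 | Suc b' \<Rightarrow> sing (Suc a) b' (l + 2) (qint q b *s kki y))"
    by (auto simp: fun_eq_iff D1f_def sing_def split: nat.splits)
  have f: "fam Y (sing a b l ((\<alpha> * (q powi l - q powi m)) *s y))"
     "fam Y (case b of 0 \<Rightarrow> 0 | Suc b' \<Rightarrow> sing (Suc a) b' (l + 2) (qint q b *s kki y))"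
    using y ks sY by (auto intro!: fam_sing fam_zero subspace_scale split: nat.split)
  show "fam Y (D1f m (sing a b l y)) \<and> val (D1f m (sing a b l y)) = \<rho> E1 (B a b l y) - (\<alpha> * q powi m) *s B a b l y"
    unfolding 1 val_add[OF f] e1_B[OF W]
    by (intro conjI fam_add[OF sY f]) (auto simp: algebra_simps split: nat.splits)
qed (auto simp: D1f_def fun_eq_iff scale_right_distrib split: nat.splits)

lemma fam_E2f:
  assumes Y: "wsub Y" and P: "fam Y P"
  shows "fam Y (E2f P) \<and> val (E2f P) = \<rho> E2 (val P)"
proof (rule op_transfer[OF _ P])
  show sY: "subspace Y" using Y by (simp add: wsub_def)
  fix a b l y assume y: "y \<in> Y"
  then have W: "y \<in> Wh" and ks: "kki y \<in> Y" "kk y \<in> Y" "c1 y \<in> Y" using Y by (auto simp: wsub_def)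
  \<comment> \<open>One singleton for each of the five terms of \<open>e2_B\<close>. The local name
    \<open>f3\<close> hides the operator of the same name.\<close>
  define f1 where "f1 = (case a of 0 \<Rightarrow> 0 | Suc a' \<Rightarrow> sing a' b (l + 1) ((qint q a / qd * q powi (- int a' - int b)) *s y))"
  define f2 where "f2 = (case a of 0 \<Rightarrow> 0 | Suc a' \<Rightarrow> sing a' b (l - 1) ((- qint q a / qd * q powi (int a' + int b)) *s y))"
  define f3 where "f3 = (case b of 0 \<Rightarrow> 0 | Suc b' \<Rightarrow> sing a b' (l + 1) ((- (q powi (- int b' - l) * qint q b / \<alpha>)) *s c1 y))"
  define f4 where "f4 = (case b of 0 \<Rightarrow> 0 | Suc b' \<Rightarrow> sing a b' (l - 1) ((q powi (- int b' - l) * qint q b / \<alpha> * dq * q) *s kk y))"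
  define f5 where "f5 = (case b of 0 \<Rightarrow> 0 | Suc b' \<Rightarrow> sing a b' (l + 3) ((q powi (- int b' - l) * qint q b / \<alpha> * dq * inverse q) *s kki y))"
  have 1: "E2f (sing a b l y) = f1 + (f2 + (f3 + (f4 + f5)))"
    unfolding f1_def f2_def f3_def f4_def f5_def
    by (intro ext) (auto simp: E2f_def sing_def algebra_simps split: nat.splits)
  have f: "fam Y f1" "fam Y f2" "fam Y f3" "fam Y f4" "fam Y f5"
    unfolding f1_def f2_def f3_def f4_def f5_def
    using y ks sY by (auto intro!: fam_sing fam_zero subspace_scale subspace_neg split: nat.split)
  note g = fam_add[OF sY f(4) f(5)]
  note g2 = fam_add[OF sY f(3) g]
  note g3 = fam_add[OF sY f(2) g2]
  have v: "val f1 = (case a of 0 \<Rightarrow> 0 | Suc a' \<Rightarrow> (qint q a / qd * q powi (- int a' - int b)) *s B a' b (l + 1) y)"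
    "val f2 = (case a of 0 \<Rightarrow> 0 | Suc a' \<Rightarrow> (- qint q a / qd * q powi (int a' + int b)) *s B a' b (l - 1) y)"
    "val f3 = (case b of 0 \<Rightarrow> 0 | Suc b' \<Rightarrow> (- (q powi (- int b' - l) * qint q b / \<alpha>)) *s B a b' (l + 1) (c1 y))"
    "val f4 = (case b of 0 \<Rightarrow> 0 | Suc b' \<Rightarrow> (q powi (- int b' - l) * qint q b / \<alpha> * dq * q) *s B a b' (l - 1) (kk y))"
    "val f5 = (case b of 0 \<Rightarrow> 0 | Suc b' \<Rightarrow> (q powi (- int b' - l) * qint q b / \<alpha> * dq * inverse q) *s B a b' (l + 3) (kki y))"
    unfolding f1_def f2_def f3_def f4_def f5_def by (auto split: nat.split)
  show "fam Y (E2f (sing a b l y)) \<and> val (E2f (sing a b l y)) = \<rho> E2 (B a b l y)"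
    unfolding 1 val_add[OF f(1) g3] val_add[OF f(2) g2] val_add[OF f(3) g] val_add[OF f(4) f(5)] e2_B[OF W] v
    by (auto simp: fam_add[OF sY f(1) g3] scale_right_diff_distrib mult.assoc split: nat.splits)
qed (auto simp: E2f_def fun_eq_iff algebra_simps)

text \<open>On vectors with E1 v = \<alpha> v this operator is C1. It is written without E1 because
  a general \<open>val P\<close> is not such an eigenvector.\<close>

lemma fam_Cf:
  assumes Y: "wsub Y" and P: "fam Y P"
  shows "fam Y (Cf P) \<and> val (Cf P) = \<alpha> *s \<rho> F1 (val P) + dq *s (q *s \<rho> K1 (val P) + inverse q *s \<rho> K1i (val P))"
proof (rule op_transfer[OF _ P])
  show sY: "subspace Y" using Y by (simp add: wsub_def)
  fix a b l y assume y: "y \<in> Y"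
  then have W: "y \<in> Wh" and ks: "kki y \<in> Y" "kk y \<in> Y" "c1 y \<in> Y" using Y by (auto simp: wsub_def)
  define f1 where "f1 = (case a of 0 \<Rightarrow> 0 | Suc a' \<Rightarrow> sing a' (Suc b) l ((\<alpha> * qint q a) *s y))"
  define f2 where "f2 = sing a b l ((q powi (int a - int b - l)) *s c1 y)"
  define f3 where "f3 = sing a b (l - 2) ((dq * q * (q powi (int a - int b) - q powi (int a - int b - l))) *s kk y)"
  define f4 where "f4 = sing a b (l + 2) ((dq * inverse q * (q powi (int b - int a) - q powi (int a - int b - l))) *s kki y)"
  have 1: "Cf (sing a b l y) = f1 + (f2 + (f3 + f4))"
    unfolding f1_def f2_def f3_def f4_def
    by (intro ext) (auto simp: Cf_def sing_def algebra_simps split: nat.splits)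
  have f: "fam Y f1" "fam Y f2" "fam Y f3" "fam Y f4"
    unfolding f1_def f2_def f3_def f4_def
    using y ks sY by (auto intro!: fam_sing fam_zero subspace_scale split: nat.split)
  note g = fam_add[OF sY f(3) f(4)]
  note g2 = fam_add[OF sY f(2) g]
  have v: "val f1 = (case a of 0 \<Rightarrow> 0 | Suc a' \<Rightarrow> (\<alpha> * qint q a) *s B a' (Suc b) l y)"
    "val f2 = (q powi (int a - int b - l)) *s B a b l (c1 y)"
    "val f3 = (dq * q * (q powi (int a - int b) - q powi (int a - int b - l))) *s B a b (l - 2) (kk y)"
    "val f4 = (dq * inverse q * (q powi (int b - int a) - q powi (int a - int b - l))) *s B a b (l + 2) (kki y)"
    unfolding f1_def f2_def f3_def f4_def by (auto split: nat.split)
  show "fam Y (Cf (sing a b l y)) \<and> val (Cf (sing a b l y)) = \<alpha> *s \<rho> F1 (B a b l y) + dq *s (q *s \<rho> K1 (B a b l y) + inverse q *s \<rho> K1i (B a b l y))"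
    unfolding 1 val_add[OF f(1) g2] val_add[OF f(2) g] val_add[OF f(3) f(4)] f1_B[OF W] k1_B k1i_B v
    by (rule conjI, simp add: fam_add[OF sY f(1) g2], rule vec_eqI, cases a) (simp, simp add: field_simps, simp, simp add: field_simps)
qed (auto simp: Cf_def fun_eq_iff algebra_simps split: nat.splits)

text \<open>The operator \<open>h_n(K, C1)\<close>.\<close>

definition hop :: "nat \<Rightarrow> 'v \<Rightarrow> 'v" where
  "hop n y = (q powi (3 - 2 * int n)) *s kk y + (q powi (2 * int n - 3)) *s kki y - qd\<^sup>2 *s c1 y"

section \<open>Linear independence over spaces of Whittaker vectors\<close>

lemma shift_zero:
  fixes g :: "int \<Rightarrow> 'v"
  assumes "finite {l. g l \<noteq> 0}" "\<And>l. \<exists>c. g l = c *s g (l + 2)"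
  shows "g l = 0"
proof (rule ccontr)
  assume "g l \<noteq> 0"
  then have ne: "{l. g l \<noteq> 0} \<noteq> {}" by auto
  define m where "m = Max {l. g l \<noteq> 0}"
  have "g m \<noteq> 0" using Max_in[OF assms(1) ne] m_def by simp
  moreover have "g (m + 2) = 0" using Max_ge[OF assms(1), of "m + 2"] m_def by fastforce
  ultimately show False using assms(2)[of m] by auto
qed

lemma fam_fibre: "fam Y P \<Longrightarrow> finite {l. P a b l \<noteq> 0}"
  using finite_vimageI[of "supp P" "\<lambda>l. (a, b, l)"] by (auto simp: fam_def supp_def vimage_def inj_on_def)

text \<open>At (n - b - 1, b) the equation \<open>E2f P = 0\<close> links only the coefficients at
  (n - b, b) and at (n - b - 1, b + 1). Once the latter vanish, the former satisfy a two-term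
  recurrence of step 2 in the exponent of K2, whose finitely supported solutions are zero by
  \<open>shift_zero\<close>.\<close>

lemma E2f_zero_lower:
  assumes P: "fam Y P" "E2f P = 0"
    and top: "\<And>l. P (n - b0) b0 l = 0" and "b \<le> b0" "b0 \<le> n"
  shows "P (n - b) b l = 0"
  using \<open>b \<le> b0\<close>
proof (induction b arbitrary: l rule: inc_induct)
  case base then show ?case by (rule top)
next
  case (step b)
  have n: "Suc (n - Suc b) = n - b" using step.hyps \<open>b0 \<le> n\<close> by simp
  show ?case
  proof (rule shift_zero[of "P (n - b) b"])
    show "finite {l. P (n - b) b l \<noteq> 0}" using P(1) by (rule fam_fibre)
    fix l
    define c1 c2 where "c1 = q powi (- int (n - Suc b) - int b)" and "c2 = q powi (int (n - Suc b) + int b)"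
    have c: "c1 \<noteq> 0" by (simp add: c1_def)
    have "E2f P (n - Suc b) b (l + 1) = 0" using P(2) by (simp add: fun_eq_iff)
    then have "(qint q (n - b) / qd) *s (c1 *s P (n - b) b l - c2 *s P (n - b) b (l + 2)) = 0"
      unfolding E2f_def n step.IH c1_def c2_def by (simp add: add.commute)
    then have "c1 *s P (n - b) b l = c2 *s P (n - b) b (l + 2)"
      using qint_ne_0[of "n - b"] n qd0 unfolding scale_eq_0_iff by simp
    then have "inverse c1 *s (c1 *s P (n - b) b l) = inverse c1 *s c2 *s P (n - b) b (l + 2)" by simp
    then show "\<exists>c. P (n - b) b l = c *s P (n - b) b (l + 2)" using c by auto
  qed
qed

text \<open>Applying \<open>E1 - \<alpha> q^m\<close> to a relation shrinks the support of its coefficient at the highest power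
  of \<open>F3\<close>, so a relation of minimal support is an eigenvector of \<open>E1\<close>; comparing the two
  highest coefficients in \<open>E1\<close> and \<open>E2\<close> then yields \<open>hop m y = 0\<close>.\<close>

lemma free_bounded:
  assumes Y: "wsub Y"
    and inj: "\<And>m y. 1 \<le> m \<Longrightarrow> m < n0 \<Longrightarrow> y \<in> Y \<Longrightarrow> hop m y = 0 \<Longrightarrow> y = 0"
  shows "fam Y P \<Longrightarrow> (\<And>a b l. P a b l \<noteq> 0 \<Longrightarrow> a + b < N \<and> b < n0) \<Longrightarrow> val P = 0 \<Longrightarrow> P = 0"
proof (induction N arbitrary: P)
  case 0 then show ?case by (auto simp: fun_eq_iff)
next
  case (Suc N)
  define R where "R P \<longleftrightarrow> fam Y P \<and> (\<forall>a b l. P a b l \<noteq> 0 \<longrightarrow> a + b < Suc N \<and> b < n0) \<and> val P = 0" for P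
  \<comment> \<open>E2 sends a relation to one of smaller degree, which is trivial by the induction
    hypothesis.\<close>
  have E2: "E2f P = 0" if "R P" for P
  proof (rule Suc.IH)
    show "fam Y (E2f P)" "val (E2f P) = 0"
      using fam_E2f[OF Y, of P] that by (auto simp: R_def)
    fix a b l assume "E2f P a b l \<noteq> 0"
    then have "\<exists>l. P (Suc a) b l \<noteq> 0 \<or> P a (Suc b) l \<noteq> 0"
      by (rule contrapos_np) (simp add: E2f_def)
    then obtain l where "P (Suc a) b l \<noteq> 0 \<or> P a (Suc b) l \<noteq> 0" ..
    then show "a + b < N \<and> b < n0" using that unfolding R_def by fastforce
  qed
  have D1: "R (D1f m P)" if "R P" for m P
    unfolding R_def
  proof (intro conjI allI impI)
    show "fam Y (D1f m P)" "val (D1f m P) = 0"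
      using fam_D1f[OF Y, of P m] that by (auto simp: R_def)
    fix a b l assume "D1f m P a b l \<noteq> 0"
    then have "P a b l \<noteq> 0 \<or> (\<exists>a' l. a = Suc a' \<and> P a' (Suc b) l \<noteq> 0)"
      by (rule contrapos_np) (auto simp: D1f_def split: nat.split)
    then show "a + b < Suc N" "b < n0" using that unfolding R_def by fastforce+
  qed
  have low: "P (n - b) b l = 0" if "R P" "\<And>l. P 0 n l = 0" "b \<le> n" for P n b l
    by (rule E2f_zero_lower[of Y P n n]) (use that E2 in \<open>auto simp: R_def\<close>)
  have min: "\<exists>P l0. R P \<and> {l. P 0 n l \<noteq> 0} = {l0} \<and> (\<forall>b\<le>n. \<forall>l. D1f l0 P (n - b) b l = 0)"
    if RP: "R P" "P 0 n l \<noteq> 0" for P n l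
  proof -
    define S where "S P = {l. P 0 n l \<noteq> (0 :: 'v)}" for P :: "nat \<Rightarrow> nat \<Rightarrow> int \<Rightarrow> 'v"
    obtain P' where P': "R P'" "S P' \<noteq> {}" "\<And>P. R P \<Longrightarrow> S P \<noteq> {} \<Longrightarrow> card (S P') \<le> card (S P)"
      using ex_has_least_nat[of "\<lambda>P. R P \<and> S P \<noteq> {}" P "\<lambda>P. card (S P)"] RP unfolding S_def by blast
    obtain l0 where l0: "l0 \<in> S P'" using P'(2) by auto
    have fin: "finite (S P')" unfolding S_def using fam_fibre P'(1) by (auto simp: R_def)
    \<comment> \<open>At a = 0 the map \<open>D1f l0\<close> multiplies the coefficient of F3^n K2^l
      by \<alpha> (q^l - q^l0), so exactly \<open>l0\<close> leaves the support; by minimality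
      nothing else was in it.\<close>
    have SD: "S (D1f l0 P') = S P' - {l0}" by (auto simp: S_def D1f_def)
    have "card (S P' - {l0}) < card (S P')" using fin l0 by (metis card_Diff1_less)
    then have "S (D1f l0 P') = {}" using P'(3)[OF D1[OF P'(1), of l0]] SD by fastforce
    moreover from this have "S P' = {l0}" using SD l0 by auto
    ultimately show ?thesis
      using low[OF D1[OF P'(1), of l0], of n] P'(1) unfolding S_def by blast
  qed
  have pos: "P 0 (Suc m) l = 0" if RP: "R P" for P m l
  proof (rule ccontr)
    assume ne: "P 0 (Suc m) l \<noteq> 0"
    from min[OF RP this] obtain P l0 where R: "R P" and S: "{l. P 0 (Suc m) l \<noteq> 0} = {l0}"
      and D: "\<And>b l. b \<le> Suc m \<Longrightarrow> D1f l0 P (Suc m - b) b l = 0" by auto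
    define y where "y = P 0 (Suc m) l0"
    have y: "y \<noteq> 0" "y \<in> Y" and m: "Suc m < n0" using S R fam_in unfolding y_def R_def by fast+
    have S0: "P 0 (Suc m) l = 0" if "l \<noteq> l0" for l using S that by auto
    define X M where "X = q powi l0" and "M = q ^ m"
    have XM: "X \<noteq> 0" "M \<noteq> 0" by (simp_all add: X_def M_def)
    have eq0: "E2f P 0 m l = 0" for l using E2[OF R] by simp
    define N where "N = qint q (Suc m)"
    have N: "N \<noteq> 0" by (simp add: N_def)
    \<comment> \<open>The E1-equations at l0 + 2 and l0 - 2 and the E2-equations at l0 + 1 and l0 -
      1 involve only y and the coefficients of F2 F3^m K2^l for l = l0 - 2, l0, l0 + 2. Facts 1, 2
      and 4 express these through \<open>kk y\<close> and \<open>kki y\<close>; fact 3 then becomes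
      h_(m+1)(K, C1) y = 0.\<close>
    have 1: "(\<alpha> * X * (q\<^sup>2 - 1)) *s P 1 m (l0 + 2) + N *s kki y = 0"
      using D[of m "l0 + 2"] unfolding D1f_def X_def y_def N_def by (simp add: power_int_add algebra_simps)
    have 2: "P 1 m (l0 - 2) = 0"
    proof -
      have "q powi (l0 - 2) \<noteq> q powi l0" unfolding q_powi_inject by simp
      then show ?thesis using D[of m "l0 - 2"] S0[of "l0 - 4"] by (simp add: D1f_def)
    qed
    have 3: "(1 / qd) *s (inverse M *s P 1 m l0 - M *s P 1 m (l0 + 2)) = (N / \<alpha> * inverse (M * X)) *s c1 y"
      using eq0[of "l0 + 1"] unfolding E2f_def X_def M_def y_def N_def
      by (simp add: S0 add.commute power_int_diff power_int_minus divide_inverse mult_ac)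
    have 4: "(1 / qd) *s M *s P 1 m l0 = (N / \<alpha> * dq * q * inverse (M * X)) *s kk y"
      using eq0[of "l0 - 1"] 2 unfolding E2f_def X_def M_def y_def N_def
      by (simp add: S0 power_int_diff power_int_minus divide_inverse mult_ac)
    have 5: "q powi (3 - 2 * int (Suc m)) = q / M\<^sup>2" "q powi (2 * int (Suc m) - 3) = M\<^sup>2 / q"
      by (simp_all add: M_def power_int_diff power_int_add power_int_mult power_mult power2_eq_square power3_eq_cube power_mult_distrib)
    define d where "d = qd"
    have d: "d \<noteq> 0" unfolding d_def by (rule qd0)
    have qq: "q\<^sup>2 = d * q + 1" unfolding d_def by (simp add: field_simps power2_eq_square)
    have "hop (Suc m) y = 0"
      unfolding hop_def 5 d_def[symmetric]
    proof (rule vec_eqI)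
      fix \<phi> :: "'v \<Rightarrow> complex"
      assume l: "\<And>x y. \<phi> (x + y) = \<phi> x + \<phi> y" "\<And>x y. \<phi> (x - y) = \<phi> x - \<phi> y" "\<phi> 0 = 0" "\<And>c x. \<phi> (c *s x) = c * \<phi> x"
      define z0 z1 k k' c where "z0 = \<phi> (P 1 m l0)" and "z1 = \<phi> (P 1 m (l0 + 2))" and "k = \<phi> (kk y)"
        and "k' = \<phi> (kki y)" and "c = \<phi> (c1 y)"
      have e1: "\<alpha> * X * (d * q) * z1 + N * k' = 0"
        using arg_cong[OF 1, of \<phi>] by (simp add: l qq k'_def z1_def)
      have e2: "(1 / d) * (inverse M * z0 - M * z1) = (N / \<alpha> * inverse (M * X)) * c"
        using arg_cong[OF 3, of \<phi>] by (simp add: l c_def z0_def z1_def d_def)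
      have e3: "(1 / d) * M * z0 = (N / \<alpha> * (1 / d\<^sup>2) * q * inverse (M * X)) * k"
        using arg_cong[OF 4, of \<phi>] by (simp add: l k_def z0_def d_def dq_def)
      have z0: "z0 = N * q * k / (\<alpha> * d * M\<^sup>2 * X)"
        using e3 d XM by (simp add: field_simps power2_eq_square)
      have z1: "z1 = - N * k' / (\<alpha> * X * d * q)"
        using e1 d XM by (simp add: field_simps) algebra
      have "M * (c * N * d) = M * (\<alpha> * X * (z0 - M\<^sup>2 * z1))"
        using e2 d XM by (simp add: field_simps power2_eq_square)
      then have "c * N * d = \<alpha> * X * (z0 - M\<^sup>2 * z1)" using XM by simp
      then have "c * N = (\<alpha> * X / d) * (z0 - M\<^sup>2 * z1)"
        using d by (simp add: field_simps)
      also have "\<dots> = N * (q * k / (M\<^sup>2 * d\<^sup>2) + M\<^sup>2 * k' / (d\<^sup>2 * q))"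
        unfolding z0 z1 using d XM N by (simp add: field_simps power2_eq_square)
      finally have c: "c = q * k / (M\<^sup>2 * d\<^sup>2) + M\<^sup>2 * k' / (d\<^sup>2 * q)" using N by simp
      show "\<phi> ((q / M\<^sup>2) *s kk y + (M\<^sup>2 / q) *s kki y - d\<^sup>2 *s c1 y) = \<phi> 0"
        unfolding l k_def[symmetric] k'_def[symmetric] c_def[symmetric] unfolding c
        using d XM by (simp add: field_simps)
    qed
    then show False using inj[of "Suc m" y] y m by simp
  qed
  have R: "R P" using Suc.prems by (simp add: R_def)
  have deg: "P a b l = 0" if "R P" "a + b > 0" for P a b l
    using low[OF that(1), of "a + b" b l] pos[OF that(1), of "a + b - 1"] that(2) by simp
  \<comment> \<open>In degree zero minimality leaves a single power of K2, which is
    invertible.\<close>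
  have zero: "P 0 0 l = 0" for l
  proof (rule ccontr)
    assume "P 0 0 l \<noteq> 0"
    from min[OF R this] obtain P l0 where R: "R P" and S: "{l. P 0 0 l \<noteq> 0} = {l0}" by auto
    have eq: "P a b l = sing 0 0 l0 (P 0 0 l0) a b l" for a b l
      using S deg[OF R, of a b l] by (cases "a + b = 0") (auto simp: sing_def)
    have "val P = val (sing 0 0 l0 (P 0 0 l0))" by (rule arg_cong[of _ _ val]) (intro ext, rule eq)
    then have "k2p l0 (P 0 0 l0) = 0" using R by (simp add: R_def B_def)
    then have "k2p (- l0) (k2p l0 (P 0 0 l0)) = 0" by simp
    then show False using S by (auto simp: k2p_k2p)
  qed
  have "P a b l = 0" for a b l using zero[of l] deg[OF R, of a b l] by (cases "a + b = 0") auto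
  then show ?case by (simp add: fun_eq_iff)
qed

lemma free:
  assumes "wsub Y" "\<And>m y. 1 \<le> m \<Longrightarrow> m < n0 \<Longrightarrow> y \<in> Y \<Longrightarrow> hop m y = 0 \<Longrightarrow> y = 0"
    and "fam Y P" "\<And>a b l. P a b l \<noteq> 0 \<Longrightarrow> b < n0" "val P = 0"
  shows "P = 0"
proof -
  have fin: "finite ((\<lambda>(a, b, l). a + b) ` supp P)" using fam_finite[OF assms(3)] by simp
  have "a + b < Suc (Max ((\<lambda>(a, b, l). a + b) ` supp P))" if "P a b l \<noteq> 0" for a b l
    unfolding less_Suc_eq_le by (rule Max_ge[OF fin]) (use that in \<open>force simp: supp_def\<close>)
  then show ?thesis using free_bounded[of Y n0 P] assms by blast
qed

subsection \<open>Submodules generated by Whittaker vectors\<close>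

text \<open>The set J records the powers of F3 that are kept: all of them, or those below n once a
  vanishing u(n,0,1) reduces the others.\<close>

definition Sp :: "nat set \<Rightarrow> 'v set \<Rightarrow> 'v set" where
  "Sp J Y = span {B a b l y |a b l y. b \<in> J \<and> y \<in> Y}"

lemma Sp_B: "b \<in> J \<Longrightarrow> y \<in> Y \<Longrightarrow> B a b l y \<in> Sp J Y"
  unfolding Sp_def by (rule span_base) blast

lemma subspace_Sp [simp]: "subspace (Sp J Y)"
  by (simp add: Sp_def)

lemma Sp_val:
  assumes "subspace Y" "x \<in> Sp J Y"
  shows "\<exists>P. fam Y P \<and> (\<forall>a b l. P a b l \<noteq> 0 \<longrightarrow> b \<in> J) \<and> val P = x"
  using assms(2) unfolding Sp_def
proof (induction rule: span_induct_alt)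
  case base
  show ?case
  proof (intro exI conjI allI impI)
    show "fam Y 0" by (rule fam_zero[OF assms(1)])
    show "val 0 = 0" by (rule val_zero)
  qed simp
next
  case (step c x z)
  then obtain a b l y P where x: "x = B a b l y" "b \<in> J" "y \<in> Y"
    and P: "fam Y P" "\<And>a b l. P a b l \<noteq> 0 \<Longrightarrow> b \<in> J" "val P = z" by blast
  have f: "fam Y (sing a b l (c *s y))" using assms(1) x by (simp add: fam_sing subspace_scale)
  show ?case
  proof (intro exI conjI allI impI)
    show "fam Y (sing a b l (c *s y) + P)" by (rule fam_add[OF assms(1) f P(1)])
    show "val (sing a b l (c *s y) + P) = c *s x + z" by (simp only: val_add[OF f P(1)] val_sing P x B_scale)
    show "b' \<in> J" if "(sing a b l (c *s y) + P) a' b' l' \<noteq> 0" for a' b' l'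
      using that P(2)[of a' b' l'] x(2) by (auto simp: sing_def split: if_splits)
  qed
qed

lemma Sp_rho:
  assumes Y: "wsub Y" and "x \<in> Sp UNIV Y"
  shows "\<rho> g x \<in> Sp UNIV Y"
  using assms(2) unfolding Sp_def[of UNIV]
proof (induction rule: span_induct_alt)
  case base then show ?case by (simp add: span_zero)
next
  case (step c x z)
  let ?S = "span {B a b l y |a b l y. b \<in> UNIV \<and> y \<in> Y}"
  obtain a b l y where x: "x = B a b l y" and y: "y \<in> Y" using step by blast
  have y': "y \<in> Wh" "kk y \<in> Y" "kki y \<in> Y" "c1 y \<in> Y" using y Y by (auto simp: wsub_def)
  have B: "B a b l u \<in> ?S" if "u \<in> Y" for a b l u using that by (intro span_base) blast
  have "\<rho> g x \<in> ?S"
  proof (cases g)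
    case E1 then show ?thesis unfolding x E1 e1_B[OF y'(1)]
      using B y y' by (auto intro!: span_add span_scale span_diff span_zero split: nat.split)
  next
    case E2 then show ?thesis unfolding x E2 e2_B[OF y'(1)]
      using B y y' by (auto intro!: span_add span_scale span_diff span_zero span_neg split: nat.split)
  next
    case F1 then show ?thesis unfolding x F1 f1_B[OF y'(1)]
      using B y y' by (auto intro!: span_add span_scale span_diff span_zero split: nat.split)
  qed (use B y y' in \<open>auto simp: x k1_B k1i_B k2_B k2i_B f2_B intro!: span_scale\<close>)
  then show ?case using step.IH by (auto intro: span_add span_scale)
qed

subsection \<open>The singular vectors\<close>

definition kp :: "int \<Rightarrow> 'v \<Rightarrow> 'v" where
  "kp m x = (if m \<ge> 0 then (kk ^^ nat m) x else (kki ^^ nat (- m)) x)"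

lemma kp_0 [simp]: "kp 0 x = x" by (simp add: kp_def)

lemma kk_kp [simp]: "kk (kp l x) = kp (l + 1) x"
proof (cases "l \<ge> 0")
  case True then show ?thesis by (simp add: kp_def nat_add_distrib)
next
  case False
  then obtain n where "l = - int (Suc n)" by (metis int_cases not_le of_nat_0_le_iff)
  then show ?thesis by (auto simp: kp_def nat_add_distrib)
qed

lemma kki_kp [simp]: "kki (kp l x) = kp (l - 1) x"
  using kk_kp[of "l - 1" x] by (simp add: kki_flip)

lemma kp_commute:
  assumes "\<And>x. T (kk x) = kk (T x)"
  shows "T (kp l x) = kp l (T x)"
proof (induction l rule: int_induct[where k = 0])
  case base then show ?case by simp
next
  case (step1 i) then show ?case using assms[of "kp i x"] by simp
next
  case (step2 i)
  have "kk (T (kp (i - 1) x)) = kk (kp (i - 1) (T x))"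
    using step2 assms[of "kp (i - 1) x"] by simp
  then show ?case by (metis kki_kk)
qed

lemma kp_plus [simp]: "kp l (x + y) = kp l x + kp l y"
proof (induction l rule: int_induct[where k = 0])
  case base then show ?case by simp
next
  case (step1 i) then show ?case using kk_kp[of i] by (metis kk_add)
next
  case (step2 i) then show ?case using kki_kp[of i] by (metis kki_add)
qed

lemma kp_scale [simp]: "kp l (c *s x) = c *s kp l x"
  using kp_commute[of "\<lambda>x. c *s x" l x] by simp

lemma kk_kp_r: "kp l (kk x) = kp (l + 1) x"
  using kp_commute[of kk l x] by simp

lemma kp_inverse: "kp (- int n) (kp (int n) y) = y"
proof (induction n)
  case (Suc n)
  have "kp (- int (Suc n)) (kp (int (Suc n)) y) = kp (- int (Suc n)) (kk (kp (int n) y))"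
    by (simp add: add.commute)
  also have "\<dots> = kp (- int n) (kp (int n) y)" by (simp only: kk_kp_r) simp
  finally show ?case using Suc by simp
qed simp

lemma kki_kp_r: "kp l (kki x) = kp (l - 1) x"
  using kp_commute[of kki l x] by simp

lemma c1_kp: "c1 (kp l x) = kp l (c1 x)"
  by (rule kp_commute) (rule c1_kk)

lemma wsub_kp: "wsub Y \<Longrightarrow> y \<in> Y \<Longrightarrow> kp m y \<in> Y"
proof (induction m rule: int_induct[where k = 0])
  case (step1 i) then show ?case using kk_kp[of i y] by (metis wsub_def)
next
  case (step2 i) then show ?case using kki_kp[of i y] by (metis wsub_def)
qed simp

text \<open>The coefficients \<open>a_kj(n)\<close> with \<open>j\<close> running over the integers, so that the recurrences below
  need no boundary cases.\<close>

definition Az :: "nat \<Rightarrow> nat \<Rightarrow> int \<Rightarrow> complex" where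
  "Az n k m = (if m < 0 then 0 else acoef q \<alpha> n k (nat m))"

definition qi :: "int \<Rightarrow> complex" where
  "qi m = (q powi m - q powi (- m)) / qd"

lemma qi_nat [simp]: "qi (int n) = qint q n"
  by (simp add: qi_def qint_powi)

lemma qfact_Suc: "qfact q (Suc n) = qint q (Suc n) * qfact q n"
  by (simp add: qfact_def atLeastAtMostSuc_conv)

lemma qfact_ne_0 [simp]: "qfact q n \<noteq> 0"
  by (simp add: qfact_def)

lemma acoef_eq_0: "k > n \<or> j > n - k \<Longrightarrow> acoef q \<alpha> n k j = 0"
  by (auto simp: acoef_def qbin_def)

text \<open>With r = n - k - j the two Gaussian binomials multiply to one q-multinomial coefficient,
  so that ratios of neighbouring coefficients can be read off.\<close>

lemma acoef_eq:
  assumes "k + j + r = n"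
  shows "acoef q \<alpha> n k j = (-1) ^ j * \<alpha> ^ k * (q^2 - 1) ^ k * q powi (int j * (int n - 3))
     * q powi ((int k * (2 * int n + 2 * int j + int k - 7)) div 2)
     * (qfact q n / (qfact q k * qfact q j * qfact q r))"
proof -
  have "n - k - j = r" "k \<le> n" "j \<le> n - k" using assms by auto
  then show ?thesis by (simp add: acoef_def qbin_def)
qed

text \<open>Raising k by one changes the halved exponent by n + j + k - 3 and adds a factor q^2 - 1
  = q (q - q^-1); together they account for q^(2-n-k-j). Outside the triangle k + j < n both sides
  vanish, on its edge k + j = n because of the factor [0].\<close>

lemma acoef_Suc_left:
  "\<alpha> * qd * qi (int n - int k - int j) * acoef q \<alpha> n k j =
     q powi (2 - int n - int k - int j) * qint q (Suc k) * acoef q \<alpha> n (Suc k) j"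
proof (cases "k + j < n")
  case False
  have "acoef q \<alpha> n (Suc k) j = 0" by (rule acoef_eq_0) (use False in linarith)
  moreover have "qi (int n - int k - int j) = 0 \<or> acoef q \<alpha> n k j = 0"
  proof (cases "k + j = n")
    case True
    then show ?thesis by (auto simp: qi_def)
  next
    case F: False
    have "acoef q \<alpha> n k j = 0" by (rule acoef_eq_0) (use F False in linarith)
    then show ?thesis ..
  qed
  ultimately show ?thesis by auto
next
  case True
  define r where "r = n - Suc (k + j)"
  have r: "k + j + Suc r = n" using True by (simp add: r_def)
  have r': "Suc k + j + r = n" "int n - int k - int j = int (Suc r)" using r by auto
  define e where "e = int k * (2 * int n + 2 * int j + int k - 7)"
  have e: "int (Suc k) * (2 * int n + 2 * int j + int (Suc k) - 7) = e + 2 * (int n + int j + int k - 3)"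
    by (simp add: e_def algebra_simps)
  have "(e + 2 * (int n + int j + int k - 3)) div 2 = e div 2 + (int n + int j + int k - 3)" by simp
  then have p: "q powi ((e + 2 * (int n + int j + int k - 3)) div 2) = q powi (e div 2) * q powi (int n + int j + int k - 3)"
    by (simp only: power_int_add[OF disjI1[OF q0]])
  have p2: "q powi (2 - int n - int k - int j) * q powi (int n + int j + int k - 3) = inverse q"
    by (simp flip: power_int_add add: power_int_minus)
  have qq: "q\<^sup>2 - 1 = q * qd" by (simp add: power2_eq_square algebra_simps)
  define C where "C = (-1) ^ j * \<alpha> ^ Suc k * (q^2 - 1) ^ k * q powi (int j * (int n - 3)) * q powi (e div 2)"
  have "\<alpha> * qd * qi (int n - int k - int j) * acoef q \<alpha> n k j =
      qd * C * (qfact q n / (qfact q k * qfact q j * qfact q r))"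
    unfolding r' qi_nat acoef_eq[OF r] qfact_Suc C_def e_def[symmetric] by (simp add: field_simps)
  also have "\<dots> = (q powi (2 - int n - int k - int j) * q powi (int n + int j + int k - 3)) * qint q (Suc k) *
      (C * (q\<^sup>2 - 1)) * (qfact q n / (qfact q (Suc k) * qfact q j * qfact q r))"
    unfolding p2 qfact_Suc qq by (simp add: field_simps)
  also have "\<dots> = q powi (2 - int n - int k - int j) * qint q (Suc k) * acoef q \<alpha> n (Suc k) j"
    unfolding acoef_eq[OF r'(1)] e p C_def by simp
  finally show ?thesis .
qed

text \<open>Coefficient by coefficient this is the equation E1 u = \<alpha> u; see
  \<open>D1f_U\<close>.\<close>

lemma acoef_shift:
  "\<alpha> * (q ^ (2 * Suc j) - 1) * acoef q \<alpha> n k (Suc j) = - qint q (Suc k) * acoef q \<alpha> n (Suc k) j"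
proof (cases "k + j < n")
  case False
  have "acoef q \<alpha> n (Suc k) j = 0" by (rule acoef_eq_0) (use False in linarith)
  moreover have "acoef q \<alpha> n k (Suc j) = 0" by (rule acoef_eq_0) (use False in linarith)
  ultimately show ?thesis by simp
next
  case True
  define r where "r = n - Suc (k + j)"
  have r: "k + Suc j + r = n" using True by (simp add: r_def)
  have r': "Suc k + j + r = n" using r by auto
  define e where "e = int k * (2 * int n + 2 * int j + int k - 7)"
  have e: "int (Suc k) * (2 * int n + 2 * int j + int (Suc k) - 7) = e + 2 * (int n + int j + int k - 3)"
    "int k * (2 * int n + 2 * int (Suc j) + int k - 7) = e + 2 * int k"
    by (simp_all add: e_def algebra_simps)
  have "(e + 2 * (int n + int j + int k - 3)) div 2 = e div 2 + (int n + int j + int k - 3)"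
    "(e + 2 * int k) div 2 = e div 2 + int k" by simp_all
  then have p: "q powi ((e + 2 * (int n + int j + int k - 3)) div 2) = q powi (e div 2) * q powi (int n + int j + int k - 3)"
    "q powi ((e + 2 * int k) div 2) = q powi (e div 2) * q powi (int k)"
    by (simp_all only: power_int_add[OF disjI1[OF q0]])
  have p2: "q powi (int (Suc j) * (int n - 3)) * q powi (int k) = q powi (- int j) * (q powi (int j * (int n - 3)) * q powi (int n + int j + int k - 3))"
    by (simp flip: power_int_add add: algebra_simps del: power_int_of_nat)
  have qq: "q ^ (2 * Suc j) - 1 = (q\<^sup>2 - 1) * q ^ j * qint q (Suc j)"
  proof -
    have "(q ^ (2 * Suc j) - 1) * qd = (q\<^sup>2 - 1) * q ^ j * (q ^ Suc j - inverse q ^ Suc j)"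
      by (simp add: field_simps power2_eq_square power_add mult_2_right)
    then show ?thesis using qd0 unfolding qint_def by (simp add: eq_divide_eq)
  qed
  define C where "C = (-1) ^ j * \<alpha> ^ Suc k * (q^2 - 1) ^ Suc k * q powi (e div 2)"
  have "\<alpha> * (q ^ (2 * Suc j) - 1) * acoef q \<alpha> n k (Suc j) =
     - C * q ^ j * (q powi (int (Suc j) * (int n - 3)) * q powi (int k)) * (qfact q n / (qfact q k * qfact q j * qfact q r))"
    unfolding acoef_eq[OF r] qq e p qfact_Suc C_def by (simp add: field_simps)
  also have "\<dots> = - qint q (Suc k) * acoef q \<alpha> n (Suc k) j"
    unfolding acoef_eq[OF r'] e p p2 qfact_Suc C_def by (simp add: power_int_minus field_simps)
  finally show ?thesis .
qed

lemma Az_shift: "\<alpha> * (q powi (2 * m) - 1) * Az n k m = - qint q (Suc k) * Az n (Suc k) (m - 1)"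
proof (cases "m \<le> 0")
  case True then show ?thesis by (cases "m = 0") (auto simp: Az_def)
next
  case False
  define j where "j = nat (m - 1)"
  have m: "m = int (Suc j)" and j: "nat m = Suc j" "nat (m - 1) = j" using False by (auto simp: j_def)
  have "q powi (2 * m) = q ^ (2 * Suc j)"
    unfolding m by (simp flip: power_int_of_nat)
  then show ?thesis using acoef_shift[of j n k] False by (simp add: Az_def j del: power_Suc)
qed

lemma Az_Suc: "\<alpha> * qd * qi (int n - int k - m) * Az n k m =
    q powi (2 - int n - int k - m) * qint q (Suc k) * Az n (Suc k) m"
  using acoef_Suc_left[of n k "nat m"] by (auto simp: Az_def)

text \<open>Eliminating the neighbour at k + 1 between \<open>Az_shift\<close> at m + 1 and
  \<open>Az_Suc\<close> at m leaves a recurrence in m alone.\<close>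

lemma Az_step: "(q powi (2 * m + 2) - 1) * Az n k (m + 1) =
   - qd * qi (int n - int k - m) * q powi (int n + int k + m - 2) * Az n k m"
proof -
  have "\<alpha> * ((q powi (2 * m + 2) - 1) * Az n k (m + 1)) = - qint q (Suc k) * Az n (Suc k) m"
    using Az_shift[of "m + 1" n k] by (simp add: mult.assoc distrib_left)
  also have "\<dots> = - (q powi (int n + int k + m - 2) * q powi (2 - int n - int k - m)) * (qint q (Suc k) * Az n (Suc k) m)"
    by (simp flip: power_int_add)
  also have "\<dots> = \<alpha> * (- qd * qi (int n - int k - m) * q powi (int n + int k + m - 2) * Az n k m)"
    using Az_Suc[of n k m] by algebra
  finally show ?thesis by (simp only: mult_cancel_left \<alpha>0) simp
qed

text \<open>The coefficient family of u(n,0,1), with b for k and l for 2j, so that the exponent -2j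
  - k of K reads - l - b. The power of K is applied to y and thus belongs to the
  coefficient.\<close>

definition U :: "nat \<Rightarrow> 'v \<Rightarrow> nat \<Rightarrow> nat \<Rightarrow> int \<Rightarrow> 'v" where
  "U n y = (\<lambda>a b l. if a + b = n \<and> even l then Az n b (l div 2) *s kp (- l - int b) y else 0)"

text \<open>The vector \<open>u(n,0,1)\<close> with \<open>y\<close> in place of the generator of \<open>M(\<eta>)\<close>.\<close>

definition u :: "nat \<Rightarrow> 'v \<Rightarrow> 'v" where "u n y = val (U n y)"

definition KJ :: "nat \<Rightarrow> (nat \<times> nat) set" where "KJ n = {(k, j). k \<le> n \<and> j \<le> n - k}"

lemma finite_KJ [simp]: "finite (KJ n)"
  by (rule finite_subset[of _ "{..n} \<times> {..n}"]) (auto simp: KJ_def)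

lemma supp_U: "supp (U n y) \<subseteq> (\<lambda>(k, j). (n - k, k, 2 * int j)) ` KJ n"
proof
  fix x assume "x \<in> supp (U n y)"
  then obtain a b l where x: "x = (a, b, l)" "U n y a b l \<noteq> 0" by (auto simp: supp_def)
  then have ab: "a + b = n" "even l" and A: "Az n b (l div 2) \<noteq> 0" by (auto simp: U_def split: if_splits)
  define j where "j = nat (l div 2)"
  have l: "l = 2 * int j" using A ab(2) by (auto simp: Az_def j_def split: if_splits)
  have "acoef q \<alpha> n b j \<noteq> 0" using A by (auto simp: Az_def j_def split: if_splits)
  then have "j \<le> n - b" using acoef_eq_0 by (metis not_le)
  then show "x \<in> (\<lambda>(k, j). (n - k, k, 2 * int j)) ` KJ n"
    using ab l x by (intro image_eqI[of _ _ "(b, j)"]) (auto simp: KJ_def)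
qed

lemma u_eq: "u n y = (\<Sum>(k, j)\<in>KJ n. acoef q \<alpha> n k j *s B (n - k) k (2 * int j) (kp (- 2 * int j - int k) y))"
proof -
  have inj: "inj_on (\<lambda>(k, j). (n - k, k, 2 * int j)) (KJ n)" by (auto simp: inj_on_def)
  show ?thesis
    unfolding u_def
    by (subst val_superset[OF finite_imageI[OF finite_KJ] supp_U], subst sum.reindex[OF inj], rule sum.cong)
      (auto simp: U_def Az_def KJ_def)
qed

lemma fam_U:
  assumes "wsub Y" "y \<in> Y" shows "fam Y (U n y)"
  unfolding fam_def
proof (intro conjI allI)
  show "finite (supp (U n y))" by (rule finite_subset[OF supp_U]) simp
  show "U n y a b l \<in> Y" for a b l
    using assms wsub_kp[OF assms] by (auto simp: U_def wsub_def subspace_scale subspace_0)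
qed

lemma c1_hop: "hop n y = 0 \<Longrightarrow> c1 y = (dq * q powi (3 - 2 * int n)) *s kk y + (dq * q powi (2 * int n - 3)) *s kki y"
proof -
  assume "hop n y = 0"
  then have "qd\<^sup>2 *s c1 y = (q powi (3 - 2 * int n)) *s kk y + (q powi (2 * int n - 3)) *s kki y"
    by (simp add: hop_def)
  then have "dq *s (qd\<^sup>2 *s c1 y) = dq *s ((q powi (3 - 2 * int n)) *s kk y + (q powi (2 * int n - 3)) *s kki y)" by simp
  moreover have "dq * qd\<^sup>2 = 1" using qd0 by (simp add: dq_def)
  ultimately show ?thesis by (simp add: scale_right_distrib)
qed

lemma D1f_U: "D1f 0 (U n y) = 0"
proof (intro ext)
  fix a b l
  show "D1f 0 (U n y) a b l = 0 a b l"
  proof (cases "a + b = n \<and> even l")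
    case True
    then obtain m where l: "l = 2 * m" by auto
    have "D1f 0 (U n y) a b l = (\<alpha> * (q powi (2 * m) - 1) * Az n b m) *s kp (- l - int b) y +
      (qint q (Suc b) * Az n (Suc b) (m - 1)) *s kp (- l - int b) y"
    proof (cases a)
      case 0
      then have "Az n (Suc b) (m - 1) = 0" using True by (auto simp: Az_def acoef_eq_0)
      then show ?thesis using 0 True l by (simp add: D1f_def U_def)
    next
      case (Suc a')
      then show ?thesis using True l 
        by (auto simp: D1f_def U_def algebra_simps intro!: arg_cong[of _ _ "\<lambda>i. kp i y"])
    qed
    then show ?thesis unfolding Az_shift by (simp add: scale_left_distrib[symmetric])
  next
    case False
    then show ?thesis by (auto simp: D1f_def U_def split: nat.split)
  qed
qed

lemma U_even: "a + b = n \<Longrightarrow> U n y a b (2 * m) = Az n b m *s kp (- 2 * m - int b) y"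
  by (simp add: U_def)

lemma kp_cong: "i = j \<Longrightarrow> kp i x = kp j x"
  by simp

text \<open>By \<open>c1_hop\<close> every term is a multiple of K^(-2m-b) y or of K^(-2m-b-2) y,
  and the two scalar factors vanish separately by the recurrences for \<open>Az\<close>. Only odd l
  matter because E2 shifts the exponent of K2 by an odd number.\<close>

lemma E2f_U:
  assumes "hop n y = 0"
  shows "E2f (U n y) = 0"
proof (intro ext)
  fix a b l
  show "E2f (U n y) a b l = 0 a b l"
  proof (cases "Suc a + b = n \<and> odd l")
    case True
    then obtain m where l: "l = 2 * m + 1" by (auto elim: oddE)
    have n: "Suc (a + b) = n" "a = n - Suc b" "int n - int b = int (Suc a)" using True by auto
    define x z where "x = kp (- 2 * m - int b) y" and "z = kp (- 2 * m - int b - 2) y"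
    define N1 N2 N3 where "N1 = Az n b m" and "N2 = Az n b (m + 1)" and "N3 = qint q (Suc b)"
    define R where "R = q powi (1 - int b - l)"
    \<comment> \<open>\<open>A1\<close> and \<open>A2\<close> serve the coefficient of x and bring
      everything back to \<open>N1\<close>; \<open>A3\<close> and \<open>A4\<close> serve the
      coefficient of z and bring everything back to \<open>N2\<close>.\<close>
    have A1: "N3 * Az n (Suc b) m = q powi (int n + int b + m - 2) * (\<alpha> * qd * qi (int n - int b - m) * N1)"
      unfolding N1_def N3_def Az_Suc by (simp add: mult.assoc[symmetric] flip: power_int_add)
    have A2: "N3 * Az n (Suc b) (m - 1) = - \<alpha> * (q powi (2 * m) - 1) * N1"
      using Az_shift[of m n b] unfolding N1_def N3_def by simp
    have A3: "N3 * Az n (Suc b) m = - \<alpha> * (q powi (2 * (m + 1)) - 1) * N2"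
      using Az_shift[of "m + 1" n b] unfolding N2_def N3_def by simp
    have A4: "N3 * Az n (Suc b) (m + 1) = q powi (int n + int b + (m + 1) - 2) * (\<alpha> * qd * qi (int n - int b - (m + 1)) * N2)"
      unfolding N2_def N3_def Az_Suc by (simp add: mult.assoc[symmetric] flip: power_int_add)
    have c: "c1 (kp (- 2 * m - int (Suc b)) y) = (dq * q powi (3 - 2 * int n)) *s x + (dq * q powi (2 * int n - 3)) *s z"
      unfolding c1_kp c1_hop[OF assms] x_def z_def kp_plus kp_scale kk_kp_r kki_kp_r
      by (intro arg_cong2[of _ _ _ _ "(+)"] arg_cong2[of _ _ _ _ "(*s)"] kp_cong refl) auto
    have ls: "l - 1 = 2 * m" "l + 1 = 2 * (m + 1)" "l - 3 = 2 * (m - 1)" using l by auto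
    have v: "U n y (Suc a) b (l - 1) = N1 *s x" "U n y (Suc a) b (l + 1) = N2 *s z"
      "c1 (U n y a (Suc b) (l - 1)) = Az n (Suc b) m *s ((dq * q powi (3 - 2 * int n)) *s x + (dq * q powi (2 * int n - 3)) *s z)"
      "kk (U n y a (Suc b) (l + 1)) = Az n (Suc b) (m + 1) *s z"
      "kki (U n y a (Suc b) (l - 3)) = Az n (Suc b) (m - 1) *s x"
    proof -
      have i: "Suc a + b = n" "a + Suc b = n" using n(1) by auto
      show "U n y (Suc a) b (l - 1) = N1 *s x" "U n y (Suc a) b (l + 1) = N2 *s z"
        unfolding ls U_even[OF i(1)] N1_def N2_def x_def z_def by (auto intro!: arg_cong2[of _ _ _ _ "(*s)"] kp_cong)
      show "c1 (U n y a (Suc b) (l - 1)) = Az n (Suc b) m *s ((dq * q powi (3 - 2 * int n)) *s x + (dq * q powi (2 * int n - 3)) *s z)"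
        unfolding ls U_even[OF i(2)] c1_scale c ..
      show "kk (U n y a (Suc b) (l + 1)) = Az n (Suc b) (m + 1) *s z"
        "kki (U n y a (Suc b) (l - 3)) = Az n (Suc b) (m - 1) *s x"
        unfolding ls U_even[OF i(2)] kk_scale kki_scale kk_kp kki_kp x_def z_def
        by (auto intro!: arg_cong2[of _ _ _ _ "(*s)"] kp_cong)
    qed
    have ex: "- int a - int b = 1 - int n" "int a + int b = int n - 1" "1 - int b - l = - int b - 2 * m"
      "- 1 - int b - l = - 2 - int b - 2 * m" "3 - int b - l = 2 - int b - 2 * m"
      using n(1) l by auto
    have e: "E2f (U n y) a b l =
       (qint q (Suc a) / qd) *s ((q powi (1 - int n) * N1) *s x - (q powi (int n - 1) * N2) *s z) -
       (1 / \<alpha>) *s ((q powi (- int b - 2 * m) * (N3 * Az n (Suc b) m)) *s ((dq * q powi (3 - 2 * int n)) *s x + (dq * q powi (2 * int n - 3)) *s z)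
        - (dq * q * q powi (- 2 - int b - 2 * m) * (N3 * Az n (Suc b) (m + 1))) *s z
        - (dq * inverse q * q powi (2 - int b - 2 * m) * (N3 * Az n (Suc b) (m - 1))) *s x)"
      unfolding E2f_def v ex N3_def by (rule vec_eqI, simp, simp add: algebra_simps)
    define Q1 Q2 Q3 where "Q1 = q ^ n" and "Q2 = q ^ b" and "Q3 = q powi m"
    have Q: "Q1 \<noteq> 0" "Q2 \<noteq> 0" "Q3 \<noteq> 0" by (simp_all add: Q1_def Q2_def Q3_def)
    define d where "d = qd"
    have d: "d \<noteq> 0" unfolding d_def by (rule qd0)
    have q2m: "q powi (2 * m) = Q3\<^sup>2" by (simp add: Q3_def power_int_mult mult.commute[of 2 m])
    have a': "qint q (Suc a) = (Q1 / Q2 - Q2 / Q1) / d"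
      unfolding qi_nat[symmetric] n(3)[symmetric] qi_def d_def Q1_def Q2_def by (simp add: power_int_diff)
    have 1: "(qint q (Suc a) / qd) * (q powi (1 - int n) * N1) -
      (1 / \<alpha>) * (q powi (- int b - 2 * m) * (N3 * Az n (Suc b) m) * (dq * q powi (3 - 2 * int n))
         - dq * inverse q * q powi (2 - int b - 2 * m) * (N3 * Az n (Suc b) (m - 1))) = 0" (is "?c1 = 0")
      unfolding A1 A2 a' dq_def qi_def d_def[symmetric]
      using Q d by (simp add: power_int_diff power_int_add power_int_minus q2m power_int_mult field_simps power2_eq_square
        Q1_def[symmetric] Q2_def[symmetric] Q3_def[symmetric] power3_eq_cube)
    have 2: "- (qint q (Suc a) / qd) * (q powi (int n - 1) * N2) -
      (1 / \<alpha>) * (q powi (- int b - 2 * m) * (N3 * Az n (Suc b) m) * (dq * q powi (2 * int n - 3))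
         - dq * q * q powi (- 2 - int b - 2 * m) * (N3 * Az n (Suc b) (m + 1))) = 0" (is "?c2 = 0")
      unfolding A3 A4 a' dq_def qi_def d_def[symmetric]
      using Q d by (simp add: power_int_diff power_int_add power_int_minus q2m power_int_mult field_simps power2_eq_square
        Q1_def[symmetric] Q2_def[symmetric] Q3_def[symmetric] power3_eq_cube)
    have "E2f (U n y) a b l = ?c1 *s x + ?c2 *s z"
      unfolding e by (rule vec_eqI, simp, simp add: algebra_simps diff_divide_distrib add_divide_distrib)
    then show ?thesis unfolding 1 2 by simp
  next
    case False
    then show ?thesis by (auto simp: E2f_def U_def)
  qed
qed

text \<open>The origin of c_-: on u(n,0,1) the element C1 acts as (q^(3-n) K + q^(n-3) K^-1) / (q -
  q^-1)^2 acts on y. As in \<open>E2f_U\<close>, everything is a multiple of two vectors x and z;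
  the factor of z vanishes by \<open>Az_step\<close> at m, that of x by \<open>Az_step\<close> at m
  - 1 and the elimination in \<open>H4\<close>.\<close>

lemma Cf_U:
  assumes "hop n y = 0"
  shows "Cf (U n y) = U n ((dq * q powi (3 - int n)) *s kk y + (dq * q powi (int n - 3)) *s kki y)"
proof (intro ext)
  fix a b l
  let ?y = "(dq * q powi (3 - int n)) *s kk y + (dq * q powi (int n - 3)) *s kki y"
  show "Cf (U n y) a b l = U n ?y a b l"
  proof (cases "a + b = n \<and> even l")
    case True
    then obtain m where l: "l = 2 * m" by auto
    have n: "a + b = n" "int a = int n - int b" using True by auto
    define x z where "x = kp (- 2 * m - int b + 1) y" and "z = kp (- 2 * m - int b - 1) y"
    define N N2 N3 where "N = Az n b m" and "N2 = Az n b (m + 1)" and "N3 = Az n b (m - 1)"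
    define N4 where "N4 = (case b of 0 \<Rightarrow> 0 | Suc b' \<Rightarrow> qint q (Suc a) * Az n b' m)"
    have ls: "l + 2 = 2 * (m + 1)" "l - 2 = 2 * (m - 1)" using l by auto
    have v1: "U n y a b (l + 2) = N2 *s kp (- 2 * (m + 1) - int b) y"
      "U n y a b (l - 2) = N3 *s kp (- 2 * (m - 1) - int b) y"
      "U n y a b l = N *s kp (- 2 * m - int b) y"
      unfolding ls unfolding l U_even[OF n(1)] N2_def N3_def N_def by simp_all
    have v2: "(case b of 0 \<Rightarrow> 0 | Suc b' \<Rightarrow> (\<alpha> * qint q (Suc a)) *s U n y (Suc a) b' l) = (\<alpha> * N4) *s x"
    proof (cases b)
      case (Suc b')
      then have i: "Suc a + b' = n" using n by auto
      show ?thesis unfolding Suc nat.case N4_def l U_even[OF i] x_def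
        by (auto intro!: arg_cong2[of _ _ _ _ "(*s)"] kp_cong)
    qed (simp add: N4_def)
    have v3: "kk (kp (- 2 * (m + 1) - int b) y) = z" "kki (kp (- 2 * (m - 1) - int b) y) = x"
      unfolding kk_kp kki_kp x_def z_def by (auto intro!: kp_cong)
    have v4: "c1 (kp (- 2 * m - int b) y) = (dq * q powi (3 - 2 * int n)) *s x + (dq * q powi (2 * int n - 3)) *s z"
      unfolding c1_kp c1_hop[OF assms] x_def z_def kp_plus kp_scale kk_kp_r kki_kp_r ..
    have v5: "U n ?y a b l = (N * (dq * q powi (3 - int n))) *s x + (N * (dq * q powi (int n - 3))) *s z"
      unfolding l U_even[OF n(1)] x_def z_def kp_plus kp_scale kk_kp_r kki_kp_r N_def
      by (simp add: scale_right_distrib)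
    have e: "Cf (U n y) a b l - U n ?y a b l =
       (\<alpha> * N4 + q powi (int a - int b - l) * N * dq * q powi (3 - 2 * int n)
         + dq * inverse q * (q powi (int b - int a) - q powi (int a - int b - l + 2)) * N3 - N * dq * q powi (3 - int n)) *s x +
       (q powi (int a - int b - l) * N * dq * q powi (2 * int n - 3)
         + dq * q * (q powi (int a - int b) - q powi (int a - int b - l - 2)) * N2 - N * dq * q powi (int n - 3)) *s z"
      unfolding Cf_def v2 v1 c1_scale kk_scale kki_scale v3 v4 v5 by (rule vec_eqI, simp, simp add: algebra_simps)
    define Q1 Q2 Q3 where "Q1 = q ^ n" and "Q2 = q ^ b" and "Q3 = q powi m"
    have Q: "Q1 \<noteq> 0" "Q2 \<noteq> 0" "Q3 \<noteq> 0" by (simp_all add: Q1_def Q2_def Q3_def)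
    define d where "d = qd"
    have d: "d \<noteq> 0" unfolding d_def by (rule qd0)
    have q2b: "q powi (2 * int b) = Q2\<^sup>2" "q powi (int b * 2) = Q2\<^sup>2" by (simp_all add: Q2_def power_int_mult mult.commute[of 2])
    have q2m: "q powi (2 * m) = Q3\<^sup>2" "q powi (m * 2) = Q3\<^sup>2" by (simp_all add: Q3_def power_int_mult mult.commute[of 2 m])
    have q2n: "q powi (2 * int n) = Q1\<^sup>2" "q powi (int n * 2) = Q1\<^sup>2" by (simp_all add: Q1_def power_int_mult mult.commute[of 2])
    note simps = power_int_diff power_int_add power_int_minus q2m q2n q2b
        Q1_def[symmetric] Q2_def[symmetric] Q3_def[symmetric] power3_eq_cube l n(2)
    have 2: "q powi (int a - int b - l) * N * dq * q powi (2 * int n - 3)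
         + dq * q * (q powi (int a - int b) - q powi (int a - int b - l - 2)) * N2 - N * dq * q powi (int n - 3) = 0"
    proof -
      have "(Q3\<^sup>2 * q\<^sup>2 - 1) * N2 = - ((Q1 / Q2 / Q3 - Q2 * Q3 / Q1) * (Q1 * Q2 * Q3 / q\<^sup>2)) * N"
        using Az_step[of m n b] d unfolding N_def[symmetric] N2_def[symmetric] qi_def d_def[symmetric]
        using Q by (simp add: simps) (simp add: algebra_simps minus_divide_left)
      also have "(Q1 / Q2 / Q3 - Q2 * Q3 / Q1) * (Q1 * Q2 * Q3 / q\<^sup>2) = (Q1\<^sup>2 - Q2\<^sup>2 * Q3\<^sup>2) / q\<^sup>2"
        using Q by (simp add: field_simps power2_eq_square)
      finally have H: "(Q3\<^sup>2 * q\<^sup>2 - 1) * N2 * q\<^sup>2 = - (Q1\<^sup>2 - Q2\<^sup>2 * Q3\<^sup>2) * N" by (simp add: field_simps)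
      have "q powi (int a - int b - l) * N * dq * q powi (2 * int n - 3)
         + dq * q * (q powi (int a - int b) - q powi (int a - int b - l - 2)) * N2 - N * dq * q powi (int n - 3)
        = dq * Q1 / (q ^ 3 * Q2\<^sup>2 * Q3\<^sup>2) * ((Q3\<^sup>2 * q\<^sup>2 - 1) * N2 * q\<^sup>2 + (Q1\<^sup>2 - Q2\<^sup>2 * Q3\<^sup>2) * N)"
        using Q by (simp add: simps field_simps power2_eq_square)
      also have "(Q3\<^sup>2 * q\<^sup>2 - 1) * N2 * q\<^sup>2 + (Q1\<^sup>2 - Q2\<^sup>2 * Q3\<^sup>2) * N = 0" unfolding H by (simp add: algebra_simps)
      finally show ?thesis by simp
    qed
    have 1: "\<alpha> * N4 + q powi (int a - int b - l) * N * dq * q powi (3 - 2 * int n)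
         + dq * inverse q * (q powi (int b - int a) - q powi (int a - int b - l + 2)) * N3 - N * dq * q powi (3 - int n) = 0"
    proof -
      have "(Q3\<^sup>2 - 1) * N = - ((Q1 * q / Q2 / Q3 - Q2 * Q3 / Q1 / q) * (Q1 * Q2 * Q3 / q ^ 3)) * N3"
        using Az_step[of "m - 1" n b] d unfolding diff_add_cancel N_def[symmetric] N3_def[symmetric] qi_def d_def[symmetric]
        using Q by (simp add: simps mult_ac) (simp add: algebra_simps minus_divide_left)
      also have "(Q1 * q / Q2 / Q3 - Q2 * Q3 / Q1 / q) * (Q1 * Q2 * Q3 / q ^ 3) = (Q1\<^sup>2 * q\<^sup>2 - Q2\<^sup>2 * Q3\<^sup>2) / q ^ 4"
        using Q by (simp add: field_simps power2_eq_square power3_eq_cube power4_eq_xxxx)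
      finally have H3: "(Q3\<^sup>2 - 1) * N * q ^ 4 = - (Q1\<^sup>2 * q\<^sup>2 - Q2\<^sup>2 * Q3\<^sup>2) * N3" by (simp add: field_simps)
      \<comment> \<open>The coefficient at k = b - 1 enters because F1 turns one F2 into F3. Its
        factor [a + 1] is split into two parts so that \<open>Az_Suc\<close> and
        \<open>Az_shift\<close> at b - 1 remove it in favour of \<open>N\<close> and
        \<open>N3\<close>.\<close>
      have H4: "\<alpha> * N4 = ((Q2 - 1 / Q2) / d\<^sup>2) * (q ^ 3 / (Q1 * Q2) * N - Q2 / (Q1 * q) * N3)"
      proof (cases b)
        case 0
        then show ?thesis by (simp add: N4_def Q2_def)
      next
        case (Suc b')
        define N' where "N' = Az n b' m"
        have b: "qint q (Suc b') = (Q2 - 1 / Q2) / d"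
          unfolding Suc[symmetric] by (simp add: qint_powi d_def Q2_def power_int_minus inverse_eq_divide)
        have ib: "int b' = int b - 1" using Suc by simp
        have a: "qint q (Suc a) = (Q1 * q / Q2 - Q2 / (Q1 * q)) / d"
          unfolding qint_powi d_def[symmetric] using Q by (simp add: n(2) power_int_diff power_int_add power_int_minus Q1_def[symmetric] Q2_def[symmetric] divide_inverse mult_ac)
        have s1: "\<alpha> * (Q3\<^sup>2 - 1) * N' = - ((Q2 - 1 / Q2) / d) * N3"
          using Az_shift[of m n b'] unfolding b N'_def N3_def Suc q2m by simp
        have s2: "\<alpha> * (Q1 * q / Q2 / Q3 - Q2 * Q3 / (Q1 * q)) * N' = (q ^ 3 / (Q1 * Q2 * Q3)) * ((Q2 - 1 / Q2) / d) * N"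
          using Az_Suc[of n b' m] d unfolding b unfolding N'_def[symmetric] N_def[symmetric] Suc[symmetric] qi_def d_def[symmetric] ib
          using Q by (simp add: simps) (simp add: divide_inverse mult_ac)
        have "\<alpha> * N4 * d = \<alpha> * (Q1 * q / Q2 - Q2 / (Q1 * q)) * N'"
          unfolding N4_def Suc nat.case a[unfolded Suc] N'_def[symmetric] using d by simp
        also have "\<dots> = Q3 * (\<alpha> * (Q1 * q / Q2 / Q3 - Q2 * Q3 / (Q1 * q)) * N') + Q2 / (Q1 * q) * (\<alpha> * (Q3\<^sup>2 - 1) * N')"
          using Q by (simp add: field_simps power2_eq_square)
        also have "\<dots> = ((Q2 - 1 / Q2) / d) * (q ^ 3 / (Q1 * Q2) * N - Q2 / (Q1 * q) * N3)"
          unfolding s1 s2 using Q d by (simp add: field_simps)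
        finally show ?thesis using d by (simp add: field_simps power2_eq_square)
      qed
      have dq: "dq = 1 / d\<^sup>2" by (simp add: dq_def d_def)
      have "\<alpha> * N4 + q powi (int a - int b - l) * N * dq * q powi (3 - 2 * int n)
         + dq * inverse q * (q powi (int b - int a) - q powi (int a - int b - l + 2)) * N3 - N * dq * q powi (3 - int n)
        = - (1 / (d\<^sup>2 * Q1 * q * Q2\<^sup>2 * Q3\<^sup>2)) * ((Q3\<^sup>2 - 1) * N * q ^ 4 + (Q1\<^sup>2 * q\<^sup>2 - Q2\<^sup>2 * Q3\<^sup>2) * N3)"
        unfolding H4 dq using Q d by (simp add: simps field_simps power2_eq_square power4_eq_xxxx)
      also have "(Q3\<^sup>2 - 1) * N * q ^ 4 + (Q1\<^sup>2 * q\<^sup>2 - Q2\<^sup>2 * Q3\<^sup>2) * N3 = 0" unfolding H3 by (simp add: algebra_simps)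
      finally show ?thesis by simp
    qed
    have "Cf (U n y) a b l - U n ?y a b l = 0" unfolding e 1 2 by simp
    then show ?thesis by simp
  next
    case False
    then show ?thesis by (auto simp: Cf_def U_def split: nat.split)
  qed
qed

section \<open>Action of E1, E2, K and C1 on the singular vectors\<close>

lemma u_Wh:
  assumes "wsub Y" "y \<in> Y" "hop n y = 0"
  shows "u n y \<in> Wh"
proof -
  note f = fam_U[OF assms(1,2), of n]
  show ?thesis
    using fam_D1f[OF assms(1) f, of 0] fam_E2f[OF assms(1) f]
    unfolding D1f_U E2f_U[OF assms(3)] val_zero by (simp add: Wh_def u_def)
qed

lemma c1_u:
  assumes "wsub Y" "y \<in> Y" "hop n y = 0"
  shows "c1 (u n y) = u n ((dq * q powi (3 - int n)) *s kk y + (dq * q powi (int n - 3)) *s kki y)"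
proof -
  have "\<rho> E1 (u n y) = \<alpha> *s u n y" using u_Wh[OF assms] by (simp add: Wh_def)
  then have "c1 (u n y) = val (Cf (U n y))"
    using fam_Cf[OF assms(1) fam_U[OF assms(1,2)], of n] by (simp add: u_def c1_def dq_def)
  then show ?thesis unfolding Cf_U[OF assms(3)] u_def .
qed

text \<open>All terms of u(n,0,1) have degree n in F2 and F3, and each of these factors contributes
  q^-3.\<close>

lemma kk_u: "kk (u n y) = (q powi (- 3 * int n)) *s u n (kk y)"
proof -
  have s: "kk (sum f S) = (\<Sum>x\<in>S. kk (f x))" for f :: "nat \<times> nat \<Rightarrow> 'v" and S
    by (induction S rule: infinite_finite_induct) auto
  show ?thesis
    unfolding u_eq s scale_sum_right
    by (rule sum.cong) (auto simp: KJ_def kk_B kk_kp_r mult.commute)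
qed

lemma u_add: "u n (x + y) = u n x + u n y" and u_scale: "u n (c *s x) = c *s u n x"
  unfolding u_eq by (simp_all add: scale_sum_right sum.distrib split_def scale_right_distrib mult.commute)

text \<open>A vanishing \<open>u\<close> expresses \<open>F3^n\<close> through lower powers of \<open>F3\<close>.\<close>

lemma Sp_reduce:
  assumes Y: "wsub Y" and u0: "\<And>y. y \<in> Y \<Longrightarrow> u n y = 0"
  shows "Sp UNIV Y \<subseteq> Sp {..<n} Y"
proof -
  have sub: "subspace Y" using Y by (simp add: wsub_def)
  have main: "\<forall>a l. \<forall>y\<in>Y. B a b l y \<in> Sp {..<n} Y" for b
  proof (induction b rule: less_induct)
    case (less b)
    show ?case
    proof (intro allI ballI)
      fix a l y assume y: "y \<in> Y"
      show "B a b l y \<in> Sp {..<n} Y"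
      proof (cases "b < n")
        case True then show ?thesis using y by (intro Sp_B) auto
      next
        case False
        \<comment> \<open>The term k = n of u(n,0,1) is a multiple of F3^n K^-n; inserting K^n y
          turns it into F3^n y. All other terms have a smaller power of F3, and left multiplication
          by F2^a F3^(b-n) K2^l, which is \<open>T\<close>, sends spanning vectors to nonzero
          multiples of spanning vectors.\<close>
        define y' where "y' = kp (int n) y"
        define T where "T x = (\<rho> F2 ^^ a) ((f3 ^^ (b - n)) (k2p l x))" for x
        have y': "y' \<in> Y" unfolding y'_def by (rule wsub_kp[OF Y y])
        have Tadd: "T (x + z) = T x + T z" and Tsc: "T (c *s x) = c *s T x" for x z c by (simp_all add: T_def)
        have T0: "T 0 = 0" using Tsc[of 0 0] by simp
        have Tsum: "T (sum f S) = (\<Sum>x\<in>S. T (f x))" for f :: "nat \<times> nat \<Rightarrow> 'v" and S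
          by (induction S rule: infinite_finite_induct) (auto simp: Tadd T0)
        have TB: "\<exists>c. c \<noteq> 0 \<and> T (B a' b' l' z) = c *s B (a + a') (b - n + b') (l' + l) z" for a' b' l' z
          unfolding T_def k2p_B f3pow_scale f2pow_scale f3pow_B scale_scale
          by (rule exI, rule conjI[rotated], rule refl) simp
        have TS: "T (B (n - k) k l' z) \<in> Sp {..<n} Y" if "k < n" "z \<in> Y" for k l' z
        proof -
          obtain c where c: "T (B (n - k) k l' z) = c *s B (a + (n - k)) (b - n + k) (l' + l) z" using TB by blast
          have "b - n + k < b" using that False by simp
          then show ?thesis unfolding c using less.IH that(2) by (blast intro: subspace_scale subspace_Sp)
        qed
        have mem: "(n, 0) \<in> KJ n" by (simp add: KJ_def)
        have "0 = T (u n y')" using u0[OF y'] T0 by simp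
        also have "\<dots> = (\<Sum>(k, j)\<in>KJ n. acoef q \<alpha> n k j *s T (B (n - k) k (2 * int j) (kp (- 2 * int j - int k) y')))"
          unfolding u_eq Tsum by (simp add: split_def Tsc)
        also have "\<dots> = acoef q \<alpha> n n 0 *s T (B 0 n 0 y) +
           (\<Sum>(k, j)\<in>KJ n - {(n, 0)}. acoef q \<alpha> n k j *s T (B (n - k) k (2 * int j) (kp (- 2 * int j - int k) y')))"
        proof -
          have "kp (- int n) (kp (int n) y) = y"
            by (rule kp_inverse)
          then show ?thesis
            by (subst sum.remove[OF finite_KJ mem]) (simp add: y'_def)
        qed
        finally have "acoef q \<alpha> n n 0 *s T (B 0 n 0 y) =
           - (\<Sum>(k, j)\<in>KJ n - {(n, 0)}. acoef q \<alpha> n k j *s T (B (n - k) k (2 * int j) (kp (- 2 * int j - int k) y')))"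
          by (simp add: eq_neg_iff_add_eq_0)
        also have "\<dots> \<in> Sp {..<n} Y"
        proof (intro subspace_neg subspace_sum subspace_Sp)
          fix x assume x: "x \<in> KJ n - {(n, 0)}"
          then have "fst x < n" by (cases x, cases "fst x = n") (auto simp: KJ_def)
          then show "(case x of (k, j) \<Rightarrow> acoef q \<alpha> n k j *s T (B (n - k) k (2 * int j) (kp (- 2 * int j - int k) y'))) \<in> Sp {..<n} Y"
            using TS[OF _ wsub_kp[OF Y y']] by (auto intro!: subspace_scale split: prod.split)
        qed
        finally have mem2: "acoef q \<alpha> n n 0 *s T (B 0 n 0 y) \<in> Sp {..<n} Y" .
        have ac: "acoef q \<alpha> n n 0 \<noteq> 0"
          using q2_ne_1 by (simp add: acoef_def qbin_def)
        obtain c where c: "c \<noteq> 0" "T (B 0 n 0 y) = c *s B a b l y" using TB[of 0 n 0 y] False by auto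
        have "(inverse (acoef q \<alpha> n n 0) * inverse c) *s (acoef q \<alpha> n n 0 *s T (B 0 n 0 y)) \<in> Sp {..<n} Y"
          by (rule subspace_scale[OF subspace_Sp mem2])
        moreover have "(inverse (acoef q \<alpha> n n 0) * inverse c) *s (acoef q \<alpha> n n 0 *s T (B 0 n 0 y)) = B a b l y"
        proof -
          have "inverse (acoef q \<alpha> n n 0) * inverse c * (acoef q \<alpha> n n 0 * c) = 1"
            using ac c(1) by (simp add: field_simps)
          then show ?thesis unfolding c(2) scale_scale by (simp only: scale_one)
        qed
        ultimately show ?thesis by simp
      qed
    qed
  qed
  show ?thesis
    unfolding Sp_def[of UNIV] by (rule span_minimal) (use main in auto)
qed

end

subsection \<open>Eigenvectors in spaces of countable dimension\<close>

context lin_rep begin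

definition pop :: "('v \<Rightarrow> 'v) \<Rightarrow> complex poly \<Rightarrow> 'v \<Rightarrow> 'v" where
  "pop T Q x = (\<Sum>i\<le>degree Q. coeff Q i *s (T ^^ i) x)"

lemma pop_le: "degree Q \<le> N \<Longrightarrow> pop T Q x = (\<Sum>i\<le>N. coeff Q i *s (T ^^ i) x)"
  unfolding pop_def by (rule sum.mono_neutral_left) (auto simp: coeff_eq_0)

lemma pop_0 [simp]: "pop T 0 x = 0" by (simp add: pop_def)

lemma pop_pCons: "pop T (pCons a Q) x = a *s x + pop T Q (T x)"
proof -
  have "pop T (pCons a Q) x = (\<Sum>i\<le>Suc (degree Q). coeff (pCons a Q) i *s (T ^^ i) x)"
    by (rule pop_le) (rule degree_pCons_le)
  then show ?thesis unfolding sum.atMost_Suc_shift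
    by (simp add: pop_def funpow_swap1 del: sum.atMost_Suc)
qed

lemma pop_add: "pop T (P + Q) x = pop T P x + pop T Q x"
proof -
  let ?N = "max (degree P) (degree Q)"
  have "degree (P + Q) \<le> ?N" by (rule degree_add_le_max)
  then show ?thesis
    by (simp add: pop_le[of _ ?N] scale_left_distrib sum.distrib)
qed

lemma pop_smult: "pop T (smult c Q) x = c *s pop T Q x"
  by (simp add: pop_le[OF degree_smult_le] scale_sum_right) (simp add: pop_def scale_sum_right)

lemma pop_sum: "finite I \<Longrightarrow> pop T (\<Sum>i\<in>I. Q i) x = (\<Sum>i\<in>I. pop T (Q i) x)"
  by (induction I rule: finite_induct) (auto simp: pop_add)

context
  fixes T :: "'v \<Rightarrow> 'v"
  assumes T: "\<And>x y. T (x + y) = T x + T y" "\<And>c x. T (c *s x) = c *s T x"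
begin

lemma pow_lin: "(T ^^ i) (x + y) = (T ^^ i) x + (T ^^ i) y" "(T ^^ i) (c *s x) = c *s (T ^^ i) x"
  by (induction i) (auto simp: T)

lemma pop_lin: "pop T Q (x + y) = pop T Q x + pop T Q y" "pop T Q (c *s x) = c *s pop T Q x"
  by (simp_all add: pop_def pow_lin scale_right_distrib sum.distrib scale_sum_right mult.commute)

lemma pop_vsum: "pop T Q (\<Sum>i\<in>I. f i) = (\<Sum>i\<in>I. pop T Q (f i))"
proof (induction I rule: infinite_finite_induct)
  case empty
  then show ?case using pop_lin(2)[of Q 0 0] by simp
next
  case (infinite I)
  then show ?case using pop_lin(2)[of Q 0 0] by simp
qed (simp add: pop_lin)

lemma pop_mult: "pop T (P * Q) x = pop T Q (pop T P x)"
proof (induction P arbitrary: x)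
  case 0 show ?case using pop_lin(2)[of Q 0 0] by simp
next
  case (pCons a P)
  then show ?case by (simp add: pop_add pop_smult pop_pCons pop_lin)
qed

lemma pop_eigen: assumes "T x = r *s x" shows "pop T Q x = poly Q r *s x"
proof -
  have "pop T Q (c *s x) = (c * poly Q r) *s x" for c
    by (induction Q arbitrary: c) (simp_all add: pop_pCons T assms algebra_simps)
  from this[of 1] show ?thesis by simp
qed

lemma pop_linear: "pop T [:- r, 1:] x = T x - r *s x"
  by (simp add: pop_pCons)

text \<open>Split off a root r of Q: either (T - r) x = 0 and x is an eigenvector, or (T - r) x is a
  nonzero vector of Y killed by the remaining factor of smaller degree.\<close>

lemma eigenvector_of_annihilator:
  assumes Y: "subspace Y" "\<And>y. y \<in> Y \<Longrightarrow> T y \<in> Y"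
    and "Q \<noteq> 0" "x \<in> Y" "x \<noteq> 0" "pop T Q x = 0"
  shows "\<exists>e r. e \<in> Y \<and> e \<noteq> 0 \<and> T e = r *s e"
  using assms(3-)
proof (induction "degree Q" arbitrary: Q x)
  case 0
  then obtain a where "Q = [:a:]" using degree_eq_zeroE by metis
  then show ?case using 0 by (simp add: pop_pCons)
next
  case (Suc n)
  have "\<not> constant (poly Q)" using Suc.hyps(2) constant_degree[of Q] by simp
  then obtain r where "poly Q r = 0" using fundamental_theorem_of_algebra by blast
  then obtain Q' where Q: "Q = [:- r, 1:] * Q'" by (auto simp: poly_eq_0_iff_dvd dvd_def)
  have Q': "Q' \<noteq> 0" using Suc.prems(1) Q by auto
  have "degree ([:- r, 1:] * Q') = degree [:- r, 1:] + degree Q'" by (rule degree_mult_eq) (use Q' in auto)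
  moreover have "degree [:- r, 1:] = 1" by simp
  ultimately have deg: "degree Q' = n" using Suc.hyps(2) unfolding Q by linarith
  have x': "T x - r *s x \<in> Y" using Y Suc.prems by (auto intro: subspace_diff subspace_scale)
  have p: "pop T Q' (T x - r *s x) = 0" using Suc.prems(4) unfolding Q pop_mult pop_linear .
  show ?case
  proof (cases "T x - r *s x = 0")
    case True then show ?thesis using Suc.prems by auto
  next
    case False then show ?thesis using Suc.hyps(1)[OF deg[symmetric] Q' x' False p] by blast
  qed
qed

text \<open>If \<open>T\<close> had no eigenvector then the uncountably many vectors \<open>(T - r)\<^sup>-\<^sup>1 y0\<close> would be
  linearly independent.\<close>

lemma eigenvector_countable:
  assumes S: "countable S" "span S = UNIV"
    and Y: "subspace Y" "\<And>y. y \<in> Y \<Longrightarrow> T y \<in> Y"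
    and y0: "y0 \<in> Y" "y0 \<noteq> 0"
    and surj: "\<And>r. \<exists>y\<in>Y. T y - r *s y = y0"
  shows "\<exists>e r. e \<in> Y \<and> e \<noteq> 0 \<and> T e = r *s e"
proof -
  from surj obtain y where y: "\<And>r. y r \<in> Y" "\<And>r. T (y r) - r *s y r = y0" by metis
  have inj: "inj y"
  proof (rule injI, rule ccontr)
    fix r s assume "y r = y s" "r \<noteq> s"
    then have "T (y r) - r *s y r = T (y r) - s *s y r" using y(2)[of r] y(2)[of s] by simp
    then have "(r - s) *s y r = 0" by (simp add: scale_left_diff_distrib)
    then have "y r = 0" using \<open>r \<noteq> s\<close> by simp
    then show False using y(2)[of r] y0 T(2)[of 0 0] by simp
  qed
  \<comment> \<open>An increasing chain of finite-dimensional subspaces that exhausts the space; the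
    uncountably many vectors \<open>y r\<close> force infinitely many of them into one
    member.\<close>
  define V where "V n = span (from_nat_into S ` {..n::nat})" for n
  have "S \<noteq> {}" using y0 S(2) by auto
  have ex: "\<exists>n. x \<in> V n" for x
  proof -
    have "x \<in> span S" using S by simp
    then show ?thesis
    proof (induction rule: span_induct_alt)
      case base then show ?case by (auto simp: V_def span_zero)
    next
      case (step c x z)
      then obtain n where n: "z \<in> V n" by blast
      obtain k where k: "x = from_nat_into S k" using step S(1) from_nat_into_surj by metis
      have "x \<in> V (max n k)" unfolding V_def k by (rule span_base) simp
      moreover have "V n \<subseteq> V (max n k)" unfolding V_def by (rule span_mono) auto
      ultimately show ?case using n unfolding V_def by (auto intro!: exI[of _ "max n k"] span_add span_scale)
    qed
  qed
  have "\<exists>n. infinite {r. y r \<in> V n}"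
  proof (rule ccontr)
    assume "\<nexists>n. infinite {r. y r \<in> V n}"
    then have "countable (\<Union>n. {r. y r \<in> V n})" by (auto intro: countable_finite)
    moreover have "(\<Union>n. {r. y r \<in> V n}) = UNIV" using ex by auto
    ultimately show False using uncountable_UNIV_complex by simp
  qed
  then obtain n where n: "infinite {r. y r \<in> V n}" by blast
  have "dependent (y ` {r. y r \<in> V n})"
  proof (rule ccontr)
    assume "independent (y ` {r. y r \<in> V n})"
    then have "finite (y ` {r. y r \<in> V n})"
      using independent_span_bound[of "from_nat_into S ` {..n}" "y ` {r. y r \<in> V n}"] by (auto simp: V_def)
    then show False using n inj by (metis finite_imageD inj_on_subset subset_UNIV)
  qed
  then obtain t c v where t: "finite t" "t \<subseteq> y ` {r. y r \<in> V n}" "(\<Sum>v\<in>t. c v *s v) = 0" "v \<in> t" "c v \<noteq> 0"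
    unfolding dependent_explicit by blast
  obtain I where I: "t = y ` I" using t(2) by (metis subset_imageE)
  have fin: "finite I" using t(1) I inj by (metis finite_imageD inj_on_subset subset_UNIV)
  \<comment> \<open>The dependence says that a combination of the vectors (T - i)^-1 y0 is zero. The
    product \<open>M0\<close> of all T - i clears the inverses and gives Q(T) y0 = 0.\<close>
  define M where "M i = (\<Prod>j\<in>I - {i}. [:- j, 1:])" for i :: complex
  define M0 where "M0 = (\<Prod>j\<in>I. [:- j, 1 :: complex:])"
  define Q where "Q = (\<Sum>i\<in>I. smult (c (y i)) (M i))"
  have M: "pop T M0 (y i) = pop T (M i) y0" if "i \<in> I" for i
  proof -
    have "M0 = [:- i, 1:] * M i" unfolding M0_def M_def by (rule prod.remove[OF fin that])
    then show ?thesis by (simp only: pop_mult pop_linear y(2))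
  qed
  have "0 = pop T M0 (\<Sum>i\<in>I. c (y i) *s y i)"
  proof -
    have "(\<Sum>i\<in>I. c (y i) *s y i) = (\<Sum>v\<in>t. c v *s v)"
      unfolding I by (subst sum.reindex) (use inj in \<open>auto intro: inj_on_subset\<close>)
    then show ?thesis using t(3) pop_lin(2)[of M0 0 0] by simp
  qed
  also have "\<dots> = (\<Sum>i\<in>I. c (y i) *s pop T (M i) y0)"
    unfolding pop_vsum by (rule sum.cong) (simp_all add: pop_lin M)
  also have "\<dots> = pop T Q y0" unfolding Q_def by (simp add: pop_sum[OF fin] pop_smult)
  finally have Q0: "pop T Q y0 = 0" by simp
  obtain i where i: "i \<in> I" "c (y i) \<noteq> 0" using t I by auto
  \<comment> \<open>At i all summands with j different from i contain the factor i - i, as in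
    Lagrange interpolation, so Q is a nonzero polynomial.\<close>
  have "poly Q i = (\<Sum>j\<in>I. c (y j) * (\<Prod>k\<in>I - {j}. i - k))"
    by (simp add: Q_def M_def poly_sum poly_prod)
  also have "\<dots> = c (y i) * (\<Prod>k\<in>I - {i}. i - k) + (\<Sum>j\<in>I - {i}. c (y j) * (\<Prod>k\<in>I - {j}. i - k))"
    by (rule sum.remove[OF fin i(1)])
  also have "(\<Sum>j\<in>I - {i}. c (y j) * (\<Prod>k\<in>I - {j}. i - k)) = 0"
    using i(1) fin by (intro sum.neutral) (auto simp: prod_zero_iff)
  finally have "poly Q i \<noteq> 0" using i(2) fin by (simp add: prod_zero_iff)
  then have "Q \<noteq> 0" by auto
  then show ?thesis using eigenvector_of_annihilator[OF Y _ y0 Q0] by blast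
qed

end

lemma countable_cyc: "cyc v = UNIV \<Longrightarrow> \<exists>S. countable S \<and> span S = UNIV"
proof -
  assume c: "cyc v = UNIV"
  have "(UNIV :: gen set) \<subseteq> {E1, E2, F1, F2, K1, K2, K1i, K2i}"
    using gen.exhaust by blast
  then have "countable (UNIV :: gen set)" by (metis countable_finite finite.emptyI finite.insertI finite_subset)
  then have "countable (lists (UNIV :: gen set))" by (rule countable_lists)
  then have "countable (range (\<lambda>m. wact \<rho> m v))" by (simp add: countable_image)
  moreover have "span (range (\<lambda>m. wact \<rho> m v)) = UNIV"
  proof -
    have A: "A f v \<in> span (range (\<lambda>m. wact \<rho> m v))" for f
      unfolding act_def by (intro span_sum span_scale span_base) auto
    have "x \<in> span (range (\<lambda>m. wact \<rho> m v))" for x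
    proof -
      have "x \<in> cyc v" using c by simp
      then obtain f where "x = A f v" unfolding cyc_def by auto
      then show ?thesis using A by simp
    qed
    then show ?thesis by blast
  qed
  ultimately show ?thesis by blast
qed

end

context uq_rep begin

lemma hop_add: "hop n (x + y) = hop n x + hop n y" and hop_scale: "hop n (c *s x) = c *s hop n x"
  and hop_kk: "hop n (kk x) = kk (hop n x)" and hop_kki: "hop n (kki x) = kki (hop n x)"
  and hop_c1: "hop n (c1 x) = c1 (hop n x)"
  unfolding hop_def by (rule vec_eqI, simp, simp add: algebra_simps) (simp_all add: scale_right_distrib scale_right_diff_distrib c1_kk c1_kki mult.commute)

text \<open>Treats J = UNIV and J = {..<n} alike: a finite family uses only powers of F3 below some
  \<open>n0\<close>, and n0 - 1 can be taken in J; the condition \<open>0 \<in> J\<close> provides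
  for the empty family.\<close>

lemma free_on:
  assumes Y: "wsub Y"
    and inj: "\<And>m y. 1 \<le> m \<Longrightarrow> \<exists>b\<in>J. m \<le> b \<Longrightarrow> y \<in> Y \<Longrightarrow> hop m y = 0 \<Longrightarrow> y = 0"
    and P: "fam Y P" "\<And>a b l. P a b l \<noteq> 0 \<Longrightarrow> b \<in> J" "val P = 0" and J: "0 \<in> J"
  shows "P = 0"
proof -
  define n0 where "n0 = Suc (Max (insert 0 ((\<lambda>(a, b, l). b) ` supp P)))"
  have fin: "finite (insert 0 ((\<lambda>(a, b, l). b) ` supp P))" using fam_finite[OF P(1)] by simp
  have n0: "b < n0" if "P a b l \<noteq> 0" for a b l
    unfolding n0_def less_Suc_eq_le by (rule Max_ge[OF fin]) (use that in \<open>force simp: supp_def\<close>)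
  have "n0 - 1 \<in> insert 0 ((\<lambda>(a, b, l). b) ` supp P)" unfolding n0_def diff_Suc_1 by (rule Max_in[OF fin]) simp
  then have "n0 - 1 \<in> J" using J P(2) by (auto simp: supp_def)
  then have "\<exists>b\<in>J. m \<le> b" if "m < n0" for m using that by (intro bexI[of _ "n0 - 1"]) auto
  then have inj': "y = 0" if "1 \<le> m" "m < n0" "y \<in> Y" "hop m y = 0" for m y using inj that by blast
  show "P = 0" by (rule free[OF Y inj' P(1) n0 P(3)])
qed

end

section \<open>Eigenvectors of K and C1 in an irreducible module\<close>

locale uq_irr = uq_rep +
  assumes irr: "\<And>S. subspace S \<Longrightarrow> (\<And>g x. x \<in> S \<Longrightarrow> \<rho> g x \<in> S) \<Longrightarrow> S = {0} \<or> S = UNIV"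
begin

lemma cyc_full: "v \<noteq> 0 \<Longrightarrow> cyc v = UNIV"
  using irr[OF subspace_cyc rho_cyc] cyc_self[of v] by (metis singletonD)

lemma Sp_full:
  assumes "wsub Y" "y \<in> Y" "y \<noteq> 0" shows "Sp UNIV Y = UNIV"
proof -
  have "y \<in> Sp UNIV Y" using Sp_B[of 0 UNIV y Y 0 0] assms(2) by simp
  then show ?thesis using irr[OF subspace_Sp Sp_rho[OF assms(1)]] assms(3) by blast
qed

text \<open>A nonzero Y' generates the whole module, so any y0 in Y has an expansion with
  coefficients in Y'. Subtracting y0 at the index (0, 0, 0) gives a relation over Y; independence
  makes it trivial, so y0 is one of the coefficients.\<close>

lemma wsub_maximal:
  assumes Y: "wsub Y" and Y': "wsub Y'" "Y' \<subseteq> Y" "Y' \<noteq> {0}"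
    and inj: "\<And>m y. 1 \<le> m \<Longrightarrow> \<exists>b\<in>J. m \<le> b \<Longrightarrow> y \<in> Y \<Longrightarrow> hop m y = 0 \<Longrightarrow> y = 0"
    and J: "0 \<in> J" "Sp UNIV Y' \<subseteq> Sp J Y'"
  shows "Y' = Y"
proof
  show "Y \<subseteq> Y'"
  proof
    fix y0 assume y0: "y0 \<in> Y"
    have sub: "subspace Y" "subspace Y'" using Y Y' by (auto simp: wsub_def)
    obtain y where "y \<in> Y'" "y \<noteq> 0" using Y'(3) subspace_0[OF sub(2)] by blast
    then have "y0 \<in> Sp J Y'" using Sp_full[OF Y'(1)] J(2) by auto
    from Sp_val[OF sub(2) this] obtain P where P: "fam Y' P" "\<And>a b l. P a b l \<noteq> 0 \<Longrightarrow> b \<in> J" "val P = y0" by blast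
    have PY: "fam Y P" using P(1) Y'(2) by (auto simp: fam_def)
    define R where "R = sing 0 0 0 (- y0) + P"
    have s: "fam Y (sing 0 0 0 (- y0))" using sub(1) y0 by (simp add: fam_sing subspace_neg)
    have R: "fam Y R" "val R = 0" unfolding R_def
      using val_add[OF s PY] P(3) fam_add[OF sub(1) s PY] by simp_all
    have RJ: "b \<in> J" if "R a b l \<noteq> 0" for a b l
      using that P(2)[of a b l] J(1) by (auto simp: R_def sing_def split: if_splits)
    have "R = 0" by (rule free_on[OF Y inj R(1) RJ R(2) J(1)])
    then have "R 0 0 0 = 0" by simp
    then have "P 0 0 0 = y0" by (simp add: R_def sing_def)
    then show "y0 \<in> Y'" using fam_in[OF P(1)] by metis
  qed
qed (rule Y'(2))

text \<open>T - r commutes with K and C1, so it maps Y onto a space of the kind \<open>wsub\<close>.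
  Without eigenvectors this image is nonzero, hence all of Y by \<open>wsub_maximal\<close>, and y0
  has a preimage under every T - r, as \<open>eigenvector_countable\<close> demands.\<close>

lemma eigenvector_in_wsub:
  assumes Y: "wsub Y" and y0: "y0 \<in> Y" "y0 \<noteq> 0"
    and T: "\<And>x y. T (x + y) = T x + T y" "\<And>c x. T (c *s x) = c *s T x"
      "\<And>y. y \<in> Y \<Longrightarrow> T y \<in> Y" "\<And>x. T (kk x) = kk (T x)" "\<And>x. T (kki x) = kki (T x)" "\<And>x. T (c1 x) = c1 (T x)"
    and inj: "\<And>m y. 1 \<le> m \<Longrightarrow> \<exists>b\<in>J. m \<le> b \<Longrightarrow> y \<in> Y \<Longrightarrow> hop m y = 0 \<Longrightarrow> y = 0"
    and J: "0 \<in> J" "\<And>Y'. wsub Y' \<Longrightarrow> Y' \<subseteq> Y \<Longrightarrow> Sp UNIV Y' \<subseteq> Sp J Y'"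
  shows "\<exists>e r. e \<in> Y \<and> e \<noteq> 0 \<and> T e = r *s e"
proof (rule ccontr)
  assume none: "\<nexists>e r. e \<in> Y \<and> e \<noteq> 0 \<and> T e = r *s e"
  have sub: "subspace Y" using Y by (simp add: wsub_def)
  have T0: "T 0 = 0" using T(2)[of 0 0] by simp
  obtain S where S: "countable S" "span S = UNIV" using countable_cyc[OF cyc_full[OF y0(2)]] by blast
  have surj: "\<exists>y\<in>Y. T y - r *s y = y0" for r
  proof -
    define f where "f y = T y - r *s y" for y
    have f: "f (x + y) = f x + f y" "f (c *s x) = c *s f x" for x y c
      by (simp_all add: f_def T algebra_simps)
    have sub': "subspace (f ` Y)"
    proof (rule subspaceI)
      show "0 \<in> f ` Y" using subspace_0[OF sub] by (auto simp: f_def T0 intro!: image_eqI[of _ _ 0])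
      show "x + y \<in> f ` Y" if "x \<in> f ` Y" "y \<in> f ` Y" for x y
        using that subspace_add[OF sub] by (auto simp: f(1)[symmetric])
      show "c *s x \<in> f ` Y" if "x \<in> f ` Y" for c x
        using that subspace_scale[OF sub] by (auto simp: f(2)[symmetric])
    qed
    have fY: "f ` Y \<subseteq> Y" using T(3) sub by (auto simp: f_def intro: subspace_diff subspace_scale)
    have fc: "kk (f y) = f (kk y)" "kki (f y) = f (kki y)" "c1 (f y) = f (c1 y)" for y
      by (simp_all add: f_def T(4,5,6))
    have wf: "wsub (f ` Y)"
      unfolding wsub_def using sub' fY Y by (auto simp: fc wsub_def)
    have "f y0 \<noteq> 0" using none y0 by (auto simp: f_def)
    then have ne: "f ` Y \<noteq> {0}" using y0 by blast
    have "f ` Y = Y" by (rule wsub_maximal[OF Y wf fY ne inj J(1) J(2)[OF wf fY]])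
    then have "y0 \<in> f ` Y" using y0(1) by simp
    then show ?thesis by (auto simp: f_def)
  qed
  show False using eigenvector_countable[OF T(1,2) S sub T(3) y0 surj] none by blast
qed

lemma wsub_Wh: "wsub Wh"
proof -
  have E2: "\<rho> E2 (kk y) = 0" "\<rho> E2 (kki y) = 0" if "\<rho> E2 y = 0" for y
    using kk_e2[of y] kki_e2[of y] that by auto
  show ?thesis
    unfolding wsub_def
  proof (intro conjI ballI)
    show "subspace Wh" by (rule subspaceI) (auto simp: Wh_def algebra_simps)
    fix y assume "y \<in> Wh"
    then have y: "\<rho> E1 y = \<alpha> *s y" "\<rho> E2 y = 0" by (auto simp: Wh_def)
    show "kk y \<in> Wh" "kki y \<in> Wh"
      using kk_e1[of y] kki_e1[of y] E2 y by (auto simp: Wh_def)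
    have "\<rho> E2 (\<rho> K1 y) = 0" "\<rho> E2 (\<rho> K1i y) = 0"
      using k1_e2[of y] k1i_e2[of y] y by auto
    then have "\<rho> E2 (c1 y) = 0" using y by (simp add: c1_def e2_f1)
    then show "c1 y \<in> Wh"
      using c1_e1[of y] y by (simp add: Wh_def)
  qed auto
qed

lemma wsub_kernel:
  assumes "wsub Y" "\<And>x y. f (x + y) = f x + f y" "\<And>c x. f (c *s x) = c *s f x"
    "\<And>x. f (kk x) = kk (f x)" "\<And>x. f (kki x) = kki (f x)" "\<And>x. f (c1 x) = c1 (f x)"
  shows "wsub {y \<in> Y. f y = 0}"
proof -
  have "f 0 = 0" using assms(3)[of 0 0] by simp
  then show ?thesis
    using assms unfolding wsub_def by (auto simp: subspace_def)
qed

text \<open>The relation says K^2 y = s^2 y with s^2 = -b/a. Then (K + s) y is an eigenvector for s,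
  unless it vanishes and y is one for -s.\<close>

lemma kk_eigenvector_quadratic:
  assumes "y \<in> Wh" "y \<noteq> 0" "a *s kk y + b *s kki y = 0" "a \<noteq> 0"
  shows "\<exists>e r. e \<in> Wh \<and> e \<noteq> 0 \<and> kk e = r *s e"
proof -
  define s where "s = csqrt (- b / a)"
  have s: "a * (s * s) = - b" using assms(4) power2_csqrt[of "- b / a"] by (simp add: s_def power2_eq_square)
  have sub: "subspace Wh" and k: "kk y \<in> Wh" using wsub_Wh assms(1) by (auto simp: wsub_def)
  have "a *s kk (kk y) = - b *s y"
    using arg_cong[OF assms(3), of kk] by (simp add: eq_neg_iff_add_eq_0)
  then have "a *s kk (kk y) = a *s ((s * s) *s y)" using s by simp
  then have kk2: "kk (kk y) = (s * s) *s y" by (rule scale_left_imp_eq[OF assms(4)])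
  define e where "e = kk y + s *s y"
  have "kk e = s *s e" unfolding e_def by (simp add: kk2 algebra_simps)
  moreover have "e \<in> Wh" unfolding e_def using sub k assms(1) by (intro subspace_add subspace_scale)
  moreover have "kk y = (- s) *s y" if "e = 0" using that by (simp add: e_def eq_neg_iff_add_eq_0)
  ultimately show ?thesis using assms(1,2) by (cases "e = 0") blast+
qed

lemma dq_qd: "dq * qd\<^sup>2 = 1" using qd0 by (simp add: dq_def)

lemma kki_u: "kki (u n y) = (q powi (3 * int n)) *s u n (kki y)"
proof -
  have "u n y = kk ((q powi (3 * int n)) *s u n (kki y))"
    by (simp add: kk_u flip: power_int_add)
  then show ?thesis by (metis kki_kk)
qed

text \<open>If K has no eigenvector in \<open>Wh\<close>, then h_m and h_n with m \<noteq> n have no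
  common kernel, because their difference is a K + b K^-1 with a \<noteq> 0. The argument of
  \<open>eigenvector_in_wsub\<close> is then applied to one of three spaces: \<open>Wh\<close>, the
  kernel of one h_n, or a space containing a nonzero value of u(n,0,1) on this kernel.\<close>

lemma exists_kk_eigenvector:
  assumes w: "w \<in> Wh" "w \<noteq> 0"
  shows "\<exists>e r. e \<in> Wh \<and> e \<noteq> 0 \<and> kk e = r *s e"
proof (rule ccontr)
  assume none: "\<not> ?thesis"
  have contra: False
    if "wsub Y" "y0 \<in> Y" "y0 \<noteq> 0" "0 \<in> J"
      "\<And>m y. 1 \<le> m \<Longrightarrow> \<exists>b\<in>J. m \<le> b \<Longrightarrow> y \<in> Y \<Longrightarrow> hop m y = 0 \<Longrightarrow> y = 0"
      "\<And>Y'. wsub Y' \<Longrightarrow> Y' \<subseteq> Y \<Longrightarrow> Sp UNIV Y' \<subseteq> Sp J Y'" for Y y0 J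
  proof -
    have "\<exists>e r. e \<in> Y \<and> e \<noteq> 0 \<and> kk e = r *s e"
      by (rule eigenvector_in_wsub[OF that(1-3) _ _ _ _ _ _ that(5) that(4) that(6)])
        (use that(1) in \<open>auto simp: c1_kk wsub_def\<close>)
    then show False using none that(1) by (auto simp: wsub_def)
  qed
  have quad: "y = 0" if "y \<in> Wh" "a *s kk y + b *s kki y = 0" "a \<noteq> 0" for y a b
    using kk_eigenvector_quadratic[of y a b] that none by blast
  have "\<exists>n y. 1 \<le> n \<and> y \<in> Wh \<and> y \<noteq> 0 \<and> hop n y = 0"
    using contra[OF wsub_Wh w, of UNIV] by blast
  then obtain n y1 where n: "1 \<le> n" and y1: "y1 \<in> Wh" "y1 \<noteq> 0" "hop n y1 = 0" by blast
  define Y where "Y = {y \<in> Wh. hop n y = 0}"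
  have Y: "wsub Y" unfolding Y_def
    by (rule wsub_kernel[OF wsub_Wh]) (simp_all add: hop_add hop_scale hop_kk hop_kki hop_c1)
  have inj: "y = 0" if "m \<noteq> n" "y \<in> Y" "hop m y = 0" for m y
  proof (rule quad)
    show "y \<in> Wh" using that by (simp add: Y_def)
    have "hop m y - hop n y = 0" using that by (simp add: Y_def)
    then show "(q powi (3 - 2 * int m) - q powi (3 - 2 * int n)) *s kk y + (q powi (2 * int m - 3) - q powi (2 * int n - 3)) *s kki y = 0"
      by (simp add: hop_def algebra_simps)
    show "q powi (3 - 2 * int m) - q powi (3 - 2 * int n) \<noteq> 0" using that(1) unfolding right_minus_eq q_powi_inject by simp
  qed
  show False
  proof (cases "\<forall>y\<in>Y. u n y = 0")
    case True
    show False
    proof (rule contra[OF Y])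
      show "y1 \<in> Y" "y1 \<noteq> 0" using y1 by (auto simp: Y_def)
      show "0 \<in> {..<n}" using n by simp
      show "y = 0" if "\<exists>b\<in>{..<n}. m \<le> b" "y \<in> Y" "hop m y = 0" for m y
        by (rule inj[of m]) (use that in auto)
      show "Sp UNIV Y' \<subseteq> Sp {..<n} Y'" if "wsub Y'" "Y' \<subseteq> Y" for Y'
        by (rule Sp_reduce) (use that True in auto)
    qed
  next
    case False
    then obtain y where y: "y \<in> Y" "u n y \<noteq> 0" by blast
    \<comment> \<open>Moving K from y to u(n,0,1) costs q^(3n), which turns the exponent 3 - n of
      \<open>c1_u\<close> into 3 + 2n. Formally f is a multiple of h_m at m = -n, so it can be
      compared with every h_m for m \<ge> 1.\<close>
    define f where "f x = c1 x - ((dq * q powi (3 + 2 * int n)) *s kk x + (dq * q powi (- 3 - 2 * int n)) *s kki x)" for x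
    define Z where "Z = {y \<in> Wh. f y = 0}"
    have Z: "wsub Z" unfolding Z_def
      by (rule wsub_kernel[OF wsub_Wh]) (simp_all add: f_def algebra_simps c1_kk c1_kki)
    have h: "hop n y = 0" using y by (simp add: Y_def)
    have "u n y \<in> Wh" using u_Wh[OF Y y(1) h] .
    moreover have "f (u n y) = 0"
      unfolding f_def c1_u[OF Y y(1) h] kk_u kki_u u_add u_scale scale_scale
      by (simp add: mult.assoc flip: power_int_add)
    ultimately have uZ: "u n y \<in> Z" by (simp add: Z_def)
    show False
    proof (rule contra[OF Z uZ y(2), of UNIV])
      show "y = 0" if m: "1 \<le> m" and yZ: "y \<in> Z" and hm: "hop m y = 0" for m y
      proof (rule quad)
        show "y \<in> Wh" using yZ by (simp add: Z_def)
        have c: "c1 y = (dq * q powi (3 + 2 * int n)) *s kk y + (dq * q powi (- 3 - 2 * int n)) *s kki y"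
          using yZ by (simp add: Z_def f_def)
        have "qd\<^sup>2 *s c1 y = (dq * qd\<^sup>2) *s ((q powi (3 + 2 * int n)) *s kk y + (q powi (- 3 - 2 * int n)) *s kki y)"
          unfolding c by (simp add: scale_right_distrib mult_ac)
        then show "(q powi (3 - 2 * int m) - q powi (3 + 2 * int n)) *s kk y + (q powi (2 * int m - 3) - q powi (- 3 - 2 * int n)) *s kki y = 0"
          using hm unfolding dq_qd by (simp add: hop_def algebra_simps)
        show "q powi (3 - 2 * int m) - q powi (3 + 2 * int n) \<noteq> 0" using m unfolding right_minus_eq q_powi_inject by simp
      qed
    qed auto
  qed
qed

text \<open>Where K is a scalar, h_m(K, C1) y = 0 makes C1 y a multiple of y. So if C1 had no
  eigenvector there, all h_m would be injective and \<open>eigenvector_in_wsub\<close> would produce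
  one.\<close>

lemma exists_eigenvector:
  assumes w: "w \<in> Wh" "w \<noteq> 0"
  shows "\<exists>e \<kappa> c. e \<in> Wh \<and> e \<noteq> 0 \<and> \<kappa> \<noteq> 0 \<and> kk e = \<kappa> *s e \<and> c1 e = c *s e"
proof -
  obtain e \<kappa> where e: "e \<in> Wh" "e \<noteq> 0" "kk e = \<kappa> *s e" using exists_kk_eigenvector[OF w] by blast
  have \<kappa>: "\<kappa> \<noteq> 0" using e kki_kk[of e] by auto
  define Y where "Y = {y \<in> Wh. kk y - \<kappa> *s y = 0}"
  have Y: "wsub Y" unfolding Y_def
    by (rule wsub_kernel[OF wsub_Wh]) (simp_all add: algebra_simps c1_kk)
  have eY: "e \<in> Y" using e by (simp add: Y_def)
  have "\<exists>e r. e \<in> Y \<and> e \<noteq> 0 \<and> c1 e = r *s e"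
  proof (rule ccontr)
    assume none: "\<not> ?thesis"
    have inj: "y = 0" if "y \<in> Y" "hop m y = 0" for m y
    proof -
      have k: "kk y = \<kappa> *s y" using that by (simp add: Y_def)
      then have "kki y = inverse \<kappa> *s y" using \<kappa> by (simp add: kki_flip)
      then have "c1 y = (dq * q powi (3 - 2 * int m) * \<kappa> + dq * q powi (2 * int m - 3) * inverse \<kappa>) *s y"
        using c1_hop[OF that(2)] k by (simp add: scale_left_distrib)
      then show ?thesis using none that(1) by blast
    qed
    have "\<exists>e r. e \<in> Y \<and> e \<noteq> 0 \<and> c1 e = r *s e"
      by (rule eigenvector_in_wsub[OF Y eY e(2), where J = UNIV])
        (use Y inj in \<open>auto simp: c1_kk c1_kki wsub_def\<close>)
    then show False using none by blast
  qed
  then obtain e' c where "e' \<in> Y" "e' \<noteq> 0" "c1 e' = c *s e'" by blast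
  then show ?thesis using \<kappa> by (auto simp: Y_def)
qed

end

subsection \<open>Cyclic modules as quotients of the free algebra\<close>

lemma ncadd_eq: "ncadd f g = f + g"
  by (simp add: ncadd_def plus_fun_def)

lemma ncc_0: "ncc 0 = 0"
  by (simp add: ncc_def zero_fun_def)

lemma vector_space_nc: "vector_space ncsc"
  by standard (auto simp: ncsc_def fun_eq_iff algebra_simps)

text \<open>Extend a basis of L to one of F and then to one of the whole space; \<pi> keeps the
  basis vectors that are new in F and kills all others. Its image is a copy of F/L inside the same
  type.\<close>

lemma (in vector_space) exists_projection:
  assumes L: "subspace L" and F: "subspace F" and LF: "L \<subseteq> F"
  shows "\<exists>\<pi>. Vector_Spaces.linear scale scale \<pi> \<and> (\<forall>x\<in>L. \<pi> x = 0) \<and> (\<forall>x\<in>F. x - \<pi> x \<in> L) \<and>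
    (\<forall>x. \<pi> x \<in> F) \<and> (\<forall>x. \<pi> (\<pi> x) = \<pi> x)"
proof -
  interpret P: vector_space_pair scale scale ..
  obtain BL where BL: "BL \<subseteq> L" "independent BL" "L \<subseteq> span BL"
    by (rule maximal_independent_subset)
  obtain BF where BF: "BL \<subseteq> BF" "BF \<subseteq> F" "independent BF" "F \<subseteq> span BF"
    by (rule maximal_independent_subset_extend[OF order_trans[OF BL(1) LF] BL(2)])
  obtain B where B: "BF \<subseteq> B" "independent B" "UNIV \<subseteq> span B"
    by (rule maximal_independent_subset_extend[OF subset_UNIV BF(3)])
  obtain \<pi> where \<pi>: "Vector_Spaces.linear scale scale \<pi>" "\<And>x. x \<in> B \<Longrightarrow> \<pi> x = (if x \<in> BF - BL then x else 0)"
    using P.linear_independent_extend[OF B(2), of "\<lambda>x. if x \<in> BF - BL then x else 0"] by auto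
  note lin = P.linear_add[OF \<pi>(1)] P.linear_scale[OF \<pi>(1)] P.linear_0[OF \<pi>(1)]
  have L0: "\<pi> x = 0" if "x \<in> L" for x
  proof -
    have "x \<in> span BL" using that BL by blast
    then show ?thesis
    proof (induction rule: span_induct_alt)
      case (step c x y)
      then have "x \<in> B" "x \<notin> BF - BL" using BL BF B by auto
      then show ?case using step \<pi>(2) by (simp add: lin)
    qed (simp add: lin)
  qed
  have FL: "x - \<pi> x \<in> L" if "x \<in> F" for x
  proof -
    have "x \<in> span BF" using that BF by blast
    then show ?thesis
    proof (induction rule: span_induct_alt)
      case base
      then show ?case using subspace_0[OF L] by (simp add: lin)
    next
      case (step c x y)
      then have "x \<in> B" using B(1) by blast
      then have "x - \<pi> x \<in> L" using \<pi>(2)[of x] step BL(1) subspace_0[OF L] by (auto split: if_splits)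
      then have "scale c (x - \<pi> x) + (y - \<pi> y) \<in> L" using step L by (intro subspace_add subspace_scale)
      then show ?case by (simp add: lin algebra_simps)
    qed
  qed
  have \<pi>F: "\<pi> x \<in> F \<and> \<pi> (\<pi> x) = \<pi> x" for x
  proof -
    have "x \<in> span B" using B by blast
    then show ?thesis
    proof (induction rule: span_induct_alt)
      case base
      then show ?case using subspace_0[OF F] by (simp add: lin)
    next
      case (step c x y)
      have "\<pi> x \<in> F \<and> \<pi> (\<pi> x) = \<pi> x"
        using \<pi>(2)[of x] step BF(2) subspace_0[OF F] by (auto simp: lin split: if_splits)
      then show ?case using step F by (simp add: lin subspace_add subspace_scale)
    qed
  qed
  show ?thesis using \<pi>(1) L0 FL \<pi>F by blast
qed

text \<open>The counit of U as a one-dimensional module. It supplies an action satisfying the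
  relations on the part of the type that the quotient does not occupy.\<close>

definition triv :: "gen \<Rightarrow> complex \<Rightarrow> complex" where
  "triv g z = (if g \<in> {K1, K2, K1i, K2i} then z else 0)"

lemma lin_rep_triv: "lin_rep (*) triv"
proof -
  interpret vector_space "(*) :: complex \<Rightarrow> complex \<Rightarrow> complex"
    by standard (auto simp: algebra_simps)
  show ?thesis
    by standard (auto simp: triv_def algebra_simps)
qed

lemma triv_rels:
  assumes "r \<in> Uq_rels q" shows "act (*) triv r z = 0"
proof -
  interpret lin_rep "(*)" triv by (rule lin_rep_triv)
  show ?thesis
    using assms unfolding Uq_rels_def
    by (auto simp: Kg_def Kig_def Eg_def Fg_def triv_def split: if_splits)
qed

text \<open>The quotient of the finitely supported functions by \<open>L\<close> is realised on the whole type
  \<open>nc\<close>: a projection along \<open>L\<close> identifies it with a subspace, and the kernel of the projection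
  carries copies of the trivial representation.\<close>

lemma exists_quotient_rep:
  fixes L :: "nc set" and q :: complex
  assumes zero: "ncc 0 \<in> L" and add: "\<And>x y. x \<in> L \<Longrightarrow> y \<in> L \<Longrightarrow> ncadd x y \<in> L"
    and scale: "\<And>c x. x \<in> L \<Longrightarrow> ncsc c x \<in> L"
    and left: "\<And>g x. ncfin x \<Longrightarrow> x \<in> L \<Longrightarrow> ncmul (ncg g) x \<in> L"
    and rel: "\<And>r x. r \<in> Uq_rels q \<Longrightarrow> ncfin x \<Longrightarrow> ncmul r x \<in> L"
  shows "\<exists>\<rho> w. lin_rep ncsc \<rho> \<and> (\<forall>r\<in>Uq_rels q. \<forall>v. act ncsc \<rho> r v = 0) \<and>
    (\<forall>f. ncfin f \<longrightarrow> (act ncsc \<rho> f w = 0 \<longleftrightarrow> f \<in> L))"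
proof -
  interpret N: vector_space ncsc by (rule vector_space_nc)
  interpret t: lin_rep "(*)" triv by (rule lin_rep_triv)
  have F: "N.subspace {f. ncfin f}"
    by (rule N.subspaceI) (auto simp flip: ncadd_eq ncc_0)
  have L: "N.subspace {f \<in> L. ncfin f}"
    by (rule N.subspaceI) (auto simp: zero add scale simp flip: ncadd_eq ncc_0)
  have "{f \<in> L. ncfin f} \<subseteq> {f. ncfin f}" by auto
  from N.exists_projection[OF L F this] obtain \<pi> where lin: "Vector_Spaces.linear ncsc ncsc \<pi>"
    and pi: "\<forall>x\<in>{f \<in> L. ncfin f}. \<pi> x = 0" "\<forall>x\<in>{f. ncfin f}. x - \<pi> x \<in> {f \<in> L. ncfin f}"
      "\<forall>x. \<pi> x \<in> {f. ncfin f}" "\<forall>x. \<pi> (\<pi> x) = \<pi> x"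
    by blast
  have \<pi>L: "\<pi> x = 0" if "x \<in> L" "ncfin x" for x using pi(1) that by simp
  have \<pi>F: "x - \<pi> x \<in> L \<and> ncfin (x - \<pi> x)" if "ncfin x" for x using pi(2) that by simp
  have \<pi>f: "ncfin (\<pi> x)" and \<pi>\<pi>: "\<pi> (\<pi> x) = \<pi> x" for x using pi(3,4) by simp_all
  interpret P: vector_space_pair ncsc ncsc ..
  note l = P.linear_add[OF lin] P.linear_diff[OF lin] P.linear_scale[OF lin] P.linear_0[OF lin]
  have mul_add: "ncmul f (x + y) = ncmul f x + ncmul f y" for f x y
    using ncmul_ncadd_right by (simp add: ncadd_eq)
  have mul_sc: "ncmul f (ncsc c x) = ncsc c (ncmul f x)" for f c x by (rule ncmul_ncsc_right)
  have mul_diff: "ncmul f (x - y) = ncmul f x - ncmul f y" for f x y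
    using mul_add[of f x "- y"] mul_sc[of f "-1" y] by simp
  have mulL: "ncmul f x \<in> L" if "ncfin f" "ncfin x" "x \<in> L" for f x
    using that(1)
  proof (induction rule: ncfin_induct)
    case (add c m f)
    have "ncmul (ncw m) x \<in> L"
    proof (induction m)
      case (Cons g m)
      then show ?case using left[of "ncmul (ncw m) x" g] that by (simp add: ncw_Cons ncmul_ncg_assoc)
    qed (use that in \<open>simp add: ncw_Nil\<close>)
    then show ?case using assms(2,3) add by (simp add: ncmul_ncadd_left ncmul_ncsc_left)
  qed (simp add: zero)
  have \<pi>mul: "\<pi> (ncmul f (\<pi> x)) = \<pi> (ncmul f x)" if "ncfin f" "ncfin x" for f x
  proof -
    have "\<pi> (ncmul f (x - \<pi> x)) = 0" using \<pi>F[OF that(2)] mulL[of f "x - \<pi> x"] that(1) by (intro \<pi>L) auto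
    then show ?thesis by (simp add: mul_diff l)
  qed
  define \<rho> where "\<rho> g x = \<pi> (ncmul (ncg g) (\<pi> x)) + ncsc (triv g 1) (x - \<pi> x)" for g x
  have lr: "lin_rep ncsc \<rho>"
  proof (intro lin_rep.intro lin_rep_axioms.intro vector_space_nc)
    show "Vector_Spaces.linear ncsc ncsc (\<rho> g)" for g
      unfolding Vector_Spaces.linear_iff using vector_space_nc
      by (simp add: \<rho>_def l mul_add mul_sc N.scale_right_distrib N.scale_right_diff_distrib algebra_simps)
  qed
  interpret R: lin_rep ncsc \<rho> by (rule lr)
  \<comment> \<open>An element acts separately on the two summands of x: by multiplication modulo L
    on \<pi> x, through the counit on x - \<pi> x.\<close>
  have act: "act ncsc \<rho> f x = \<pi> (ncmul f (\<pi> x)) + ncsc (act (*) triv f 1) (x - \<pi> x)" if "ncfin f" for f x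
    using that
  proof (induction rule: ncfin_induct)
    case zero
    show ?case
      unfolding R.act_ncc t.act_ncc ncmul_zero_left
      by (simp only: ncc_0 l N.scale_zero_left mult_zero_left add_0_right)
  next
    case (add c m f)
    have w: "wact \<rho> m x = \<pi> (ncmul (ncw m) (\<pi> x)) + ncsc (wact triv m 1) (x - \<pi> x)"
    proof (induction m)
      case Nil
      then show ?case by (simp add: ncw_Nil \<pi>\<pi>)
    next
      case (Cons g m)
      define y where "y = \<pi> (ncmul (ncw m) (\<pi> x)) + ncsc (wact triv m 1) (x - \<pi> x)"
      have py: "\<pi> y = \<pi> (ncmul (ncw m) (\<pi> x))"
        by (simp only: y_def l \<pi>\<pi> diff_self N.scale_zero_right add_0_right)
      have fin: "ncfin (ncmul (ncw m) (\<pi> x))" using \<pi>f by simp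
      have t: "wact triv (g # m) 1 = triv g 1 * wact triv m 1" by (simp add: triv_def)
      have "wact \<rho> (g # m) x = \<rho> g y" using Cons by (simp only: wact.simps y_def)
      also have "\<dots> = \<pi> (ncmul (ncg g) (ncmul (ncw m) (\<pi> x))) + ncsc (triv g 1) (y - \<pi> (ncmul (ncw m) (\<pi> x)))"
        by (simp only: \<rho>_def py \<pi>mul[OF ncfin_ncg fin])
      finally show ?case
        by (simp only: t y_def ncw_Cons ncmul_ncg_assoc add_diff_cancel_left' N.scale_scale)
    qed
    have "act ncsc \<rho> (ncadd (ncsc c (ncw m)) f) x = ncsc c (wact \<rho> m x) + act ncsc \<rho> f x"
      using add.hyps by (simp only: R.act_ncadd R.act_ncsc R.act_ncw ncfin_ncsc ncfin_ncw)
    moreover have "act (*) triv (ncadd (ncsc c (ncw m)) f) 1 = c * wact triv m 1 + act (*) triv f 1"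
      using add.hyps by simp
    moreover have "ncmul (ncadd (ncsc c (ncw m)) f) (\<pi> x) = ncsc c (ncmul (ncw m) (\<pi> x)) + ncmul f (\<pi> x)"
      unfolding ncmul_ncadd_left ncmul_ncsc_left by (rule ncadd_eq)
    ultimately show ?case
      by (simp only: w add.IH l N.scale_right_distrib N.scale_left_distrib N.scale_scale ac_simps)
  qed
  define w where "w = \<pi> (ncc 1)"
  have aw: "act ncsc \<rho> f w = \<pi> f" if "ncfin f" for f
    by (simp only: act[OF that] w_def \<pi>\<pi> \<pi>mul[OF that ncfin_ncc] ncmul_ncc1_right diff_self
        N.scale_zero_right add_0_right)
  have rels: "act ncsc \<rho> r v = 0" if "r \<in> Uq_rels q" for r v
    by (simp only: act[OF ncfin_Uq_rels[OF that]] triv_rels[OF that] N.scale_zero_left add_0_right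
        \<pi>L[OF rel[OF that \<pi>f[of v]] ncfin_ncmul[OF ncfin_Uq_rels[OF that] \<pi>f[of v]]])
  have "act ncsc \<rho> f w = 0 \<longleftrightarrow> f \<in> L" if "ncfin f" for f
    unfolding aw[OF that] using \<pi>L[of f] \<pi>F[OF that] that by (metis diff_0_right)
  then show ?thesis using lr rels by blast
qed

subsection \<open>The annihilator of a Whittaker eigenvector\<close>

definition k2pow :: "int \<Rightarrow> nc" where
  "k2pow l = (if l \<ge> 0 then ncpow (ncg K2) (nat l) else ncpow (ncg K2i) (nat (- l)))"

definition pbw :: "complex \<Rightarrow> nat \<Rightarrow> nat \<Rightarrow> int \<Rightarrow> nc" where
  "pbw q a b l = ncmul (ncpow (ncg F2) a) (ncmul (ncpow (F3el q) b) (k2pow l))"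

lemma ncfin_pbw [simp]: "ncfin (pbw q a b l)"
  by (simp add: pbw_def k2pow_def)

context uq_rep begin

lemma act_Kel [simp]: "A Kel x = kk x" and act_C1el [simp]: "A (C1el q) x = c1 x"
  and act_F3el [simp]: "A (F3el q) x = f3 x"
  by (simp_all add: Kel_def kk_def C1el_def c1_def F3el_def f3_def)

lemma act_Kpow [simp]: "A (Kpow m) x = kp m x"
proof -
  have "act scale \<rho> (ncw [K1, K2, K2]) = kk" "act scale \<rho> (ncw [K2i, K2i, K1i]) = kki"
    by (simp_all add: fun_eq_iff kk_def kki_def)
  then show ?thesis by (simp add: Kpow_def kp_def Kel_def Kinvel_def)
qed

lemma act_pbw [simp]: "A (pbw q a b l) x = B a b l x"
proof -
  have "act scale \<rho> (ncg g) = \<rho> g" "act scale \<rho> (F3el q) = f3" for g by (simp_all add: fun_eq_iff)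
  then show ?thesis by (simp add: pbw_def B_def k2pow_def k2p_def)
qed

lemma act_uel [simp]: "A (uel q \<alpha> n) x = u n x"
proof -
  have f: "act scale \<rho> (ncg g) = \<rho> g" "act scale \<rho> (F3el q) = f3" for g by (simp_all add: fun_eq_iff)
  have "k2p (2 * int j) y = (\<rho> K2 ^^ (2 * j)) y" for j y
    by (simp add: k2p_def nat_mult_distrib)
  then show ?thesis
    unfolding uel_def KJ_def[symmetric] u_eq by (subst act_ncsum) (auto simp: f B_def intro!: sum.cong)
qed

lemma wact_eta:
  assumes "w \<in> Wh" "set m \<subseteq> {E1, E2}" shows "wact \<rho> m w = eta_word \<alpha> m *s w"
  using assms(2)
proof (induction m)
  case (Cons g m)
  have w: "\<rho> E1 w = \<alpha> *s w" "\<rho> E2 w = 0" using assms(1) by (auto simp: Wh_def)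
  from Cons show ?case by (auto simp: w eta_word_def)
qed (simp add: eta_word_def)

lemma hop_eigen:
  assumes "kk w = \<kappa> *s w" "c1 w = c *s w" "\<kappa> \<noteq> 0"
  shows "hop m w = hfun q m \<kappa> c *s w"
proof -
  have "kki w = inverse \<kappa> *s w" using assms by (simp add: kki_flip)
  then show ?thesis using assms by (simp add: hop_def hfun_def scale_left_distrib scale_left_diff_distrib)
qed

lemma wsub_line:
  assumes "w \<in> Wh" "kk w = \<kappa> *s w" "c1 w = c *s w" "\<kappa> \<noteq> 0"
  shows "wsub (range (\<lambda>s. s *s w))"
proof -
  have "kki w = inverse \<kappa> *s w" using assms by (simp add: kki_flip)
  moreover have "subspace (range (\<lambda>s. s *s w))"
  proof (rule subspaceI)
    show "0 \<in> range (\<lambda>s. s *s w)" by (rule range_eqI[of _ _ 0]) simp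
    show "x + y \<in> range (\<lambda>s. s *s w)" if "x \<in> range (\<lambda>s. s *s w)" "y \<in> range (\<lambda>s. s *s w)" for x y
      using that by (auto simp flip: scale_left_distrib)
  qed auto
  ultimately show ?thesis
    using assms by (auto simp: wsub_def Wh_def mult.commute)
qed

lemma LV_annihilates:
  assumes w: "w \<in> Wh" "kk w = \<kappa> *s w" "c1 w = c *s w"
    and x: "x \<in> L_M q \<alpha> \<union> L_J q \<kappa> c"
  shows "ncfin x \<and> A x w = 0"
proof -
  have y: "kk (kp m ((c1 ^^ n) w)) = \<kappa> *s kp m ((c1 ^^ n) w)" "c1 (kp m ((c1 ^^ n) w)) = c *s kp m ((c1 ^^ n) w)" for m n
  proof -
    have "(c1 ^^ n) w = c ^ n *s w" by (induction n) (simp_all add: w mult.commute)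
    then have "kk ((c1 ^^ n) w) = \<kappa> *s (c1 ^^ n) w" "c1 ((c1 ^^ n) w) = c *s (c1 ^^ n) w"
      by (simp_all add: w mult.commute)
    then show "kk (kp m ((c1 ^^ n) w)) = \<kappa> *s kp m ((c1 ^^ n) w)" "c1 (kp m ((c1 ^^ n) w)) = c *s kp m ((c1 ^^ n) w)"
      using kp_commute[of kk m "(c1 ^^ n) w"] by (simp_all add: c1_kp del: kk_kp)
  qed
  have f: "act scale \<rho> (C1el q) = c1" by (simp add: fun_eq_iff)
  have Kfin: "ncfin Kel" by (simp add: Kel_def)
  show ?thesis
    using x Kfin unfolding L_M_def L_J_def
    by (auto simp: rels ncfin_Uq_rels f y wact_eta[OF w(1)] simp del: kk_kp)
qed

text \<open>Over the line spanned by w the vector coefficients of a family become scalars, so the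
  expansion can be carried to another module by means of the elements \<open>pbw\<close>.\<close>

lemma pbw_expansion:
  assumes w: "w \<in> Wh" "kk w = \<kappa> *s w" "c1 w = c *s w" "\<kappa> \<noteq> 0"
    and J: "0 \<in> J" "Sp UNIV (range (\<lambda>s. s *s w)) \<subseteq> Sp J (range (\<lambda>s. s *s w))"
    and f: "ncfin f"
  shows "\<exists>r. finite {(a, b, l). r a b l \<noteq> 0} \<and> (\<forall>a b l. r a b l \<noteq> 0 \<longrightarrow> b \<in> J) \<and>
    A f w = (\<Sum>(a, b, l)\<in>{(a, b, l). r a b l \<noteq> 0}. r a b l *s B a b l w)"
proof -
  let ?Y = "range (\<lambda>s. s *s w)"
  have Y: "wsub ?Y" by (rule wsub_line[OF w])
  have sub: "subspace ?Y" using Y by (simp add: wsub_def)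
  have wY: "w \<in> ?Y" by (rule range_eqI[of _ _ 1]) simp
  have "w \<in> Sp UNIV ?Y" using Sp_B[of 0 UNIV w ?Y 0 0] wY by simp
  then have "A f w \<in> Sp UNIV ?Y" by (intro act_induct[OF f] Sp_rho[OF Y]) auto
  then have "A f w \<in> Sp J ?Y" using J by blast
  from Sp_val[OF sub this] obtain P where P: "fam ?Y P" "\<And>a b l. P a b l \<noteq> 0 \<Longrightarrow> b \<in> J" "val P = A f w" by blast
  have "\<exists>s. P a b l = s *s w \<and> (P a b l = 0 \<longrightarrow> s = 0)" for a b l
    using fam_in[OF P(1), of a b l] by (cases "P a b l = 0") (auto intro: exI[of _ 0])
  then obtain r where r: "\<And>a b l. P a b l = r a b l *s w" "\<And>a b l. P a b l = 0 \<Longrightarrow> r a b l = 0" by metis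
  have S: "{(a, b, l). r a b l \<noteq> 0} = supp P" using r by (force simp: supp_def)
  show ?thesis
  proof (intro exI conjI allI impI)
    show "finite {(a, b, l). r a b l \<noteq> 0}" unfolding S by (rule fam_finite[OF P(1)])
    show "b \<in> J" if "r a b l \<noteq> 0" for a b l using that r P(2) by metis
    show "A f w = (\<Sum>(a, b, l)\<in>{(a, b, l). r a b l \<noteq> 0}. r a b l *s B a b l w)"
      unfolding S P(3)[symmetric] val_def by (rule sum.cong) (auto simp: r(1))
  qed
qed

text \<open>In the quotient by L the class of 1 is a Whittaker eigenvector v, and f v = g v for a
  combination g of elements \<open>pbw\<close> with powers of F3 in J. Thus f - g lies in L, so g w
  = 0, and independence in the given module makes all coefficients of g zero. Then f v = 0, that is,
  f lies in L.\<close>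

lemma annihilator_subset:
  fixes L :: "nc set"
  assumes w: "w \<in> Wh" "w \<noteq> 0" "kk w = \<kappa> *s w" "c1 w = c *s w" "\<kappa> \<noteq> 0"
    and zero: "ncc 0 \<in> L" and add: "\<And>x y. x \<in> L \<Longrightarrow> y \<in> L \<Longrightarrow> ncadd x y \<in> L"
    and scale: "\<And>c x. x \<in> L \<Longrightarrow> ncsc c x \<in> L"
    and left: "\<And>g x. x \<in> L \<Longrightarrow> ncmul (ncg g) x \<in> L"
    and sub: "L_M q \<alpha> \<union> L_J q \<kappa> c \<subseteq> L"
    and ann: "\<And>f. f \<in> L \<Longrightarrow> A f w = 0"
    and J: "J = UNIV \<or> n \<ge> 1 \<and> J = {..<n} \<and> uel q \<alpha> n \<in> L"
    and h: "\<And>m. 1 \<le> m \<Longrightarrow> \<exists>b\<in>J. m \<le> b \<Longrightarrow> hfun q m \<kappa> c \<noteq> 0"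
    and f: "ncfin f" "A f w = 0"
  shows "f \<in> L"
proof -
  have rel: "ncmul r x \<in> L" if "r \<in> Uq_rels q" "ncfin x" for r x
  proof -
    have "ncmul (ncmul (ncc 1) r) x \<in> L_M q \<alpha>" unfolding L_M_def using that ncfin_ncc by blast
    then show ?thesis using sub by auto
  qed
  obtain \<sigma> v where \<sigma>: "lin_rep ncsc \<sigma>" "\<forall>r\<in>Uq_rels q. \<forall>v. act ncsc \<sigma> r v = 0"
    and v': "\<forall>f. ncfin f \<longrightarrow> (act ncsc \<sigma> f v = 0 \<longleftrightarrow> f \<in> L)"
    using exists_quotient_rep[OF zero add scale left rel] by blast
  have v: "act ncsc \<sigma> f v = 0 \<longleftrightarrow> f \<in> L" if "ncfin f" for f using v' that by blast
  interpret M: uq_rep ncsc \<sigma> q \<alpha>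
    using \<sigma> by (intro uq_rep.intro uq_rep_axioms.intro) (auto dest: q_not_root)
  have Kfin: "ncfin Kel" by (simp add: Kel_def)
  have vW: "v \<in> M.Wh"
  proof -
    have m: "ncmul (ncc 1) (ncsub (ncw m) (ncc (eta_word \<alpha> m))) \<in> L" if "set m \<subseteq> {E1, E2}" for m
      using sub that ncfin_ncc unfolding L_M_def by blast
    from m[of "[E1]"] m[of "[E2]"] show ?thesis
      by (auto simp: M.Wh_def eta_word_def simp flip: v)
  qed
  have vk: "M.kk v = ncsc \<kappa> v" "M.c1 v = ncsc c v"
  proof -
    have "ncmul (ncc 1) (ncmul (ncsub Kel (ncc \<kappa>)) (ncmul (Kpow 0) (ncpow (C1el q) 0))) \<in> L"
      "ncmul (ncc 1) (ncmul (ncsub (C1el q) (ncc c)) (ncmul (Kpow 0) (ncpow (C1el q) 0))) \<in> L"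
      using sub ncfin_ncc unfolding L_J_def by blast+
    then have "ncsub Kel (ncc \<kappa>) \<in> L" "ncsub (C1el q) (ncc c) \<in> L" by (simp_all add: Kpow_def ncpow_def)
    then show "M.kk v = ncsc \<kappa> v" "M.c1 v = ncsc c v" using Kfin by (simp_all flip: v)
  qed
  have J0: "0 \<in> J" using J by auto
  \<comment> \<open>For J = {..<n} the higher powers of F3 are reduced in the quotient, where
    u(n,0,1) v = 0 because L contains \<open>uel q \<alpha> n\<close>.\<close>
  have red: "M.Sp UNIV (range (\<lambda>s. ncsc s v)) \<subseteq> M.Sp J (range (\<lambda>s. ncsc s v))"
  proof (cases "J = UNIV")
    case False
    then have n: "J = {..<n}" "uel q \<alpha> n \<in> L" using J by auto
    have "M.u n v = 0" using n(2) by (simp flip: v)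
    then have "M.u n y = 0" if "y \<in> range (\<lambda>s. ncsc s v)" for y using that by (auto simp: M.u_scale)
    then show ?thesis unfolding n(1) by (intro M.Sp_reduce M.wsub_line[OF vW vk w(5)])
  qed simp
  from M.pbw_expansion[OF vW vk w(5) J0 red f(1)] obtain r
    where r: "finite {(a, b, l). r a b l \<noteq> 0}" "\<And>a b l. r a b l \<noteq> 0 \<Longrightarrow> b \<in> J"
      "act ncsc \<sigma> f v = (\<Sum>(a, b, l)\<in>{(a, b, l). r a b l \<noteq> 0}. ncsc (r a b l) (M.B a b l v))" by blast
  define S where "S = {(a, b, l). r a b l \<noteq> 0}"
  define g where "g = ncsum (\<lambda>(a, b, l). ncsc (r a b l) (pbw q a b l)) S"
  have g: "ncfin g" unfolding g_def by (intro ncfin_ncsum) auto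
  have gv: "act ncsc \<sigma> g v = act ncsc \<sigma> f v"
    unfolding g_def r(3) S_def[symmetric] by (subst M.act_ncsum) (use r(1) in \<open>auto simp: S_def intro!: sum.cong\<close>)
  then have "ncsub f g \<in> L" using f g by (simp flip: v)
  then have "A g w = 0" using ann[of "ncsub f g"] f g by simp
  then have sum0: "(\<Sum>(a, b, l)\<in>S. B a b l (r a b l *s w)) = 0"
    unfolding g_def by (subst (asm) act_ncsum) (use r(1) in \<open>auto simp: S_def split_def\<close>)
  let ?Y = "range (\<lambda>s. s *s w)"
  define P where "P a b l = r a b l *s w" for a b l
  have supp: "supp P = S" using w(2) by (auto simp: supp_def P_def S_def)
  have "P = 0"
  proof (rule free_on[OF wsub_line[OF w(1,3,4,5)]])
    show "fam ?Y P" using r(1) supp by (auto simp: fam_def P_def S_def)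
    show "val P = 0" unfolding val_def supp using sum0 by (simp add: P_def)
    show "0 \<in> J" by (rule J0)
    show "b \<in> J" if "P a b l \<noteq> 0" for a b l using that r(2) by (auto simp: P_def)
    show "y = 0" if m: "1 \<le> m" "\<exists>b\<in>J. m \<le> b" and y: "y \<in> ?Y" "hop m y = 0" for m y
    proof -
      obtain s where s: "y = s *s w" using y(1) by blast
      then have "(s * hfun q m \<kappa> c) *s w = 0" using y(2) by (simp add: hop_scale hop_eigen[OF w(3,4,5)])
      then show "y = 0" using h[OF m] w(2) s by auto
    qed
  qed
  then have "supp P = {}" by (auto simp: supp_def)
  then have "S = {}" using supp by simp
  then have "act ncsc \<sigma> f v = 0" unfolding r(3) S_def[symmetric] by simp
  then show ?thesis using v f by simp
qed

end

section \<open>Left multiplication on the generating sets, and the vanishing of u_-\<close>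

lemma L_M_left:
  assumes "x \<in> L_M q \<alpha>" shows "ncmul (ncg g) x \<in> L_M q \<alpha>"
proof -
  consider (rel) a r b where "x = ncmul (ncmul a r) b" "ncfin a" "ncfin b" "r \<in> Uq_rels q"
    | (eta) a m where "x = ncmul a (ncsub (ncw m) (ncc (eta_word \<alpha> m)))" "ncfin a" "set m \<subseteq> {E1, E2}"
    using assms unfolding L_M_def by blast
  then show ?thesis
  proof cases
    case rel
    then have "ncmul (ncg g) x = ncmul (ncmul (ncmul (ncg g) a) r) b" "ncfin (ncmul (ncg g) a)"
      by (simp_all add: ncmul_ncg_assoc)
    then show ?thesis using rel unfolding L_M_def by blast
  next
    case eta
    then have "ncmul (ncg g) x = ncmul (ncmul (ncg g) a) (ncsub (ncw m) (ncc (eta_word \<alpha> m)))" "ncfin (ncmul (ncg g) a)"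
      by (simp_all add: ncmul_ncg_assoc)
    then show ?thesis using eta unfolding L_M_def by blast
  qed
qed

lemma left_multiples_left:
  assumes "x \<in> {ncmul a z |a. ncfin a}" shows "ncmul (ncg g) x \<in> {ncmul a z |a. ncfin a}"
proof -
  obtain a where "x = ncmul a z" "ncfin a" using assms by blast
  then have "ncmul (ncg g) x = ncmul (ncmul (ncg g) a) z" "ncfin (ncmul (ncg g) a)"
    by (simp_all add: ncmul_ncg_assoc)
  then show ?thesis by blast
qed

lemma L_J_left:
  assumes "x \<in> L_J q \<kappa> c" shows "ncmul (ncg g) x \<in> L_J q \<kappa> c"
proof -
  obtain z where z: "x \<in> {ncmul a z |a. ncfin a}" "{ncmul a z |a. ncfin a} \<subseteq> L_J q \<kappa> c"
    using assms unfolding L_J_def by blast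
  then show ?thesis using left_multiples_left by blast
qed

context uq_irr begin

text \<open>If u(n,0,1) w were nonzero, w would be a combination of vectors \<open>B a b l\<close>
  over it, which are eigenvectors of K for q^(-3(a+b+n)) \<kappa>. The polynomial \<open>Q\<close>
  with these roots kills the combination, but it acts on w by Q(\<kappa>), which is nonzero since n
  \<ge> 1 and q is not a root of unity.\<close>

lemma u_critical_zero:
  assumes w: "w \<in> Wh" "w \<noteq> 0" "kk w = \<kappa> *s w" "c1 w = c *s w" "\<kappa> \<noteq> 0"
    and h: "hfun q n \<kappa> c = 0" and n: "n \<ge> 1"
  shows "u n w = 0"
proof (rule ccontr)
  assume z0: "u n w \<noteq> 0"
  let ?Y = "range (\<lambda>s. s *s w)" and ?Z = "range (\<lambda>s. s *s u n w)"
  have Y: "wsub ?Y" by (rule wsub_line[OF w(1,3,4,5)])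
  have wY: "w \<in> ?Y" by (rule range_eqI[of _ _ 1]) simp
  have hw: "hop n w = 0" using hop_eigen[OF w(3,4,5), of n] h by simp
  have kki: "kki w = inverse \<kappa> *s w" using w by (simp add: kki_flip)
  define \<mu> where "\<mu> = q powi (- 3 * int n) * \<kappa>"
  have zW: "u n w \<in> Wh" by (rule u_Wh[OF Y wY hw])
  have kz: "kk (u n w) = \<mu> *s u n w" by (simp add: kk_u w(3) u_scale \<mu>_def)
  have cz: "c1 (u n w) = (dq * q powi (3 - int n) * \<kappa> + dq * q powi (int n - 3) * inverse \<kappa>) *s u n w"
    unfolding c1_u[OF Y wY hw] w(3) kki u_add u_scale by (simp add: scale_left_distrib)
  have Z: "wsub ?Z" by (rule wsub_line[OF zW kz cz]) (use w(5) in \<open>simp add: \<mu>_def\<close>)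
  have zZ: "u n w \<in> ?Z" by (rule range_eqI[of _ _ 1]) simp
  have sub: "subspace ?Z" using Z by (simp add: wsub_def)
  have "w \<in> Sp UNIV ?Z" using Sp_full[OF Z zZ z0] by simp
  from Sp_val[OF sub this] obtain P where P: "fam ?Z P" "val P = w" by blast
  define Q where "Q = (\<Prod>(a, b, l)\<in>supp P. [:- (q powi (- 3 * (int a + int b)) * \<mu>), 1:])"
  have kB: "kk (B a b l y) = (q powi (- 3 * (int a + int b)) * \<mu>) *s B a b l y" if "y \<in> ?Z" for a b l y
    using that kz by (auto simp: kk_B mult_ac)
  note kl = kk_add kk_scale
  have "pop kk Q (val P) = 0"
    unfolding val_def pop_vsum[OF kl]
  proof (rule sum.neutral, clarify)
    fix a b l assume abl: "(a, b, l) \<in> supp P"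
    have "poly Q (q powi (- 3 * (int a + int b)) * \<mu>) = 0"
      unfolding Q_def poly_prod using abl fam_finite[OF P(1)] by (subst prod_zero_iff) (auto intro!: bexI[of _ "(a, b, l)"])
    then show "pop kk Q (B a b l (P a b l)) = 0"
      using pop_eigen[OF kl kB[OF fam_in[OF P(1)]]] by simp
  qed
  moreover have "pop kk Q w = poly Q \<kappa> *s w" by (rule pop_eigen[OF kl w(3)])
  moreover have "poly Q \<kappa> \<noteq> 0"
  proof -
    have "\<kappa> \<noteq> q powi (- 3 * (int a + int b)) * \<mu>" for a b :: nat
    proof
      assume "\<kappa> = q powi (- 3 * (int a + int b)) * \<mu>"
      then have "q powi (- 3 * (int a + int b) + (- 3 * int n)) = 1"
        using w(5) unfolding \<mu>_def by (simp only: power_int_add[OF disjI1[OF q0]]) simp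
      then show False using n unfolding q_powi_eq_1_iff by simp
    qed
    then show ?thesis unfolding Q_def poly_prod using fam_finite[OF P(1)] by (subst prod_zero_iff) auto
  qed
  ultimately show False using P(2) w(2) by simp
qed

end

theorem theorem5p10:
  fixes q \<alpha> :: complex
    and scale :: "complex \<Rightarrow> 'v::ab_group_add \<Rightarrow> 'v"
    and \<rho> :: "gen \<Rightarrow> 'v \<Rightarrow> 'v"
  assumes "q \<noteq> 0"
    and "\<forall>n::nat. n > 0 \<longrightarrow> q ^ n \<noteq> 1"
    and "\<alpha> \<noteq> 0"
    and "Uq_module q scale \<rho>"
    and "whittaker_Umod \<alpha> scale \<rho>"
    and "irreducible_Umod scale \<rho>"
  shows "\<exists>\<kappa> c. \<kappa> \<noteq> 0 \<and>
           ((\<not> critical q \<kappa> c \<and> iso_to_quot scale \<rho> (LV q \<alpha> \<kappa> c))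
          \<or> (critical q \<kappa> c \<and> iso_to_quot scale \<rho> (LVminus q \<alpha> \<kappa> c)))"
proof -
  interpret vector_space scale using assms(4) by (simp add: Uq_module_def)
  interpret uq_irr scale \<rho> q \<alpha>
  proof (intro uq_irr.intro uq_rep.intro lin_rep.intro lin_rep_axioms.intro uq_rep_axioms.intro uq_irr_axioms.intro)
    show "vector_space scale" using assms(4) by (simp add: Uq_module_def)
    show "Vector_Spaces.linear scale scale (\<rho> g)" for g using assms(4) by (simp add: Uq_module_def)
    show "act scale \<rho> r v = 0" if "r \<in> Uq_rels q" for r v using assms(4) that by (simp add: Uq_module_def)
    show "S = {0} \<or> S = UNIV" if "subspace S" "\<And>g x. x \<in> S \<Longrightarrow> \<rho> g x \<in> S" for S
      using assms(6) that unfolding irreducible_Umod_def by blast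
  qed (use assms in auto)
  obtain w0 where w0: "w0 \<noteq> 0" "\<rho> E1 w0 = scale \<alpha> w0" "\<rho> E2 w0 = 0"
    using assms(5) unfolding whittaker_Umod_def by blast
  then have "w0 \<in> Wh" by (simp add: Wh_def)
  \<comment> \<open>The given Whittaker vector is exchanged for an eigenvector w of K and C1, which
    is again a generator by irreducibility and becomes the image of the class of 1.\<close>
  from exists_eigenvector[OF this w0(1)] obtain w \<kappa> c
    where w: "w \<in> Wh" "w \<noteq> 0" "kk w = scale \<kappa> w" "c1 w = scale c w" "\<kappa> \<noteq> 0" by blast
  have gen: "{act scale \<rho> f w |f. ncfin f} = UNIV" using cyc_full[OF w(2)] by (simp add: cyc_def)
  \<comment> \<open>Both cases at once: X is the generating set of the kernel and J the set of
    surviving powers of F3.\<close>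
  have iso: "iso_to_quot scale \<rho> (ncspan X)"
    if X: "L_M q \<alpha> \<union> L_J q \<kappa> c \<subseteq> X" and left: "\<And>g x. x \<in> X \<Longrightarrow> ncmul (ncg g) x \<in> X"
      and ann: "\<And>x. x \<in> X \<Longrightarrow> ncfin x \<and> act scale \<rho> x w = 0"
      and J: "J = UNIV \<or> n \<ge> 1 \<and> J = {..<n} \<and> uel q \<alpha> n \<in> X"
      and h: "\<And>m. 1 \<le> m \<Longrightarrow> \<exists>b\<in>J. m \<le> b \<Longrightarrow> hfun q m \<kappa> c \<noteq> 0" for X J n
  proof -
    have leftL: "ncmul (ncg g) x \<in> ncspan X" if "x \<in> ncspan X" for g x
      using that by induction (auto simp: ncmul_ncadd_right ncmul_ncsc_right left intro: ncspan.intros)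
    have annL: "ncfin x \<and> act scale \<rho> x w = 0" if "x \<in> ncspan X" for x
      using that by induction (auto simp: ann)
    have J': "J = UNIV \<or> n \<ge> 1 \<and> J = {..<n} \<and> uel q \<alpha> n \<in> ncspan X"
      using J by (auto intro: ncspan.intros)
    have X': "L_M q \<alpha> \<union> L_J q \<kappa> c \<subseteq> ncspan X" using X by (auto intro: ncspan.intros)
    have "act scale \<rho> f w = 0 \<longleftrightarrow> f \<in> ncspan X" if "ncfin f" for f
      using annihilator_subset[OF w ncspan_zero ncspan_add ncspan_scale leftL X' _ J' h that] annL by blast
    then show ?thesis unfolding iso_to_quot_def using gen by blast
  qed
  show ?thesis
  proof (cases "critical q \<kappa> c")
    case False
    have "iso_to_quot scale \<rho> (LV q \<alpha> \<kappa> c)"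
      unfolding LV_def
    proof (rule iso[of _ UNIV])
      show "ncmul (ncg g) x \<in> L_M q \<alpha> \<union> L_J q \<kappa> c" if "x \<in> L_M q \<alpha> \<union> L_J q \<kappa> c" for g x
        using that L_M_left L_J_left by blast
    qed (use False LV_annihilates[OF w(1,3,4)] in \<open>auto simp: critical_def\<close>)
    then show ?thesis using False w(5) by blast
  next
    case True
    define n where "n = nminus q \<kappa> c"
    have n: "n \<ge> 1 \<and> hfun q n \<kappa> c = 0"
      unfolding n_def nminus_def using True unfolding critical_def by (rule LeastI_ex)
    \<comment> \<open>Minimality of n is exactly what independence for the powers of F3 below n asks
      for.\<close>
    have small: "hfun q m \<kappa> c \<noteq> 0" if "1 \<le> m" "m < n" for m
      using not_less_Least[of m "\<lambda>n. n \<ge> 1 \<and> hfun q n \<kappa> c = 0"] that unfolding n_def nminus_def by blast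
    have u0: "u n w = 0" using u_critical_zero[OF w] n by blast
    have "iso_to_quot scale \<rho> (LVminus q \<alpha> \<kappa> c)"
      unfolding LVminus_def n_def[symmetric]
    proof (rule iso[of _ "{..<n}" n])
      have "ncmul (ncc 1) (uel q \<alpha> n) \<in> {ncmul a (uel q \<alpha> n) |a. ncfin a}" using ncfin_ncc by blast
      then show "{..<n} = UNIV \<or> n \<ge> 1 \<and> {..<n} = {..<n} \<and> uel q \<alpha> n \<in> L_M q \<alpha> \<union> L_J q \<kappa> c \<union> {ncmul a (uel q \<alpha> n) |a. ncfin a}"
        using n by simp
      show "ncmul (ncg g) x \<in> L_M q \<alpha> \<union> L_J q \<kappa> c \<union> {ncmul a (uel q \<alpha> n) |a. ncfin a}"
        if "x \<in> L_M q \<alpha> \<union> L_J q \<kappa> c \<union> {ncmul a (uel q \<alpha> n) |a. ncfin a}" for g x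
        using that L_M_left L_J_left left_multiples_left by blast
      show "ncfin x \<and> act scale \<rho> x w = 0" if "x \<in> L_M q \<alpha> \<union> L_J q \<kappa> c \<union> {ncmul a (uel q \<alpha> n) |a. ncfin a}" for x
        using that LV_annihilates[OF w(1,3,4)] u0 by auto
    qed (use small in auto)
    then show ?thesis using True w(5) by blast
  qed
qed

end
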